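(* Consider the mechanical system with gyroscopic forces $(SO(3),m,\Pi,\varkappa)$ describing a rigid body about a fixed point, with closed 2-form $\varkappa=\varkappa_1\,\mathrm{d}\Lambda_1+\varkappa_2\,\mathrm{d}\Lambda_2+\varkappa_3\,\mathrm{d}\Lambda_3$, $\varkappa_i:SO(3)\to\mathbb{R}$, and with a potential depending only on $\alpha_1,\alpha_2,\alpha_3$, i.e. $\Pi=\Pi(\alpha_1,\alpha_2,\alpha_3)$. Then the system has an area integral if and only if the vector $\boldsymbol\kappa=(\varkappa_1,\varkappa_2,\varkappa_3)^T$ has on $SO(3)$ a representation $$\boldsymbol\kappa=F\,\boldsymbol\alpha+\operatorname{grad} f,$$ where $F=F(\alpha_1,\alpha_2,\alpha_3)$ and $f=f(\alpha_1,\alpha_2,\alpha_3)$ are functions depending only on $\alpha_1,\alpha_2,\alpha_3$, $\boldsymbol\alpha=(\alpha_1,\alpha_2,\alpha_3)^T$, and $\operatorname{grad} f=(\partial f/\partial\alpha_1,\partial f/\partial\alpha_2,\partial f/\partial\alpha_3)^T$.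
   Context: All objects are smooth. General notion. A mechanical system with gyroscopic forces is a 4-tuple $(M,m,\Pi,\varkappa)$: a smooth manifold $M$, a Riemannian metric $m=\langle\,,\rangle$, a function $\Pi:M\to\mathbb{R}$ (potential), and a closed 2-form $\varkappa$ on $M$. With $p_M:TM\to M$ the projection, put $H(w)=\frac12\langle w,w\rangle+\Pi(p_M(w))$, $\theta(w)Y=\langle w,Tp_M(Y)\rangle$ for $Y\in T_wTM$, and $\sigma=\mathrm{d}\theta+p_M^*\varkappa$ (a symplectic form on $TM$). The dynamics is the vector field $X$ on $TM$ with $\mathrm{i}_X\sigma=-\mathrm{d}H$, where $\mathrm{i}$ is contraction in the first argument. A first integral is a function on $TM$ constant along trajectories of $X$. Rigid body. Elements of $SO(3)$ are written as matrices $Q$ with rows $(\alpha_1,\alpha_2,\alpha_3)$, $(\alpha_1',\alpha_2',\alpha_3')$, $(\alpha_1'',\alpha_2'',\alpha_3'')$; the entries are regarded as functions on $SO(3)$. Let $\mathbf{f}$ be the canonical isomorphism from the space of skew-symmetric $3\times3$ matrices to $\mathbb{R}^3$, so that $\mathbf{f}^{-1}(\boldsymbol\omega)u=\boldsymbol\omega\times u$. A tangent vector $\Omega_Q\in T_QSO(3)$ is assigned the inner angular velocity $\boldsymbol\omega=\mathbf{f}(Q^{-1}\Omega_Q)\in\mathbb{R}^3$. The metric is $m_Q(\Omega_Q^1,\Omega_Q^2)=\mathbf{A}\boldsymbol\omega^1\cdot\boldsymbol\omega^2$, where $\mathbf{A}:\mathbb{R}^3\to\mathbb{R}^3$ is a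 symmetric positive definite operator (inertia tensor). The 1-forms $\Lambda_1,\Lambda_2,\Lambda_3$ on $SO(3)$ are (restrictions to $SO(3)$ of) $\Lambda_1=\alpha_3\mathrm{d}\alpha_2+\alpha_3'\mathrm{d}\alpha_2'+\alpha_3''\mathrm{d}\alpha_2''$, $\Lambda_2=\alpha_1\mathrm{d}\alpha_3+\alpha_1'\mathrm{d}\alpha_3'+\alpha_1''\mathrm{d}\alpha_3''$, $\Lambda_3=\alpha_2\mathrm{d}\alpha_1+\alpha_2'\mathrm{d}\alpha_1'+\alpha_2''\mathrm{d}\alpha_1''$; they give the components of $\boldsymbol\omega$ and satisfy $\mathrm{d}\Lambda_1=\Lambda_3\wedge\Lambda_2$, $\mathrm{d}\Lambda_2=\Lambda_1\wedge\Lambda_3$, $\mathrm{d}\Lambda_3=\Lambda_2\wedge\Lambda_1$, so every 2-form on $SO(3)$ is uniquely of the form $\sum_i\varkappa_i\,\mathrm{d}\Lambda_i$. Let $\Psi$ be the one-parameter group of diffeomorphisms of $SO(3)$ rotating the body about the first axis fixed in space (left multiplication by rotations about the first coordinate axis); its generating field is $v(Q)=Q\,\mathbf{f}^{-1}(\boldsymbol\alpha)$, $\boldsymbol\alpha=(\alpha_1,\alpha_2,\alpha_3)^T$. An area integral is a first integral of the form $G(w)=m_Q(v(Q),w)+g(Q)$, $w\in T_QSO(3)$, with some smooth function $g:SO(3)\to\mathbb{R}$. A function of $\alpha_1,\alpha_2,\alpha_3$ is a function on $SO(3)$ that factors through the map $Q\mapsto\boldsymbol\alpha$ onto the Poisson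 sphere $\alpha_1^2+\alpha_2^2+\alpha_3^2=1$; to form $\operatorname{grad} f$, $f$ is regarded as a smooth function of three variables defined in a neighbourhood of this sphere in $\mathbb{R}^3$. *)

theory Defs
  imports "HOL-Analysis.Analysis"
begin

section \<open>Smooth calculus on subsets of Euclidean spaces\<close>

text \<open>
  Manifolds are embedded submanifolds \<open>M\<close> of a Euclidean space.  Functions and forms on \<open>M\<close> are
  functions on the ambient space of which only the values at points of \<open>M\<close> and at vectors tangent
  to \<open>M\<close> matter.  Smoothness and the exterior derivative are expressed through local smooth
  extensions to the ambient space.
\<close>

primrec times_differentiable_on ::
  "nat \<Rightarrow> 'a::real_normed_vector set \<Rightarrow> ('a \<Rightarrow> 'b::real_normed_vector) \<Rightarrow> bool" where
  "times_differentiable_on 0 U f \<longleftrightarrow> continuous_on U f"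
| "times_differentiable_on (Suc n) U f \<longleftrightarrow>
     (\<forall>x\<in>U. f differentiable (at x)) \<and>
     (\<forall>v. times_differentiable_on n U (\<lambda>x. frechet_derivative f (at x) v))"

text \<open>Only meant for open \<open>U\<close>.\<close>

definition smooth_on ::
  "'a::real_normed_vector set \<Rightarrow> ('a \<Rightarrow> 'b::real_normed_vector) \<Rightarrow> bool" where
  "smooth_on U f \<longleftrightarrow> (\<forall>n. times_differentiable_on n U f)"

definition local_extension ::
  "'a::euclidean_space set \<Rightarrow> ('a \<Rightarrow> 'b::real_normed_vector) \<Rightarrow> 'a \<Rightarrow> 'a set \<Rightarrow> ('a \<Rightarrow> 'b) \<Rightarrow> bool" where
  "local_extension M f x U g \<longleftrightarrow>
     open U \<and> x \<in> U \<and> smooth_on U g \<and> (\<forall>y\<in>U \<inter> M. g y = f y)"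

definition smooth_function ::
  "'a::euclidean_space set \<Rightarrow> ('a \<Rightarrow> 'b::real_normed_vector) \<Rightarrow> bool" where
  "smooth_function M f \<longleftrightarrow> (\<forall>x\<in>M. \<exists>U g. local_extension M f x U g)"

definition tangent_space :: "'a::euclidean_space set \<Rightarrow> 'a \<Rightarrow> 'a set" where
  "tangent_space M x =
     {v. \<exists>(c::real \<Rightarrow> 'a) e. e > 0 \<and> smooth_on {-e<..<e} c \<and> c ` {-e<..<e} \<subseteq> M \<and>
           c 0 = x \<and> (c has_vector_derivative v) (at 0)}"

definition tangent_bundle :: "'a::euclidean_space set \<Rightarrow> ('a \<times> 'a) set" where
  "tangent_bundle M = {(x, v). x \<in> M \<and> v \<in> tangent_space M x}"

definition differential ::
  "'a::euclidean_space set \<Rightarrow> ('a \<Rightarrow> real) \<Rightarrow> 'a \<Rightarrow> 'a \<Rightarrow> real" where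
  "differential M f x v =
     (THE r. \<exists>U g. local_extension M f x U g \<and> r = frechet_derivative g (at x) v)"

definition local_one_form_extension ::
  "'a::euclidean_space set \<Rightarrow> ('a \<Rightarrow> 'a \<Rightarrow> real) \<Rightarrow> 'a \<Rightarrow> 'a set \<Rightarrow> ('a \<Rightarrow> 'a \<Rightarrow> real) \<Rightarrow> bool" where
  "local_one_form_extension M \<theta> x U \<eta> \<longleftrightarrow>
     open U \<and> x \<in> U \<and>
     (\<forall>y\<in>U. linear (\<eta> y)) \<and> (\<forall>v. smooth_on U (\<lambda>y. \<eta> y v)) \<and>
     (\<forall>y\<in>U \<inter> M. \<forall>v\<in>tangent_space M y. \<eta> y v = \<theta> y v)"

text \<open>
  For constant ambient vector fields the Lie bracket term of the exterior derivative vanishes.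
  The value is determined when \<open>\<theta>\<close> is smooth and \<open>u\<close>, \<open>v\<close> are tangent to the submanifold \<open>M\<close> at
  \<open>x\<close>.  No factor \<open>1/2\<close> is used.
\<close>

definition ext_deriv1 ::
  "'a::euclidean_space set \<Rightarrow> ('a \<Rightarrow> 'a \<Rightarrow> real) \<Rightarrow> 'a \<Rightarrow> 'a \<Rightarrow> 'a \<Rightarrow> real" where
  "ext_deriv1 M \<theta> x u v =
     (THE r. \<exists>U \<eta>. local_one_form_extension M \<theta> x U \<eta> \<and>
        r = frechet_derivative (\<lambda>y. \<eta> y v) (at x) u - frechet_derivative (\<lambda>y. \<eta> y u) (at x) v)"

definition local_two_form_extension ::
  "'a::euclidean_space set \<Rightarrow> ('a \<Rightarrow> 'a \<Rightarrow> 'a \<Rightarrow> real) \<Rightarrow> 'a \<Rightarrow> 'a set \<Rightarrow>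
     ('a \<Rightarrow> 'a \<Rightarrow> 'a \<Rightarrow> real) \<Rightarrow> bool" where
  "local_two_form_extension M \<omega> x U \<beta> \<longleftrightarrow>
     open U \<and> x \<in> U \<and>
     (\<forall>y\<in>U. bilinear (\<beta> y) \<and> (\<forall>v. \<beta> y v v = 0)) \<and>
     (\<forall>u v. smooth_on U (\<lambda>y. \<beta> y u v)) \<and>
     (\<forall>y\<in>U \<inter> M. \<forall>u\<in>tangent_space M y. \<forall>v\<in>tangent_space M y. \<beta> y u v = \<omega> y u v)"

definition smooth_two_form ::
  "'a::euclidean_space set \<Rightarrow> ('a \<Rightarrow> 'a \<Rightarrow> 'a \<Rightarrow> real) \<Rightarrow> bool" where
  "smooth_two_form M \<omega> \<longleftrightarrow> (\<forall>x\<in>M. \<exists>U \<beta>. local_two_form_extension M \<omega> x U \<beta>)"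

definition ext_deriv2 ::
  "'a::euclidean_space set \<Rightarrow> ('a \<Rightarrow> 'a \<Rightarrow> 'a \<Rightarrow> real) \<Rightarrow> 'a \<Rightarrow> 'a \<Rightarrow> 'a \<Rightarrow> 'a \<Rightarrow> real" where
  "ext_deriv2 M \<omega> x u v w =
     (THE r. \<exists>U \<beta>. local_two_form_extension M \<omega> x U \<beta> \<and>
        r = frechet_derivative (\<lambda>y. \<beta> y v w) (at x) u
          - frechet_derivative (\<lambda>y. \<beta> y u w) (at x) v
          + frechet_derivative (\<lambda>y. \<beta> y u v) (at x) w)"

definition closed_two_form ::
  "'a::euclidean_space set \<Rightarrow> ('a \<Rightarrow> 'a \<Rightarrow> 'a \<Rightarrow> real) \<Rightarrow> bool" where
  "closed_two_form M \<omega> \<longleftrightarrow>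
     smooth_two_form M \<omega> \<and>
     (\<forall>x\<in>M. \<forall>u\<in>tangent_space M x. \<forall>v\<in>tangent_space M x. \<forall>w\<in>tangent_space M x.
        ext_deriv2 M \<omega> x u v w = 0)"

definition gradient :: "(real^'n \<Rightarrow> real) \<Rightarrow> real^'n \<Rightarrow> real^'n" where
  "gradient f x = (\<chi> i. frechet_derivative f (at x) (axis i 1))"


section \<open>Mechanical systems with gyroscopic forces\<close>

record 'a gyro_system =
  config :: "'a set"
  metric :: "'a \<Rightarrow> 'a \<Rightarrow> 'a \<Rightarrow> real"
  potential :: "'a \<Rightarrow> real"
  gyro :: "'a \<Rightarrow> 'a \<Rightarrow> 'a \<Rightarrow> real"

text \<open>
  A point of \<open>TM\<close> is a pair \<open>(x, v)\<close>, so the projection \<open>TM \<rightarrow> M\<close> and its tangent map are both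
  the first projection of pairs.
\<close>

definition hamiltonian :: "'a::euclidean_space gyro_system \<Rightarrow> 'a \<times> 'a \<Rightarrow> real" where
  "hamiltonian S w = metric S (fst w) (snd w) (snd w) / 2 + potential S (fst w)"

definition liouville_form :: "'a::euclidean_space gyro_system \<Rightarrow> 'a \<times> 'a \<Rightarrow> 'a \<times> 'a \<Rightarrow> real" where
  "liouville_form S w Y = metric S (fst w) (snd w) (fst Y)"

definition symplectic_form ::
  "'a::euclidean_space gyro_system \<Rightarrow> 'a \<times> 'a \<Rightarrow> 'a \<times> 'a \<Rightarrow> 'a \<times> 'a \<Rightarrow> real" where
  "symplectic_form S w Y Z =
     ext_deriv1 (tangent_bundle (config S)) (liouville_form S) w Y Z
     + gyro S (fst w) (fst Y) (fst Z)"

definition dynamics :: "'a::euclidean_space gyro_system \<Rightarrow> 'a \<times> 'a \<Rightarrow> 'a \<times> 'a" where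
  "dynamics S w =
     (THE X. X \<in> tangent_space (tangent_bundle (config S)) w \<and>
        (\<forall>Y\<in>tangent_space (tangent_bundle (config S)) w.
           symplectic_form S w X Y
             = - differential (tangent_bundle (config S)) (hamiltonian S) w Y))"

definition trajectory ::
  "'a::euclidean_space gyro_system \<Rightarrow> real set \<Rightarrow> (real \<Rightarrow> 'a \<times> 'a) \<Rightarrow> bool" where
  "trajectory S I c \<longleftrightarrow>
     open I \<and> is_interval I \<and>
     (\<forall>t\<in>I. c t \<in> tangent_bundle (config S) \<and>
            (c has_vector_derivative dynamics S (c t)) (at t))"

definition first_integral :: "'a::euclidean_space gyro_system \<Rightarrow> ('a \<times> 'a \<Rightarrow> real) \<Rightarrow> bool" where
  "first_integral S G \<longleftrightarrow>
     (\<forall>I c. trajectory S I c \<longrightarrow> (\<forall>s\<in>I. \<forall>t\<in>I. G (c s) = G (c t)))"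


section \<open>The rigid body with a fixed point\<close>

definition SO3 :: "(real^3^3) set" where
  "SO3 = {Q. rotation_matrix Q}"

definition hat :: "real^3 \<Rightarrow> real^3^3" where
  "hat \<omega> = matrix (cross3 \<omega>)"

text \<open>
  \<open>hat\<close> is a bijection onto the skew-symmetric matrices; for \<open>Q \<in> SO3\<close> and \<open>\<Omega>\<close> tangent to \<open>SO3\<close> at
  \<open>Q\<close> the matrix \<open>Q\<inverse> \<Omega>\<close> is skew-symmetric.
\<close>

definition angular_velocity :: "real^3^3 \<Rightarrow> real^3^3 \<Rightarrow> real^3" where
  "angular_velocity Q \<Omega> = inv hat (matrix_inv Q ** \<Omega>)"

definition body_metric :: "(real^3 \<Rightarrow> real^3) \<Rightarrow> real^3^3 \<Rightarrow> real^3^3 \<Rightarrow> real^3^3 \<Rightarrow> real" where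
  "body_metric A Q \<Omega>\<^sub>1 \<Omega>\<^sub>2 = A (angular_velocity Q \<Omega>\<^sub>1) \<bullet> angular_velocity Q \<Omega>\<^sub>2"

text \<open>The differential of a matrix entry is the corresponding entry of the tangent vector.\<close>

definition Lambda1 :: "real^3^3 \<Rightarrow> real^3^3 \<Rightarrow> real" where
  "Lambda1 Q \<Omega> = Q$1$3 * \<Omega>$1$2 + Q$2$3 * \<Omega>$2$2 + Q$3$3 * \<Omega>$3$2"

definition Lambda2 :: "real^3^3 \<Rightarrow> real^3^3 \<Rightarrow> real" where
  "Lambda2 Q \<Omega> = Q$1$1 * \<Omega>$1$3 + Q$2$1 * \<Omega>$2$3 + Q$3$1 * \<Omega>$3$3"

definition Lambda3 :: "real^3^3 \<Rightarrow> real^3^3 \<Rightarrow> real" where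
  "Lambda3 Q \<Omega> = Q$1$2 * \<Omega>$1$1 + Q$2$2 * \<Omega>$2$1 + Q$3$2 * \<Omega>$3$1"

definition gyro_form :: "(real^3^3 \<Rightarrow> real^3) \<Rightarrow> real^3^3 \<Rightarrow> real^3^3 \<Rightarrow> real^3^3 \<Rightarrow> real" where
  "gyro_form \<kappa> Q u v =
     \<kappa> Q $ 1 * ext_deriv1 SO3 Lambda1 Q u v
     + \<kappa> Q $ 2 * ext_deriv1 SO3 Lambda2 Q u v
     + \<kappa> Q $ 3 * ext_deriv1 SO3 Lambda3 Q u v"

definition rigid_body ::
  "(real^3 \<Rightarrow> real^3) \<Rightarrow> (real^3^3 \<Rightarrow> real) \<Rightarrow> (real^3^3 \<Rightarrow> real^3) \<Rightarrow> (real^3^3) gyro_system" where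
  "rigid_body A V \<kappa> =
     \<lparr>config = SO3, metric = body_metric A, potential = V, gyro = gyro_form \<kappa>\<rparr>"

definition inertia_tensor :: "(real^3 \<Rightarrow> real^3) \<Rightarrow> bool" where
  "inertia_tensor A \<longleftrightarrow>
     linear A \<and> (\<forall>u v. A u \<bullet> v = u \<bullet> A v) \<and> (\<forall>u. u \<noteq> 0 \<longrightarrow> A u \<bullet> u > 0)"

definition alpha :: "real^3^3 \<Rightarrow> real^3" where
  "alpha Q = row 1 Q"

text \<open>A smooth function on \<open>SO3\<close> that factors through \<open>alpha\<close>.\<close>

definition function_of_alpha :: "(real^3^3 \<Rightarrow> real) \<Rightarrow> bool" where
  "function_of_alpha F \<longleftrightarrow>
     smooth_function SO3 F \<and> (\<exists>\<phi>. \<forall>Q\<in>SO3. F Q = \<phi> (alpha Q))"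

text \<open>The field generating the left multiplications by rotations about the first axis.\<close>

definition rotation_field :: "real^3^3 \<Rightarrow> real^3^3" where
  "rotation_field Q = Q ** hat (alpha Q)"

definition has_area_integral :: "(real^3^3) gyro_system \<Rightarrow> bool" where
  "has_area_integral S \<longleftrightarrow>
     (\<exists>g. smooth_function SO3 g \<and>
        first_integral S (\<lambda>w. metric S (fst w) (rotation_field (fst w)) (snd w) + g (fst w)))"

end

theory Submission
  imports Defs
begin

text \<open>
  In the trivialisation \<open>\<Omega> = Q ** hat w\<close> of the tangent bundle of \<open>SO3\<close>, a tangent vector of the bundle
  is a pair \<open>(a, p)\<close> of the body angular velocity \<open>a\<close> of \<open>Q\<close> and the derivative \<open>p\<close> of \<open>w\<close>.  There the
  symplectic form is
  \<open>A p \<bullet> b - A q \<bullet> a - (A w + \<kappa> Q) \<bullet> (a \<times> b)\<close> (\<open>symplectic_form_rigid_body\<close>), so the dynamics is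
  \<open>Q' = Q ** hat w\<close>, \<open>A w' = (A w + \<kappa> Q) \<times> w - \<nabla>V\<close> (\<open>dynamics_rigid_body\<close>), where the components of
  \<open>\<nabla>V\<close> are the derivatives of \<open>V\<close> along the fields \<open>Q ** hat e\<^sub>i\<close>.  Let \<open>\<alpha>\<close> be the first row of \<open>Q\<close>, so
  that \<open>\<alpha>' = \<alpha> \<times> w\<close>.  In the derivative of \<open>A \<alpha> \<bullet> w + g(Q)\<close> along a trajectory the terms quadratic in
  \<open>w\<close> cancel, and the potential drops out because it is constant along the rotations about the first
  axis.  What remains is \<open>dg(Q ** hat w) - \<kappa> \<bullet> (\<alpha> \<times> w)\<close> (\<open>area_integral_derivative\<close>).

  Trajectories pass through every point of the bundle, so an area integral with the function \<open>g\<close> exists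
  if and only if \<open>dg(Q ** hat w) = \<kappa> \<bullet> (\<alpha> \<times> w)\<close> for all \<open>Q\<close> and \<open>w\<close> (\<open>has_area_integral_iff\<close>).

  If \<open>\<kappa> = F \<alpha> + grad f\<close>, then \<open>g = f(\<alpha>)\<close> satisfies this, since \<open>\<alpha> \<bullet> (\<alpha> \<times> w) = 0\<close>.  Conversely, let \<open>g\<close>
  satisfy it.  Taking \<open>w = \<alpha>\<close> shows that \<open>g\<close> is constant on the orbits of the rotations about the first
  axis, which are the fibres of \<open>\<alpha>\<close> (\<open>alpha_fibre\<close>); hence \<open>g = f(\<alpha>)\<close> with a smooth \<open>f\<close>
  (\<open>function_of_alpha_extension\<close>).  Then \<open>\<kappa> - grad f\<close> is orthogonal to every \<open>\<alpha> \<times> w\<close>, hence a multiple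
  \<open>F \<alpha>\<close> of \<open>\<alpha>\<close>.  That \<open>F\<close> is a function of \<open>\<alpha>\<close> is where the closedness of the gyroscopic form enters: it
  says that the divergence \<open>\<Sum>\<^sub>i d\<kappa>\<^sub>i(Q ** hat e\<^sub>i)\<close> vanishes (\<open>closed_gyro_form_divergence\<close>), and the
  gradient part contributes nothing to it because second derivatives commute, so the derivative of \<open>F\<close>
  along the orbits is zero (\<open>coefficient_invariant\<close>).

  The analytic tools are smooth calculus, uniqueness of the exterior derivative of a form on a
  submanifold, and local solvability of smooth ordinary differential equations.
\<close>

section \<open>Smooth functions\<close>

lemma times_differentiable_on_cong:
  assumes "open U" "\<And>x. x \<in> U \<Longrightarrow> f x = g x" "times_differentiable_on n U f"
  shows "times_differentiable_on n U g"
  using assms(2,3)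
proof (induction n arbitrary: f g)
  case 0
  have "continuous_on U f" using "0.prems"(2) by simp
  then show ?case using continuous_on_cong[OF refl, of U f g] "0.prems"(1) by fastforce
next
  case (Suc n)
  have d: "(f has_derivative frechet_derivative f (at x)) (at x)" if "x \<in> U" for x
    using Suc.prems(2) that by (simp add: frechet_derivative_works)
  have d': "(g has_derivative frechet_derivative f (at x)) (at x)" if "x \<in> U" for x
    by (rule has_derivative_transform_within_open[OF d[OF that] assms(1) that])
       (rule Suc.prems(1))
  have eq: "frechet_derivative f (at x) v = frechet_derivative g (at x) v" if "x \<in> U" for x v
    using frechet_derivative_at[OF d'[OF that]] by simp
  have "times_differentiable_on n U (\<lambda>x. frechet_derivative f (at x) v)" for v
    using Suc.prems(2) by simp
  from Suc.IH[OF eq this]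
  have "times_differentiable_on n U (\<lambda>x. frechet_derivative g (at x) v)" for v .
  moreover have "g differentiable at x" if "x \<in> U" for x
    using d'[OF that] by (rule differentiableI)
  ultimately show ?case by simp
qed

lemma times_differentiable_on_continuous:
  "times_differentiable_on n U f \<Longrightarrow> continuous_on U f"
  by (cases n) (auto intro!: differentiable_imp_continuous_on differentiable_at_imp_differentiable_on)

text \<open>
  The algebraic closure properties below follow one pattern: an explicit derivative is built from the
  functions and their derivatives by the same operations, so that the induction hypothesis applies
  to it.
\<close>

lemma times_differentiable_on_SucI:
  assumes "open U" "\<And>x. x \<in> U \<Longrightarrow> (f has_derivative D x) (at x)"
    and "\<And>v. times_differentiable_on n U (\<lambda>x. D x v)"
  shows "times_differentiable_on (Suc n) U f"
proof -
  have "times_differentiable_on n U (\<lambda>x. frechet_derivative f (at x) v)" for v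
    by (rule times_differentiable_on_cong[OF assms(1) _ assms(3)])
       (simp add: frechet_derivative_at[OF assms(2), symmetric])
  moreover have "f differentiable at x" if "x \<in> U" for x
    using assms(2)[OF that] by (rule differentiableI)
  ultimately show ?thesis by simp
qed

lemma times_differentiable_on_Suc:
  "times_differentiable_on (Suc n) U f \<Longrightarrow> times_differentiable_on n U f"
proof (induction n arbitrary: f)
  case 0
  then show ?case by (metis times_differentiable_on.simps(1) times_differentiable_on_continuous)
qed auto

lemma times_differentiable_on_subset:
  "V \<subseteq> U \<Longrightarrow> times_differentiable_on n U f \<Longrightarrow> times_differentiable_on n V f"
  by (induction n arbitrary: f) (auto intro: continuous_on_subset)

lemma times_differentiable_on_local:
  assumes "\<And>x. x \<in> U \<Longrightarrow> \<exists>W. open W \<and> x \<in> W \<and> times_differentiable_on n W f"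
  shows "times_differentiable_on n U f"
  using assms
proof (induction n arbitrary: f)
  case 0
  then have "continuous (at x) f" if "x \<in> U" for x
    using that continuous_on_eq_continuous_at by (metis times_differentiable_on.simps(1))
  then show ?case
    by (simp add: continuous_at_imp_continuous_on)
next
  case (Suc n)
  have "f differentiable at x" if "x \<in> U" for x using Suc.prems[OF that] by auto
  moreover have "times_differentiable_on n U (\<lambda>x. frechet_derivative f (at x) v)" for v
    using Suc.prems by (intro Suc.IH) (metis times_differentiable_on.simps(2))
  ultimately show ?case by simp
qed

lemma times_differentiable_on_const: "times_differentiable_on n U (\<lambda>x. c)"
  by (induction n arbitrary: c) auto

lemma times_differentiable_on_bounded_linear:
  assumes "open U" "bounded_linear h" "times_differentiable_on n U f"
  shows "times_differentiable_on n U (\<lambda>x. h (f x))"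
  using assms(3)
proof (induction n arbitrary: f)
  case 0
  then show ?case by (simp add: assms(2) bounded_linear.continuous_on)
next
  case (Suc n)
  have D: "((\<lambda>x. h (f x)) has_derivative (\<lambda>v. h (frechet_derivative f (at x) v))) (at x)"
    if "x \<in> U" for x
    using Suc.prems that
    by (intro bounded_linear.has_derivative[OF assms(2)]) (simp add: frechet_derivative_works)
  show ?case
    using Suc.prems by (intro times_differentiable_on_SucI[OF assms(1) D] Suc.IH) simp_all
qed

lemma times_differentiable_on_add:
  assumes "open U" "times_differentiable_on n U f" "times_differentiable_on n U g"
  shows "times_differentiable_on n U (\<lambda>x. f x + g x)"
  using assms(2,3)
proof (induction n arbitrary: f g)
  case 0
  then show ?case by (simp add: continuous_on_add)
next
  case (Suc n)
  have D: "((\<lambda>x. f x + g x) has_derivative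
      (\<lambda>v. frechet_derivative f (at x) v + frechet_derivative g (at x) v)) (at x)"
    if "x \<in> U" for x
    using Suc.prems that by (intro has_derivative_add) (simp_all add: frechet_derivative_works)
  show ?case
    using Suc.prems by (intro times_differentiable_on_SucI[OF assms(1) D] Suc.IH) simp_all
qed

lemma times_differentiable_on_bilinear:
  assumes "open U" "bounded_bilinear p" "times_differentiable_on n U f" "times_differentiable_on n U g"
  shows "times_differentiable_on n U (\<lambda>x. p (f x) (g x))"
  using assms(3,4)
proof (induction n arbitrary: f g)
  case 0
  then show ?case by (simp add: assms(2) bounded_bilinear.continuous_on)
next
  case (Suc n)
  have D: "((\<lambda>x. p (f x) (g x)) has_derivative
      (\<lambda>v. p (f x) (frechet_derivative g (at x) v) + p (frechet_derivative f (at x) v) (g x))) (at x)"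
    if "x \<in> U" for x
    using Suc.prems that
    by (intro bounded_bilinear.FDERIV[OF assms(2)]) (simp_all add: frechet_derivative_works)
  note low = times_differentiable_on_Suc[OF Suc.prems(1)] times_differentiable_on_Suc[OF Suc.prems(2)]
  show ?case
    using Suc.prems by (intro times_differentiable_on_SucI[OF assms(1) D]
        times_differentiable_on_add[OF assms(1)] Suc.IH low) simp_all
qed

lemma times_differentiable_on_sum:
  assumes "open U" "\<And>i. i \<in> I \<Longrightarrow> times_differentiable_on n U (f i)"
  shows "times_differentiable_on n U (\<lambda>x. \<Sum>i\<in>I. f i x)"
  using assms(2)
proof (induction I rule: infinite_finite_induct)
  case (insert i I)
  then show ?case using times_differentiable_on_add[OF assms(1), of n "f i"] by simp
qed (simp_all add: times_differentiable_on_const)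

lemma linear_basis_expansion:
  fixes f :: "'a::euclidean_space \<Rightarrow> 'b::real_vector"
  assumes "linear f"
  shows "f v = (\<Sum>b\<in>Basis. (v \<bullet> b) *\<^sub>R f b)"
proof -
  have "f v = f (\<Sum>b\<in>Basis. (v \<bullet> b) *\<^sub>R b)" by (simp only: euclidean_representation)
  also have "\<dots> = (\<Sum>b\<in>Basis. (v \<bullet> b) *\<^sub>R f b)"
    by (simp only: linear_sum[OF assms] linear_scale[OF assms])
  finally show ?thesis .
qed

lemma linear_axis_expansion:
  fixes f :: "real^'n \<Rightarrow> 'b::real_vector"
  assumes "linear f"
  shows "f v = (\<Sum>i\<in>UNIV. (v $ i) *\<^sub>R f (axis i 1))"
proof -
  have "f v = f (\<Sum>i\<in>UNIV. (v $ i) *\<^sub>R axis i 1)"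
    using basis_expansion[of v] by (simp add: scalar_mult_eq_scaleR)
  then show ?thesis by (simp only: linear_sum[OF assms] linear_scale[OF assms])
qed

text \<open>
  The chain rule is written in coordinates, which turns the derivative of the composition into a
  sum of products of compositions of lower order.
\<close>

lemma times_differentiable_on_compose:
  fixes g :: "'a::real_normed_vector \<Rightarrow> 'b::euclidean_space"
    and f :: "'b \<Rightarrow> 'c::real_normed_vector"
  assumes "open U" "times_differentiable_on n U g" "times_differentiable_on n W f" "g ` U \<subseteq> W"
  shows "times_differentiable_on n U (\<lambda>x. f (g x))"
  using assms(2,3)
proof (induction n arbitrary: f)
  case 0
  then show ?case using assms(4)
    by (auto intro: continuous_on_compose2)
next
  case (Suc n)
  let ?D = "\<lambda>x v. \<Sum>b\<in>Basis. (frechet_derivative g (at x) v \<bullet> b) *\<^sub>R frechet_derivative f (at (g x)) b"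
  have D: "((\<lambda>x. f (g x)) has_derivative ?D x) (at x)" if "x \<in> U" for x
  proof -
    have f: "(f has_derivative frechet_derivative f (at (g x))) (at (g x))"
      using Suc.prems that assms(4) by (auto simp: frechet_derivative_works)
    then have lin: "linear (frechet_derivative f (at (g x)))"
      by (rule has_derivative_linear)
    have "((\<lambda>x. f (g x)) has_derivative
        (\<lambda>v. frechet_derivative f (at (g x)) (frechet_derivative g (at x) v))) (at x)"
      by (rule has_derivative_compose[where f = g, OF _ f]) (use Suc.prems(1) that in \<open>simp add: frechet_derivative_works\<close>)
    moreover have "frechet_derivative f (at (g x)) w
        = (\<Sum>b\<in>Basis. (w \<bullet> b) *\<^sub>R frechet_derivative f (at (g x)) b)" for w
      by (rule linear_basis_expansion[OF lin])
    ultimately show ?thesis by (rule has_derivative_eq_rhs[OF _ ext])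
  qed
  have g': "times_differentiable_on n U (\<lambda>x. frechet_derivative g (at x) v \<bullet> b)" for v b
    using Suc.prems(1) by (intro times_differentiable_on_bounded_linear[OF assms(1)
        bounded_linear_inner_left]) simp
  have f': "times_differentiable_on n U (\<lambda>x. frechet_derivative f (at (g x)) b)" for b
    using Suc.prems(2) by (intro Suc.IH[OF times_differentiable_on_Suc[OF Suc.prems(1)]]) simp
  show ?case
    by (rule times_differentiable_on_SucI[OF assms(1) D], assumption,
        rule times_differentiable_on_sum[OF assms(1)],
        rule times_differentiable_on_bilinear[OF assms(1) bounded_bilinear_scaleR g' f'])
qed

text \<open>
  The derivative is again a product with a real power of \<open>f\<close>, so the induction runs over all
  exponents at once.  The exponents \<open>-1\<close> and \<open>-1/2\<close> give reciprocals and normalisation.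
\<close>

lemma times_differentiable_on_powr:
  fixes f :: "'a::real_normed_vector \<Rightarrow> real"
  assumes "open U" "times_differentiable_on n U f" "\<And>x. x \<in> U \<Longrightarrow> f x > 0"
  shows "times_differentiable_on n U (\<lambda>x. f x powr r)"
  using assms(2)
proof (induction n arbitrary: r)
  case 0
  then show ?case using assms(3) by (force intro!: continuous_on_powr)
next
  case (Suc n)
  let ?D = "\<lambda>x v. frechet_derivative f (at x) v *\<^sub>R (r * f x powr (r - 1))"
  have D: "((\<lambda>x. f x powr r) has_derivative ?D x) (at x)" if "x \<in> U" for x
  proof -
    have f: "(f has_derivative frechet_derivative f (at x)) (at x)"
      using Suc.prems that by (simp add: frechet_derivative_works)
    show ?thesis
      using assms(3)[OF that] 
      by (auto intro!: derivative_eq_intros f simp: powr_diff algebra_simps)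
  qed
  have f': "times_differentiable_on n U (\<lambda>x. frechet_derivative f (at x) v)" for v
    using Suc.prems by simp
  have low: "times_differentiable_on n U (\<lambda>x. r * f x powr (r - 1))"
    by (rule times_differentiable_on_bilinear[OF assms(1) bounded_bilinear_mult
          times_differentiable_on_const Suc.IH[OF times_differentiable_on_Suc[OF Suc.prems]]])
  show ?case
    by (rule times_differentiable_on_SucI[OF assms(1) D], assumption,
        rule times_differentiable_on_bilinear[OF assms(1) bounded_bilinear_scaleR f' low])
qed

lemma smooth_on_cong: "open U \<Longrightarrow> (\<And>x. x \<in> U \<Longrightarrow> f x = g x) \<Longrightarrow> smooth_on U f \<Longrightarrow> smooth_on U g"
  unfolding smooth_on_def using times_differentiable_on_cong by metis

lemma smooth_on_subset: "smooth_on U f \<Longrightarrow> V \<subseteq> U \<Longrightarrow> smooth_on V f"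
  unfolding smooth_on_def using times_differentiable_on_subset by metis

lemma smooth_on_local:
  "(\<And>x. x \<in> U \<Longrightarrow> \<exists>W. open W \<and> x \<in> W \<and> smooth_on W f) \<Longrightarrow> smooth_on U f"
  unfolding smooth_on_def using times_differentiable_on_local by metis

lemma smooth_on_const: "smooth_on U (\<lambda>x. c)"
  by (simp add: smooth_on_def times_differentiable_on_const)

lemma smooth_on_bounded_linear_comp:
  "open U \<Longrightarrow> bounded_linear h \<Longrightarrow> smooth_on U f \<Longrightarrow> smooth_on U (\<lambda>x. h (f x))"
  by (simp add: smooth_on_def times_differentiable_on_bounded_linear)

lemma smooth_on_add:
  "open U \<Longrightarrow> smooth_on U f \<Longrightarrow> smooth_on U g \<Longrightarrow> smooth_on U (\<lambda>x. f x + g x)"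
  by (simp add: smooth_on_def times_differentiable_on_add)

lemma smooth_on_bilinear:
  "open U \<Longrightarrow> bounded_bilinear p \<Longrightarrow> smooth_on U f \<Longrightarrow> smooth_on U g \<Longrightarrow> smooth_on U (\<lambda>x. p (f x) (g x))"
  by (simp add: smooth_on_def times_differentiable_on_bilinear)

lemma smooth_on_sum:
  "open U \<Longrightarrow> (\<And>i. i \<in> I \<Longrightarrow> smooth_on U (f i)) \<Longrightarrow> smooth_on U (\<lambda>x. \<Sum>i\<in>I. f i x)"
  by (simp add: smooth_on_def times_differentiable_on_sum)

lemma smooth_on_compose:
  fixes g :: "'a::real_normed_vector \<Rightarrow> 'b::euclidean_space"
  shows "open U \<Longrightarrow> smooth_on U g \<Longrightarrow> smooth_on W f \<Longrightarrow> g ` U \<subseteq> W \<Longrightarrow> smooth_on U (\<lambda>x. f (g x))"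
  unfolding smooth_on_def by (metis times_differentiable_on_compose)

lemma smooth_on_powr:
  fixes f :: "'a::real_normed_vector \<Rightarrow> real"
  shows "open U \<Longrightarrow> smooth_on U f \<Longrightarrow> (\<And>x. x \<in> U \<Longrightarrow> f x > 0) \<Longrightarrow> smooth_on U (\<lambda>x. f x powr r)"
  by (simp add: smooth_on_def times_differentiable_on_powr)

lemma smooth_on_frechet_derivative:
  "smooth_on U f \<Longrightarrow> smooth_on U (\<lambda>x. frechet_derivative f (at x) v)"
  unfolding smooth_on_def by (metis times_differentiable_on.simps(2))

lemma smooth_on_has_derivative:
  "smooth_on U f \<Longrightarrow> x \<in> U \<Longrightarrow> (f has_derivative frechet_derivative f (at x)) (at x)"
  unfolding smooth_on_def
  by (metis frechet_derivative_works times_differentiable_on.simps(2))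

lemma smooth_on_continuous: "smooth_on U f \<Longrightarrow> continuous_on U f"
  unfolding smooth_on_def by (metis times_differentiable_on_continuous)

lemma smooth_on_bounded_linear:
  assumes "open U" "bounded_linear h" shows "smooth_on U h"
proof -
  have "times_differentiable_on n U (\<lambda>x. x)" for n
    using times_differentiable_on_const[of _ U] by (cases n) auto
  then show ?thesis
    using smooth_on_bounded_linear_comp[OF assms, of "\<lambda>x. x"] by (simp add: smooth_on_def)
qed

lemmas smooth_on_mult = smooth_on_bilinear[OF _ bounded_bilinear_mult]
lemmas smooth_on_scaleR = smooth_on_bilinear[OF _ bounded_bilinear_scaleR]
lemmas smooth_on_inner = smooth_on_bilinear[OF _ bounded_bilinear_inner]

lemma smooth_on_minus:
  "open U \<Longrightarrow> smooth_on U f \<Longrightarrow> smooth_on U (\<lambda>x. - f x)"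
  by (rule smooth_on_bounded_linear_comp[OF _ bounded_linear_minus[OF bounded_linear_ident]])

lemma smooth_on_diff:
  "open U \<Longrightarrow> smooth_on U f \<Longrightarrow> smooth_on U g \<Longrightarrow> smooth_on U (\<lambda>x. f x - g x)"
  using smooth_on_add[OF _ _ smooth_on_minus, of U f g] by simp

lemma smooth_on_componentwise:
  fixes f :: "'a::real_normed_vector \<Rightarrow> 'b::euclidean_space"
  assumes "open U" "\<And>b. b \<in> Basis \<Longrightarrow> smooth_on U (\<lambda>x. f x \<bullet> b)"
  shows "smooth_on U f"
proof (rule smooth_on_cong[OF assms(1)])
  show "smooth_on U (\<lambda>x. \<Sum>b\<in>Basis. (f x \<bullet> b) *\<^sub>R b)"
    using assms by (intro smooth_on_sum smooth_on_scaleR smooth_on_const) auto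
qed (simp add: euclidean_representation)

lemma smooth_on_vec:
  fixes f :: "'a::real_normed_vector \<Rightarrow> 'b::euclidean_space^'n"
  assumes "open U" "\<And>i. smooth_on U (\<lambda>x. f x $ i)"
  shows "smooth_on U f"
proof (rule smooth_on_componentwise[OF assms(1)])
  fix b :: "'b^'n" assume "b \<in> Basis"
  then obtain i v where "b = axis i v" by (auto simp: Basis_vec_def)
  then show "smooth_on U (\<lambda>x. f x \<bullet> b)"
    by (simp add: inner_axis smooth_on_inner assms smooth_on_const)
qed

lemma smooth_on_Pair:
  fixes f :: "'a::real_normed_vector \<Rightarrow> 'b::euclidean_space" and g :: "'a \<Rightarrow> 'c::euclidean_space"
  assumes "open U" "smooth_on U f" "smooth_on U g"
  shows "smooth_on U (\<lambda>x. (f x, g x))"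
proof -
  have "smooth_on U (\<lambda>x. (f x, 0) + (0, g x))"
    by (intro smooth_on_add[OF assms(1)] smooth_on_bounded_linear_comp[OF assms(1) _ assms(2)]
        smooth_on_bounded_linear_comp[OF assms(1) _ assms(3)]
        bounded_linear_Pair bounded_linear_ident bounded_linear_zero)
  then show ?thesis by simp
qed

lemma smooth_on_directional_derivative:
  assumes "smooth_on U f" "x + s *\<^sub>R v \<in> U"
  shows "((\<lambda>s. f (x + s *\<^sub>R v)) has_vector_derivative frechet_derivative f (at (x + s *\<^sub>R v)) v) (at s)"
proof -
  have "((\<lambda>s. f (x + s *\<^sub>R v)) has_derivative
        (\<lambda>h. frechet_derivative f (at (x + s *\<^sub>R v)) (h *\<^sub>R v))) (at s)"
    by (rule has_derivative_compose[where f = "\<lambda>s. x + s *\<^sub>R v", OF _ smooth_on_has_derivative[OF assms]])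
       (auto intro!: derivative_eq_intros)
  then show ?thesis
    unfolding has_vector_derivative_def
    using linear_scale[OF has_derivative_linear[OF smooth_on_has_derivative[OF assms]]] by simp
qed

text \<open>
  The second difference over a parallelogram is the increment of a first difference, so the mean
  value theorem applies twice, in the direction \<open>u\<close> and then in the direction \<open>v\<close>.
\<close>

lemma second_difference_mean_value:
  fixes f :: "'a::real_normed_vector \<Rightarrow> real"
  assumes f: "smooth_on U f"
    and U: "\<And>s t. 0 \<le> s \<Longrightarrow> s \<le> h \<Longrightarrow> 0 \<le> t \<Longrightarrow> t \<le> h \<Longrightarrow> x + s *\<^sub>R u + t *\<^sub>R v \<in> U" and h: "0 < h"
  shows "\<exists>s t. 0 < s \<and> s < h \<and> 0 < t \<and> t < h \<and>
     f (x + h *\<^sub>R u + h *\<^sub>R v) - f (x + h *\<^sub>R u) - f (x + h *\<^sub>R v) + f x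
     = h * h * frechet_derivative (\<lambda>y. frechet_derivative f (at y) u) (at (x + s *\<^sub>R u + t *\<^sub>R v)) v"
proof -
  let ?fu = "\<lambda>y. frechet_derivative f (at y) u"
  let ?p = "\<lambda>s. f ((x + h *\<^sub>R v) + s *\<^sub>R u) - f (x + s *\<^sub>R u)"
  have "(?p has_real_derivative ?fu ((x + h *\<^sub>R v) + s *\<^sub>R u) - ?fu (x + s *\<^sub>R u)) (at s)"
    if "0 \<le> s" "s \<le> h" for s
    unfolding has_real_derivative_iff_has_vector_derivative
    using U[OF that, of h] U[OF that, of 0] h
    by (intro has_vector_derivative_diff smooth_on_directional_derivative[OF f])
       (auto simp: algebra_simps)
  from MVT2[OF h this] obtain s where s: "0 < s" "s < h"
    "?p h - ?p 0 = h * (?fu ((x + h *\<^sub>R v) + s *\<^sub>R u) - ?fu (x + s *\<^sub>R u))" by auto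
  have "((\<lambda>t. ?fu ((x + s *\<^sub>R u) + t *\<^sub>R v)) has_real_derivative
      frechet_derivative ?fu (at ((x + s *\<^sub>R u) + t *\<^sub>R v)) v) (at t)" if "0 \<le> t" "t \<le> h" for t
    unfolding has_real_derivative_iff_has_vector_derivative
    using U[OF _ _ that, of s] s
    by (intro smooth_on_directional_derivative[OF smooth_on_frechet_derivative[OF f]]) auto
  from MVT2[OF h this] obtain t where t: "0 < t" "t < h"
    "?fu ((x + s *\<^sub>R u) + h *\<^sub>R v) - ?fu (x + s *\<^sub>R u + 0 *\<^sub>R v)
      = h * frechet_derivative ?fu (at ((x + s *\<^sub>R u) + t *\<^sub>R v)) v" by auto
  from s t have "?p h - ?p 0 = h * h * frechet_derivative ?fu (at ((x + s *\<^sub>R u) + t *\<^sub>R v)) v"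
    by (simp add: algebra_simps)
  moreover have "?p h - ?p 0 = f (x + h *\<^sub>R u + h *\<^sub>R v) - f (x + h *\<^sub>R u) - f (x + h *\<^sub>R v) + f x"
    by (simp add: algebra_simps)
  ultimately show ?thesis using s(1,2) t(1,2) by metis
qed

lemma second_difference_close:
  fixes f :: "'a::real_normed_vector \<Rightarrow> real"
  assumes f: "smooth_on U f" "open U" "x \<in> U" and e: "e > 0"
  shows "\<exists>d>0. \<forall>h. 0 < h \<longrightarrow> h < d \<longrightarrow>
     \<bar>f (x + h *\<^sub>R u + h *\<^sub>R v) - f (x + h *\<^sub>R u) - f (x + h *\<^sub>R v) + f x
      - h * h * frechet_derivative (\<lambda>y. frechet_derivative f (at y) u) (at x) v\<bar> \<le> h * h * e"
proof -
  let ?F = "\<lambda>y. frechet_derivative (\<lambda>y. frechet_derivative f (at y) u) (at y) v"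
  have "continuous_on U ?F"
    by (intro smooth_on_continuous smooth_on_frechet_derivative f)
  then have "?F \<midarrow>x\<rightarrow> ?F x"
    using f(2,3) by (simp add: continuous_on_eq_continuous_at isCont_def)
  then obtain r where r: "r > 0" "\<And>y. y \<noteq> x \<Longrightarrow> dist y x < r \<Longrightarrow> \<bar>?F y - ?F x\<bar> < e"
    using LIM_D[of ?F "?F x" x e] e by (auto simp: dist_norm)
  obtain q where q: "q > 0" "ball x q \<subseteq> U" using f openE by blast
  define B where "B = norm u + norm v + 1"
  define d where "d = min r q / B"
  have B: "B > 0" unfolding B_def by (intro add_nonneg_pos) auto
  have near: "dist (x + s *\<^sub>R u + t *\<^sub>R v) x < min r q"
    if "0 < h" "h < d" "0 \<le> s" "s \<le> h" "0 \<le> t" "t \<le> h" for h s t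
  proof -
    have "dist (x + s *\<^sub>R u + t *\<^sub>R v) x \<le> s * norm u + t * norm v"
      using norm_triangle_ineq[of "s *\<^sub>R u" "t *\<^sub>R v"] that by (simp add: dist_norm add.assoc)
    also have "\<dots> \<le> h * norm u + h * norm v"
      using that by (intro add_mono mult_right_mono) auto
    also have "\<dots> < h * B" using that by (simp add: B_def algebra_simps)
    also have "\<dots> < d * B" using that B by simp
    also have "\<dots> = min r q" using B by (simp add: d_def)
    finally show ?thesis .
  qed
  have "\<bar>f (x + h *\<^sub>R u + h *\<^sub>R v) - f (x + h *\<^sub>R u) - f (x + h *\<^sub>R v) + f x - h * h * ?F x\<bar> \<le> h * h * e"
    if h: "0 < h" "h < d" for h
  proof -
    have "x + s *\<^sub>R u + t *\<^sub>R v \<in> U" if "0 \<le> s" "s \<le> h" "0 \<le> t" "t \<le> h" for s t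
      using near[OF h that] q by (auto simp: dist_commute)
    from second_difference_mean_value[OF f(1) this h(1)] obtain s t where
      st: "0 < s" "s < h" "0 < t" "t < h"
      and eq: "f (x + h *\<^sub>R u + h *\<^sub>R v) - f (x + h *\<^sub>R u) - f (x + h *\<^sub>R v) + f x
         = h * h * ?F (x + s *\<^sub>R u + t *\<^sub>R v)" by auto
    have "\<bar>?F (x + s *\<^sub>R u + t *\<^sub>R v) - ?F x\<bar> \<le> e"
    proof (cases "x + s *\<^sub>R u + t *\<^sub>R v = x")
      case True
      then show ?thesis using e by (simp only: diff_self)
    next
      case False
      then show ?thesis
        using r(2)[of "x + s *\<^sub>R u + t *\<^sub>R v"] near[OF h, of s t] st by auto
    qed
    then have "h * h * \<bar>?F (x + s *\<^sub>R u + t *\<^sub>R v) - ?F x\<bar> \<le> h * h * e"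
      by (intro mult_left_mono) auto
    then show ?thesis
      unfolding eq by (simp only: right_diff_distrib[symmetric] abs_mult abs_mult_self_eq)
  qed
  moreover have "d > 0" using B r q by (simp add: d_def)
  ultimately show ?thesis by blast
qed

text \<open>
  Both mixed derivatives are limits of the same second difference divided by \<open>h\<^sup>2\<close>, because that
  difference is symmetric in \<open>u\<close> and \<open>v\<close>.
\<close>

lemma smooth_on_second_derivative_symmetric:
  fixes f :: "'a::real_normed_vector \<Rightarrow> real"
  assumes f: "smooth_on U f" "open U" "x \<in> U"
  shows "frechet_derivative (\<lambda>y. frechet_derivative f (at y) u) (at x) v
       = frechet_derivative (\<lambda>y. frechet_derivative f (at y) v) (at x) u" (is "?a = ?b")
proof (rule ccontr)
  assume "?a \<noteq> ?b"
  define e where "e = \<bar>?a - ?b\<bar> / 3"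
  have e: "e > 0" using \<open>?a \<noteq> ?b\<close> by (simp add: e_def)
  obtain d1 where d1: "d1 > 0" "\<And>h. 0 < h \<Longrightarrow> h < d1 \<Longrightarrow>
     \<bar>f (x + h *\<^sub>R u + h *\<^sub>R v) - f (x + h *\<^sub>R u) - f (x + h *\<^sub>R v) + f x - h * h * ?a\<bar> \<le> h * h * e"
    using second_difference_close[OF f e, of u v] by blast
  obtain d2 where d2: "d2 > 0" "\<And>h. 0 < h \<Longrightarrow> h < d2 \<Longrightarrow>
     \<bar>f (x + h *\<^sub>R v + h *\<^sub>R u) - f (x + h *\<^sub>R v) - f (x + h *\<^sub>R u) + f x - h * h * ?b\<bar> \<le> h * h * e"
    using second_difference_close[OF f e, of v u] by blast
  define h where "h = min d1 d2 / 2"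
  have h: "0 < h" "h < d1" "h < d2" using d1 d2 by (auto simp: h_def)
  have "x + h *\<^sub>R v + h *\<^sub>R u = x + h *\<^sub>R u + h *\<^sub>R v" by simp
  then have "\<bar>h * h * ?a - h * h * ?b\<bar> \<le> 2 * (h * h * e)"
    using d1(2)[OF h(1,2)] d2(2)[OF h(1,3)] by (smt (verit))
  then have "h * h * \<bar>?a - ?b\<bar> \<le> h * h * (2 * e)"
    by (simp only: right_diff_distrib[symmetric] abs_mult abs_mult_self_eq)
  then have "\<bar>?a - ?b\<bar> \<le> 2 * e" using h by simp
  then show False using e by (simp add: e_def)
qed

section \<open>Exterior derivatives on a submanifold\<close>

lemma has_vector_derivative_compose:
  assumes "(c has_vector_derivative v) (at t)" "(f has_derivative f') (at (c t))"
  shows "((\<lambda>s. f (c s)) has_vector_derivative f' v) (at t)"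
proof -
  have "((\<lambda>s. f (c s)) has_derivative (\<lambda>h. f' (h *\<^sub>R v))) (at t)"
    using assms(1) unfolding has_vector_derivative_def
    by (rule has_derivative_compose[where f = c, OF _ assms(2)])
  then show ?thesis
    unfolding has_vector_derivative_def
    using linear_scale[OF has_derivative_linear[OF assms(2)]] by simp
qed

lemma has_vector_derivative_eventually_eq:
  assumes "(f has_vector_derivative v) (at x)" "\<forall>\<^sub>F s in nhds x. f s = g s"
  shows "(g has_vector_derivative v) (at x)"
  using assms has_derivative_transform_eventually[of f _ x UNIV g] eventually_nhds_x_imp_x[OF assms(2)]
  unfolding has_vector_derivative_def by (simp add: eventually_nhds_conv_at)

text \<open>
  A tangent vector is the velocity of a curve in \<open>M\<close>, and along this curve \<open>f\<close> and \<open>g\<close> coincide.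
\<close>

lemma tangent_derivative_eq:
  assumes v: "v \<in> tangent_space M x" and U: "open U" "x \<in> U"
    and eq: "\<And>y. y \<in> U \<inter> M \<Longrightarrow> f y = g y"
    and f: "(f has_derivative f') (at x)" and g: "(g has_derivative g') (at x)"
  shows "f' v = g' v"
proof -
  obtain c :: "real \<Rightarrow> 'a" and e where c: "e > 0" "c ` {-e<..<e} \<subseteq> M" "c 0 = x"
    "(c has_vector_derivative v) (at 0)" using v unfolding tangent_space_def by blast
  have fc: "((\<lambda>s. f (c s)) has_vector_derivative f' v) (at 0)"
    using has_vector_derivative_compose[OF c(4), of f f'] f c(3) by simp
  have gc: "((\<lambda>s. g (c s)) has_vector_derivative g' v) (at 0)"
    using has_vector_derivative_compose[OF c(4), of g g'] g c(3) by simp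
  have "isCont c 0" using c(4) by (rule has_vector_derivative_continuous)
  then have "\<forall>\<^sub>F s in at 0. c s \<in> U"
    using U c(3) by (simp add: isCont_def topological_tendstoD)
  then have "\<forall>\<^sub>F s in nhds 0. c s \<in> U"
    using U c(3) by (simp add: eventually_nhds_conv_at)
  moreover have "\<forall>\<^sub>F s in nhds (0::real). s \<in> {-e<..<e}"
    using c(1) by (intro eventually_nhds_in_open) auto
  ultimately have ev: "\<forall>\<^sub>F s in nhds 0. f (c s) = g (c s)"
  proof eventually_elim
    case (elim s)
    with c(2) have "c s \<in> U \<inter> M" by blast
    then show ?case by (rule eq)
  qed
  show ?thesis
    using has_vector_derivative_eventually_eq[OF fc ev] gc by (rule vector_derivative_unique_at)
qed

lemma differential_eq:
  assumes "v \<in> tangent_space M x" "local_extension M f x U g"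
  shows "differential M f x v = frechet_derivative g (at x) v"
  unfolding differential_def
proof (rule the_equality)
  fix r assume "\<exists>U g. local_extension M f x U g \<and> r = frechet_derivative g (at x) v"
  then obtain U' g' where g': "local_extension M f x U' g'" "r = frechet_derivative g' (at x) v"
    by blast
  have "frechet_derivative g' (at x) v = frechet_derivative g (at x) v"
    by (rule tangent_derivative_eq[OF assms(1), of "U \<inter> U'" g' g])
       (use assms(2) g'(1) in \<open>auto simp: local_extension_def intro!: smooth_on_has_derivative\<close>)
  then show "r = frechet_derivative g (at x) v" using g'(2) by simp
qed (use assms(2) in blast)

text \<open>
  Leibniz rule for the evaluation of a form on a linear vector field \<open>L\<close>.
\<close>

lemma linear_family_has_derivative:
  fixes \<eta> :: "'a::real_normed_vector \<Rightarrow> 'b::euclidean_space \<Rightarrow> 'c::real_normed_vector"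
  assumes U: "open U" "x \<in> U" and lin: "\<And>y. y \<in> U \<Longrightarrow> linear (\<eta> y)"
    and D: "\<And>v. ((\<lambda>y. \<eta> y v) has_derivative D v) (at x)" and L: "bounded_linear L"
  shows "((\<lambda>y. \<eta> y (L y)) has_derivative (\<lambda>h. D (L x) h + \<eta> x (L h))) (at x)"
proof -
  have expand: "\<eta> y w = (\<Sum>b\<in>Basis. (w \<bullet> b) *\<^sub>R \<eta> y b)" if "y \<in> U" for y w
    by (rule linear_basis_expansion[OF lin[OF that]])
  have bl: "((\<lambda>y. L y) has_derivative L) (at x)"
    by (rule bounded_linear_imp_has_derivative[OF L])
  have summand: "((\<lambda>y. ((L y - L x) \<bullet> b) *\<^sub>R \<eta> y b) has_derivative
      (\<lambda>h. ((L x - L x) \<bullet> b) *\<^sub>R D b h + (L h \<bullet> b) *\<^sub>R \<eta> x b)) (at x)" for b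
    by (rule has_derivative_scaleR[OF _ D]) (auto intro!: derivative_eq_intros bl)
  have "((\<lambda>y. \<eta> y (L x) + (\<Sum>b\<in>Basis. ((L y - L x) \<bullet> b) *\<^sub>R \<eta> y b)) has_derivative
      (\<lambda>h. D (L x) h + (\<Sum>b\<in>Basis. ((L x - L x) \<bullet> b) *\<^sub>R D b h + (L h \<bullet> b) *\<^sub>R \<eta> x b))) (at x)"
    by (intro has_derivative_add D has_derivative_sum summand)
  moreover have "D (L x) h + (\<Sum>b\<in>Basis. ((L x - L x) \<bullet> b) *\<^sub>R D b h + (L h \<bullet> b) *\<^sub>R \<eta> x b)
      = D (L x) h + \<eta> x (L h)" for h
    by (simp add: expand[OF U(2), of "L h"])
  ultimately have d: "((\<lambda>y. \<eta> y (L x) + (\<Sum>b\<in>Basis. ((L y - L x) \<bullet> b) *\<^sub>R \<eta> y b)) has_derivative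
      (\<lambda>h. D (L x) h + \<eta> x (L h))) (at x)" by simp
  have "\<eta> y (L x) + (\<Sum>b\<in>Basis. ((L y - L x) \<bullet> b) *\<^sub>R \<eta> y b) = \<eta> y (L y)" if "y \<in> U" for y
    unfolding expand[OF that, of "L y - L x", symmetric] linear_diff[OF lin[OF that]] by simp
  with d U show ?thesis
    using has_derivative_transform_within_open[OF d U, of "\<lambda>y. \<eta> y (L y)"] by blast
qed

text \<open>
  Uniqueness of the exterior derivative reduces to the difference \<open>\<zeta>\<close> of two extensions, which
  vanishes on vectors tangent to \<open>M\<close>.  The function \<open>\<zeta> y (L y)\<close> is zero on \<open>M\<close> for a tangent linear
  field \<open>L\<close>; differentiating it along \<open>M\<close> expresses the derivatives of \<open>\<zeta>\<close> through its values, and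
  these combine to the value of \<open>\<zeta>\<close> on a commutator, which is tangent again.
\<close>

lemma vanishing_one_form_derivative:
  fixes \<zeta> :: "'a::euclidean_space \<Rightarrow> 'a \<Rightarrow> real"
  assumes U: "open U" "x \<in> U" and lin: "\<And>y. y \<in> U \<Longrightarrow> linear (\<zeta> y)"
    and D: "\<And>v. ((\<lambda>y. \<zeta> y v) has_derivative D v) (at x)"
    and zero: "\<And>y v. y \<in> U \<inter> M \<Longrightarrow> v \<in> tangent_space M y \<Longrightarrow> \<zeta> y v = 0"
    and x: "x \<in> M" and L: "bounded_linear L1" "bounded_linear L2"
    and T: "\<And>y. y \<in> M \<Longrightarrow> L1 y \<in> tangent_space M y" "\<And>y. y \<in> M \<Longrightarrow> L2 y \<in> tangent_space M y"
    and comm: "L1 (L2 x) - L2 (L1 x) \<in> tangent_space M x"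
  shows "D (L2 x) (L1 x) - D (L1 x) (L2 x) = 0"
proof -
  have *: "D (L x) v + \<zeta> x (L v) = 0"
    if "bounded_linear L" "\<And>y. y \<in> M \<Longrightarrow> L y \<in> tangent_space M y" "v \<in> tangent_space M x" for L v
    by (rule tangent_derivative_eq[OF that(3) U _
          linear_family_has_derivative[OF U lin D that(1)] has_derivative_const])
       (use zero that(2) in auto)
  have "\<zeta> x (L1 (L2 x)) - \<zeta> x (L2 (L1 x)) = 0"
    using zero[of x, OF _ comm] x U linear_diff[OF lin[OF U(2)]] by simp
  then show ?thesis
    using *[OF L(1) T(1) T(2)[OF x]] *[OF L(2) T(2) T(1)[OF x]] by simp
qed

lemma ext_deriv1_eq:
  fixes M :: "'a::euclidean_space set"
  assumes ext: "local_one_form_extension M \<theta> x U \<eta>"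
    and x: "x \<in> M" and L: "bounded_linear L1" "bounded_linear L2"
    and T: "\<And>y. y \<in> M \<Longrightarrow> L1 y \<in> tangent_space M y" "\<And>y. y \<in> M \<Longrightarrow> L2 y \<in> tangent_space M y"
    and comm: "L1 (L2 x) - L2 (L1 x) \<in> tangent_space M x"
  shows "ext_deriv1 M \<theta> x (L1 x) (L2 x)
    = frechet_derivative (\<lambda>y. \<eta> y (L2 x)) (at x) (L1 x)
    - frechet_derivative (\<lambda>y. \<eta> y (L1 x)) (at x) (L2 x)" (is "_ = ?r \<eta>")
  unfolding ext_deriv1_def
proof (rule the_equality)
  fix r assume "\<exists>U \<eta>. local_one_form_extension M \<theta> x U \<eta> \<and> r = ?r \<eta>"
  then obtain U' \<eta>' where ext': "local_one_form_extension M \<theta> x U' \<eta>'" and r: "r = ?r \<eta>'"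
    by blast
  have D: "((\<lambda>y. \<eta> y v - \<eta>' y v) has_derivative
       (\<lambda>h. frechet_derivative (\<lambda>y. \<eta> y v) (at x) h - frechet_derivative (\<lambda>y. \<eta>' y v) (at x) h)) (at x)" for v
    using ext ext' unfolding local_one_form_extension_def
    by (intro has_derivative_diff smooth_on_has_derivative[of U] smooth_on_has_derivative[of U']) auto
  have lin: "linear (\<lambda>v. \<eta> y v - \<eta>' y v)" if "y \<in> U \<inter> U'" for y
    using ext ext' that unfolding local_one_form_extension_def by (intro linear_compose_sub) auto
  have "(frechet_derivative (\<lambda>y. \<eta> y (L2 x)) (at x) (L1 x) - frechet_derivative (\<lambda>y. \<eta>' y (L2 x)) (at x) (L1 x))
     - (frechet_derivative (\<lambda>y. \<eta> y (L1 x)) (at x) (L2 x) - frechet_derivative (\<lambda>y. \<eta>' y (L1 x)) (at x) (L2 x)) = 0"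
    by (rule vanishing_one_form_derivative[where U = "U \<inter> U'" and M = M, OF _ _ lin D _ x L T comm])
       (use ext ext' in \<open>auto simp: local_one_form_extension_def\<close>)
  then show "r = ?r \<eta>" unfolding r by simp
qed (use ext in blast)

text \<open>
  The same argument for two linear arguments: the terms produced by the Leibniz rule pair up, by
  antisymmetry, to values of \<open>\<zeta>\<close> on the three commutators.
\<close>

lemma vanishing_two_form_derivative:
  fixes \<zeta> :: "'a::euclidean_space \<Rightarrow> 'a \<Rightarrow> 'a \<Rightarrow> real"
  assumes U: "open U" "x \<in> U" and bil: "\<And>y. y \<in> U \<Longrightarrow> bilinear (\<zeta> y)"
    and alt: "\<And>y v. y \<in> U \<Longrightarrow> \<zeta> y v v = 0"
    and D: "\<And>v w. ((\<lambda>y. \<zeta> y v w) has_derivative D v w) (at x)"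
    and zero: "\<And>y v w. y \<in> U \<inter> M \<Longrightarrow> v \<in> tangent_space M y \<Longrightarrow> w \<in> tangent_space M y \<Longrightarrow> \<zeta> y v w = 0"
    and x: "x \<in> M"
    and L: "bounded_linear L1" "bounded_linear L2" "bounded_linear L3"
    and T: "\<And>y. y \<in> M \<Longrightarrow> L1 y \<in> tangent_space M y" "\<And>y. y \<in> M \<Longrightarrow> L2 y \<in> tangent_space M y"
           "\<And>y. y \<in> M \<Longrightarrow> L3 y \<in> tangent_space M y"
    and comm: "L1 (L2 x) - L2 (L1 x) \<in> tangent_space M x" "L1 (L3 x) - L3 (L1 x) \<in> tangent_space M x"
       "L2 (L3 x) - L3 (L2 x) \<in> tangent_space M x"
  shows "D (L2 x) (L3 x) (L1 x) - D (L1 x) (L3 x) (L2 x) + D (L1 x) (L2 x) (L3 x) = 0"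
proof -
  have *: "D (L x) (K x) v + \<zeta> x (L x) (K v) + \<zeta> x (L v) (K x) = 0"
    if L: "bounded_linear L" "\<And>y. y \<in> M \<Longrightarrow> L y \<in> tangent_space M y"
      and K: "bounded_linear K" "\<And>y. y \<in> M \<Longrightarrow> K y \<in> tangent_space M y"
      and v: "v \<in> tangent_space M x" for L K v
  proof -
    have 1: "((\<lambda>y. \<zeta> y w (K y)) has_derivative (\<lambda>h. D w (K x) h + \<zeta> x w (K h))) (at x)" for w
      by (rule linear_family_has_derivative[OF U _ D K(1)]) (use bil in \<open>simp add: bilinear_def\<close>)
    have lin: "linear (\<lambda>w. \<zeta> y w (K y))" if "y \<in> U" for y
      using bil[OF that] by (simp add: bilinear_def)
    show ?thesis
      by (rule tangent_derivative_eq[OF v U _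
            linear_family_has_derivative[OF U lin 1 L(1)] has_derivative_const])
         (use zero L(2) K(2) in auto)
  qed
  have lin: "linear (\<zeta> x v)" "linear (\<lambda>w. \<zeta> x w v)" for v
    using bil[OF U(2)] by (simp_all add: bilinear_def)
  have anti: "\<zeta> x v w = - \<zeta> x w v" for v w
  proof -
    have "\<zeta> x (v + w) (v + w) = \<zeta> x v v + \<zeta> x v w + \<zeta> x w v + \<zeta> x w w"
      using linear_add[OF lin(1)] linear_add[OF lin(2)] by simp
    then show ?thesis using alt[OF U(2)] by simp
  qed
  have xU: "x \<in> U \<inter> M" using U x by simp
  note lin_diff = linear_diff[OF lin(1)]
  have "\<zeta> x (L3 x) (L1 (L2 x)) - \<zeta> x (L3 x) (L2 (L1 x)) = 0"
    using zero[OF xU T(3)[OF x] comm(1)] lin_diff by simp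
  moreover have "\<zeta> x (L2 x) (L1 (L3 x)) - \<zeta> x (L2 x) (L3 (L1 x)) = 0"
    using zero[OF xU T(2)[OF x] comm(2)] lin_diff by simp
  moreover have "\<zeta> x (L1 x) (L2 (L3 x)) - \<zeta> x (L1 x) (L3 (L2 x)) = 0"
    using zero[OF xU T(1)[OF x] comm(3)] lin_diff by simp
  ultimately show ?thesis
    using *[OF L(2) T(2) L(3) T(3) T(1)[OF x]] *[OF L(1) T(1) L(3) T(3) T(2)[OF x]]
      *[OF L(1) T(1) L(2) T(2) T(3)[OF x]]
      anti[of "L2 (L1 x)" "L3 x"] anti[of "L1 (L2 x)" "L3 x"] anti[of "L1 (L3 x)" "L2 x"]
    by linarith
qed

lemma ext_deriv2_eq:
  fixes M :: "'a::euclidean_space set"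
  assumes ext: "local_two_form_extension M \<omega> x U \<beta>"
    and x: "x \<in> M"
    and L: "bounded_linear L1" "bounded_linear L2" "bounded_linear L3"
    and T: "\<And>y. y \<in> M \<Longrightarrow> L1 y \<in> tangent_space M y" "\<And>y. y \<in> M \<Longrightarrow> L2 y \<in> tangent_space M y"
           "\<And>y. y \<in> M \<Longrightarrow> L3 y \<in> tangent_space M y"
    and comm: "L1 (L2 x) - L2 (L1 x) \<in> tangent_space M x" "L1 (L3 x) - L3 (L1 x) \<in> tangent_space M x"
       "L2 (L3 x) - L3 (L2 x) \<in> tangent_space M x"
  shows "ext_deriv2 M \<omega> x (L1 x) (L2 x) (L3 x)
    = frechet_derivative (\<lambda>y. \<beta> y (L2 x) (L3 x)) (at x) (L1 x)
    - frechet_derivative (\<lambda>y. \<beta> y (L1 x) (L3 x)) (at x) (L2 x)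
    + frechet_derivative (\<lambda>y. \<beta> y (L1 x) (L2 x)) (at x) (L3 x)" (is "_ = ?r \<beta>")
  unfolding ext_deriv2_def
proof (rule the_equality)
  fix r assume "\<exists>U \<beta>. local_two_form_extension M \<omega> x U \<beta> \<and> r = ?r \<beta>"
  then obtain U' \<beta>' where ext': "local_two_form_extension M \<omega> x U' \<beta>'" and r: "r = ?r \<beta>'"
    by blast
  let ?D = "\<lambda>v w h. frechet_derivative (\<lambda>y. \<beta> y v w) (at x) h - frechet_derivative (\<lambda>y. \<beta>' y v w) (at x) h"
  have D: "((\<lambda>y. \<beta> y v w - \<beta>' y v w) has_derivative ?D v w) (at x)" for v w
    using ext ext' unfolding local_two_form_extension_def
    by (intro has_derivative_diff smooth_on_has_derivative[of U] smooth_on_has_derivative[of U']) auto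
  have bil: "bilinear (\<lambda>v w. \<beta> y v w - \<beta>' y v w)" if "y \<in> U \<inter> U'" for y
    using ext ext' that unfolding local_two_form_extension_def bilinear_def
    by (auto intro!: linear_compose_sub)
  have "?D (L2 x) (L3 x) (L1 x) - ?D (L1 x) (L3 x) (L2 x) + ?D (L1 x) (L2 x) (L3 x) = 0"
    by (rule vanishing_two_form_derivative[where U = "U \<inter> U'" and M = M, OF _ _ bil _ D _ x L T comm])
       (use ext ext' in \<open>auto simp: local_two_form_extension_def\<close>)
  then show "r = ?r \<beta>" unfolding r by simp
qed (use ext in blast)

section \<open>Geometry of the rotation group\<close>

unbundle cross3_syntax

lemma hat_entries [simp]:
  "hat w $ 1 $ 1 = 0" "hat w $ 1 $ 2 = - w $ 3" "hat w $ 1 $ 3 = w $ 2"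
  "hat w $ 2 $ 1 = w $ 3" "hat w $ 2 $ 2 = 0" "hat w $ 2 $ 3 = - w $ 1"
  "hat w $ 3 $ 1 = - w $ 2" "hat w $ 3 $ 2 = w $ 1" "hat w $ 3 $ 3 = 0"
  by (simp_all add: hat_def matrix_def cross3_def axis_def)

definition vee :: "real^3^3 \<Rightarrow> real^3" where
  "vee S = vector [S$3$2, S$1$3, S$2$1]"

lemma vee_entries [simp]: "vee S $ 1 = S$3$2" "vee S $ 2 = S$1$3" "vee S $ 3 = S$2$1"
  by (simp_all add: vee_def)

lemma vee_hat [simp]: "vee (hat w) = w"
  by (simp add: vec_eq_iff forall_3)

lemma inv_hat [simp]: "inv hat (hat w) = w"
  by (rule inv_f_f) (metis injI vee_hat)

lemma hat_vee:
  assumes "transpose S = - S" shows "hat (vee S) = S"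
proof -
  have "S $ j $ i = - S $ i $ j" for i j
    using arg_cong[OF assms, of "\<lambda>S. S $ i $ j"] by (simp add: transpose_def)
  from this[of 1 1] this[of 2 2] this[of 3 3] this[of 2 1] this[of 1 3] this[of 3 2]
  have "S$1$1 = 0" "S$2$2 = 0" "S$3$3 = 0" "S$1$2 = - S$2$1" "S$3$1 = - S$1$3" "S$2$3 = - S$3$2"
    by linarith+
  then show ?thesis by (simp add: vec_eq_iff forall_3)
qed

lemma transpose_hat: "transpose (hat w) = - hat w"
  by (simp add: vec_eq_iff forall_3 transpose_def)

lemma linear_hat: "linear hat"
  by (rule linearI) (simp_all add: vec_eq_iff forall_3)

lemma linear_vee: "linear vee"
  by (rule linearI) (simp_all add: vec_eq_iff forall_3)

lemma hat_commutator: "hat a ** hat b - hat b ** hat a = hat (a \<times> b)"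
  by (simp add: vec_eq_iff forall_3 matrix_matrix_mult_def sum_3 cross3_def algebra_simps)

lemma vee_hat_mult: "vee (hat a ** hat b) - vee (hat b ** hat a) = a \<times> b"
  by (metis hat_commutator linear_diff linear_vee vee_hat)

lemma matrix_minus_mult: "(- X) ** Y = - (X ** (Y::real^3^3))" for X :: "real^3^3"
  by (simp add: vec_eq_iff matrix_matrix_mult_def sum_negf)

lemma matrix_mult_minus: "X ** (- Y) = - (X ** (Y::real^3^3))" for X :: "real^3^3"
  by (simp add: vec_eq_iff matrix_matrix_mult_def sum_negf)

lemma matrix_mult_diff: "X ** (Y - Z) = X ** Y - X ** (Z::real^3^3)" for X :: "real^3^3"
  by (simp add: vec_eq_iff matrix_matrix_mult_def sum_subtractf algebra_simps)

lemma bounded_bilinear_matrix_mult: "bounded_bilinear ((**) :: real^3^3 \<Rightarrow> real^3^3 \<Rightarrow> real^3^3)"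
  unfolding bilinear_conv_bounded_bilinear[symmetric] bilinear_def
  by (auto intro!: linearI simp: vec_eq_iff matrix_matrix_mult_def sum_distrib_left
      sum.distrib algebra_simps)

lemma linear_transpose: "linear (transpose :: real^3^3 \<Rightarrow> real^3^3)"
  by (rule linearI) (simp_all add: vec_eq_iff transpose_def)

lemmas bounded_linear_hat = linear_conv_bounded_linear[THEN iffD1, OF linear_hat]
lemmas bounded_linear_transpose = linear_conv_bounded_linear[THEN iffD1, OF linear_transpose]

text \<open>
  The vector with the components \<open>\<Lambda>\<^sub>i\<close>.  It is bilinear on the whole ambient space and equals the
  angular velocity on the tangent bundle of \<open>SO3\<close>, so it supplies smooth extensions of the metric.
\<close>

definition body_velocity :: "real^3^3 \<Rightarrow> real^3^3 \<Rightarrow> real^3" where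
  "body_velocity Q \<Omega> = vee (transpose Q ** \<Omega>)"

lemma bounded_bilinear_body_velocity: "bounded_bilinear body_velocity"
proof -
  interpret m: bounded_bilinear "(**) :: real^3^3 \<Rightarrow> real^3^3 \<Rightarrow> real^3^3"
    by (rule bounded_bilinear_matrix_mult)
  show ?thesis
    unfolding bilinear_conv_bounded_bilinear[symmetric] bilinear_def body_velocity_def
    by (auto intro!: linearI simp: linear_add[OF linear_vee] linear_scale[OF linear_vee]
      linear_add[OF linear_transpose] linear_scale[OF linear_transpose]
      m.add_left m.add_right m.scaleR_left m.scaleR_right)
qed

interpretation body_velocity: bounded_bilinear body_velocity
  by (rule bounded_bilinear_body_velocity)

lemma Lambda_body_velocity:
  "Lambda1 Q \<Omega> = body_velocity Q \<Omega> $ 1"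
  "Lambda2 Q \<Omega> = body_velocity Q \<Omega> $ 2"
  "Lambda3 Q \<Omega> = body_velocity Q \<Omega> $ 3"
  by (simp_all add: Lambda1_def Lambda2_def Lambda3_def body_velocity_def
      matrix_matrix_mult_def sum_3 transpose_def)

lemma SO3_D:
  assumes "Q \<in> SO3"
  shows "transpose Q ** Q = mat 1" "Q ** transpose Q = mat 1" "det Q = 1"
  using assms by (auto simp: SO3_def rotation_matrix_def orthogonal_matrix_def)

lemma SO3_I: "Q ** transpose Q = mat 1 \<Longrightarrow> det Q = 1 \<Longrightarrow> Q \<in> SO3"
  by (metis (no_types) SO3_def mem_Collect_eq matrix_left_right_inverse orthogonal_matrix
      rotation_matrix_def)

lemma SO3_mult: "P \<in> SO3 \<Longrightarrow> Q \<in> SO3 \<Longrightarrow> P ** Q \<in> SO3"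
  by (simp add: SO3_def rotation_matrix_def orthogonal_matrix_mul det_mul)

lemma SO3_mult_cancel: "Q \<in> SO3 \<Longrightarrow> transpose Q ** (Q ** X) = X"
  using SO3_D(1) by (simp add: matrix_mul_assoc)

lemma SO3_mult_cancel': "Q \<in> SO3 \<Longrightarrow> Q ** (transpose Q ** X) = X"
  using SO3_D(2) by (simp add: matrix_mul_assoc)

lemma body_velocity_SO3: "Q \<in> SO3 \<Longrightarrow> body_velocity Q (Q ** X) = vee X"
  by (simp add: body_velocity_def SO3_mult_cancel)

lemma body_velocity_tangent:
  "Q \<in> SO3 \<Longrightarrow> body_velocity (Q ** hat a) (Q ** X) = - vee (hat a ** X)"
  by (simp add: body_velocity_def matrix_transpose_mul transpose_hat matrix_mul_assoc[symmetric]
      SO3_mult_cancel matrix_minus_mult linear_neg[OF linear_vee])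

lemma angular_velocity_SO3: "Q \<in> SO3 \<Longrightarrow> angular_velocity Q (Q ** hat a) = a"
proof -
  assume Q: "Q \<in> SO3"
  then have "matrix_inv Q ** Q = mat 1"
    using someI[of "\<lambda>P. Q ** P = mat 1 \<and> P ** Q = mat 1" "transpose Q"] SO3_D
    unfolding matrix_inv_def by blast
  then have "matrix_inv Q ** (Q ** hat a) = hat a"
    by (simp add: matrix_mul_assoc)
  then show ?thesis by (simp add: angular_velocity_def)
qed

text \<open>
  An orthogonal matrix has determinant \<open>1\<close> or \<open>-1\<close>, and a continuous function with finitely many
  values is constant on a connected set.
\<close>

lemma path_in_SO3:
  fixes c :: "real \<Rightarrow> real^3^3"
  assumes "connected I" "continuous_on I c" "\<And>t. t \<in> I \<Longrightarrow> c t ** transpose (c t) = mat 1"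
    and "t0 \<in> I" "c t0 \<in> SO3" "t \<in> I"
  shows "c t \<in> SO3"
proof -
  have "det (c t) ^ 2 = 1" if "t \<in> I" for t
    using arg_cong[OF assms(3)[OF that], of det] by (simp add: det_mul det_transpose power2_eq_square)
  then have "(\<lambda>t. det (c t)) ` I \<subseteq> {1, -1}"
    by (auto simp: power2_eq_1_iff)
  moreover have "continuous_on I (\<lambda>t. det (c t))"
    unfolding det_3 by (intro continuous_intros assms(2))
  ultimately have "(\<lambda>t. det (c t)) constant_on I"
    using assms(1) by (metis continuous_finite_range_constant finite.emptyI finite_insert finite_subset)
  then have "det (c t) = det (c t0)" using assms(4,6) unfolding constant_on_def by metis
  then show ?thesis using SO3_D(3)[OF assms(5)] assms(3)[OF assms(6)] by (intro SO3_I) auto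
qed

text \<open>
  The Cayley transform \<open>(1 - X)\<inverse> (1 + X)\<close> of \<open>X = t *\<^sub>R hat a / 2\<close>, made explicit by
  \<open>X\<^sup>3 = - (t\<^sup>2 (a \<bullet> a) / 4) X\<close>.  It is a rational curve of rotations with initial velocity \<open>hat a\<close>, for
  which smoothness is checked without a case distinction on \<open>a = 0\<close>.
\<close>

definition cayley :: "real^3 \<Rightarrow> real \<Rightarrow> real^3^3" where
  "cayley a t = mat 1 +
     ((1 + t\<^sup>2 * (a \<bullet> a) / 4) powr (-1)) *\<^sub>R (t *\<^sub>R hat a + (t\<^sup>2 / 2) *\<^sub>R (hat a ** hat a))"

lemma cayley_denominator_pos: "0 < 1 + t\<^sup>2 * (a \<bullet> a) / (4::real)" for a :: "real^3"
  by (simp add: add_pos_nonneg)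

lemma hat_cubed: "hat a ** hat a ** hat a = - (a \<bullet> a) *\<^sub>R hat a"
  by (simp add: vec_eq_iff forall_3 matrix_matrix_mult_def sum_3 inner_vec_def algebra_simps)

lemma cayley_orthogonal: "cayley a t ** transpose (cayley a t) = mat 1"
proof -
  interpret m: bounded_bilinear "(**) :: real^3^3 \<Rightarrow> real^3^3 \<Rightarrow> real^3^3"
    by (rule bounded_bilinear_matrix_mult)
  define c where "c = (1 + t\<^sup>2 * (a \<bullet> a) / 4) powr (-1)"
  define n where "n = a \<bullet> a"
  define S where "S = hat a"
  define T where "T = S ** S"
  have "c * (1 + t\<^sup>2 * n / 4) = 1"
    using cayley_denominator_pos[of t a] by (simp add: c_def n_def powr_minus)
  then have c: "c - c * c * (1 + t\<^sup>2 * n / 4) = 0" by (simp add: mult.assoc)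
  have tr: "transpose S = - S" "transpose T = T"
    by (simp_all add: S_def T_def transpose_hat matrix_transpose_mul matrix_minus_mult matrix_mult_minus)
  have ST: "S ** S = T" "T ** S = - n *\<^sub>R S" "S ** T = - n *\<^sub>R S" 
    using hat_cubed[of a] by (simp_all add: S_def T_def n_def matrix_mul_assoc)
  have TT: "T ** T = - n *\<^sub>R T"
    using ST by (metis T_def m.scaleR_right matrix_mul_assoc)
  have "cayley a t = mat 1 + c *\<^sub>R (t *\<^sub>R S + (t\<^sup>2 / 2) *\<^sub>R T)"
    by (simp add: cayley_def c_def S_def T_def)
  moreover have "transpose (mat 1 + c *\<^sub>R (t *\<^sub>R S + (t\<^sup>2 / 2) *\<^sub>R T)) = mat 1 + c *\<^sub>R (- t *\<^sub>R S + (t\<^sup>2 / 2) *\<^sub>R T)"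
    by (simp add: linear_add[OF linear_transpose] linear_scale[OF linear_transpose] tr)
  ultimately have "cayley a t ** transpose (cayley a t)
     = (mat 1 + c *\<^sub>R (t *\<^sub>R S + (t\<^sup>2 / 2) *\<^sub>R T)) ** (mat 1 + c *\<^sub>R (- t *\<^sub>R S + (t\<^sup>2 / 2) *\<^sub>R T))"
    by simp
  also have "\<dots> = mat 1 + (t\<^sup>2 * (c - c * c * (1 + t\<^sup>2 * n / 4))) *\<^sub>R T"
    by (simp add: m.add_left m.add_right m.diff_left m.diff_right m.scaleR_left m.scaleR_right
        m.minus_right ST TT vec_eq_iff algebra_simps power2_eq_square)
  finally show ?thesis by (simp add: c)
qed

lemma smooth_on_cayley: "smooth_on UNIV (cayley a)"
proof -
  have t: "smooth_on UNIV (\<lambda>t::real. t)" by (rule smooth_on_bounded_linear) auto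
  have t2: "smooth_on UNIV (\<lambda>t::real. t\<^sup>2 * k)" for k
    unfolding power2_eq_square by (intro smooth_on_mult t smooth_on_const open_UNIV)
  have t2': "smooth_on UNIV (\<lambda>t::real. t\<^sup>2 * (a \<bullet> a) / 4)" "smooth_on UNIV (\<lambda>t::real. t\<^sup>2 / 2)"
    using t2[of "(a \<bullet> a) / 4"] t2[of "1/2"] by simp_all
  show ?thesis
    unfolding cayley_def[abs_def]
    by (intro smooth_on_add smooth_on_scaleR smooth_on_const smooth_on_powr t t2' open_UNIV)
       (rule cayley_denominator_pos)
qed

lemma cayley_0 [simp]: "cayley a 0 = mat 1"
  by (simp add: cayley_def)

lemma cayley_in_SO3: "cayley a t \<in> SO3"
  by (rule path_in_SO3[of UNIV _ 0 t])
     (simp_all add: cayley_orthogonal smooth_on_continuous smooth_on_cayley SO3_I transpose_mat)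

lemma cayley_has_vector_derivative: "(cayley a has_vector_derivative hat a) (at 0)"
proof -
  have "((\<lambda>t. (1 + t\<^sup>2 * (a \<bullet> a) / 4) powr (-1)) has_real_derivative 0) (at 0)"
    by (rule derivative_eq_intros refl | simp)+
  then have c: "((\<lambda>t. (1 + t\<^sup>2 * (a \<bullet> a) / 4) powr (-1)) has_vector_derivative 0) (at 0)"
    by (simp add: has_real_derivative_iff_has_vector_derivative)
  have "((\<lambda>t. t *\<^sub>R hat a + (t\<^sup>2 / 2) *\<^sub>R (hat a ** hat a)) has_vector_derivative hat a) (at 0)"
    by (rule derivative_eq_intros refl | simp)+
  from has_vector_derivative_add[OF has_vector_derivative_const[of "mat 1"]
      bounded_bilinear.has_vector_derivative[OF bounded_bilinear_scaleR c this]]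
  show ?thesis by (simp add: cayley_def[abs_def])
qed

text \<open>
  Differentiating \<open>c\<^sup>T c = 1\<close> shows that \<open>c\<^sup>T c'\<close> is skew-symmetric.
\<close>

lemma curve_in_SO3_velocity:
  assumes c: "(c has_vector_derivative v) (at 0)" and e: "e > 0" "c ` {-e<..<e} \<subseteq> SO3"
  shows "\<exists>a. v = c 0 ** hat a"
proof -
  have Q: "c 0 \<in> SO3" using e by auto
  have "((\<lambda>t. transpose (c t) ** c t) has_vector_derivative
      transpose (c 0) ** v + transpose v ** c 0) (at 0)"
    by (rule bounded_bilinear.has_vector_derivative[OF bounded_bilinear_matrix_mult
        bounded_linear.has_vector_derivative[OF bounded_linear_transpose c] c])
  moreover have "\<forall>\<^sub>F t in nhds 0. t \<in> {-e<..<e}"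
    using e by (intro eventually_nhds_in_open) auto
  then have "\<forall>\<^sub>F t in nhds 0. transpose (c t) ** c t = mat 1"
    by eventually_elim (use e SO3_D in blast)
  ultimately have "((\<lambda>t. mat 1 :: real^3^3) has_vector_derivative
      transpose (c 0) ** v + transpose v ** c 0) (at 0)"
    by (rule has_vector_derivative_eventually_eq)
  then have "transpose (c 0) ** v + transpose v ** c 0 = 0"
    using vector_derivative_unique_at has_vector_derivative_const by metis
  then have "transpose (transpose (c 0) ** v) = - (transpose (c 0) ** v)"
    by (simp add: matrix_transpose_mul eq_neg_iff_add_eq_0 add.commute)
  from hat_vee[OF this] have "c 0 ** hat (vee (transpose (c 0) ** v)) = v"
    by (simp add: SO3_mult_cancel'[OF Q])
  then show ?thesis by metis
qed

lemma tangent_space_SO3: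
  assumes "Q \<in> SO3" shows "tangent_space SO3 Q = range (\<lambda>a. Q ** hat a)"
proof (rule set_eqI, rule iffI)
  fix v assume "v \<in> tangent_space SO3 Q"
  then show "v \<in> range (\<lambda>a. Q ** hat a)"
    unfolding tangent_space_def using curve_in_SO3_velocity by blast
next
  fix v assume "v \<in> range (\<lambda>a. Q ** hat a)"
  then obtain a where v: "v = Q ** hat a" by blast
  have "smooth_on UNIV (\<lambda>t. Q ** cayley a t)"
    by (intro smooth_on_bilinear[OF _ bounded_bilinear_matrix_mult] smooth_on_const
        smooth_on_cayley open_UNIV)
  then have "smooth_on {-1<..<1} (\<lambda>t. Q ** cayley a t)" by (rule smooth_on_subset) simp
  moreover have "((\<lambda>t. Q ** cayley a t) has_vector_derivative v) (at 0)"
    unfolding v using cayley_has_vector_derivative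
    by (rule bounded_linear.has_vector_derivative[OF
        bounded_bilinear.bounded_linear_right[OF bounded_bilinear_matrix_mult]])
  ultimately show "v \<in> tangent_space SO3 Q"
    unfolding tangent_space_def using SO3_mult[OF assms cayley_in_SO3]
    by (intro CollectI exI[of _ "\<lambda>t. Q ** cayley a t"] exI[of _ 1]) auto
qed

lemma tangent_bundle_SO3:
  "w \<in> tangent_bundle SO3 \<longleftrightarrow> (\<exists>Q u. Q \<in> SO3 \<and> w = (Q, Q ** hat u))"
  by (auto simp: tangent_bundle_def tangent_space_SO3)

text \<open>
  The velocity of a curve \<open>(Q, Q ** hat w)\<close> in the tangent bundle for which the body angular
  velocity of \<open>Q\<close> is \<open>a\<close> and the derivative of \<open>w\<close> is \<open>p\<close>.
\<close>

definition bundle_velocity ::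
  "real^3^3 \<Rightarrow> real^3 \<Rightarrow> real^3 \<Rightarrow> real^3 \<Rightarrow> (real^3^3) \<times> (real^3^3)" where
  "bundle_velocity Q w a p = (Q ** hat a, Q ** (hat a ** hat w + hat p))"

lemma bundle_curve_has_vector_derivative:
  assumes "(c has_vector_derivative c t ** hat a) (at t)" "(u has_vector_derivative p) (at t)"
  shows "((\<lambda>t. (c t, c t ** hat (u t))) has_vector_derivative bundle_velocity (c t) (u t) a p) (at t)"
proof -
  have "((\<lambda>t. c t ** hat (u t)) has_vector_derivative c t ** hat p + (c t ** hat a) ** hat (u t)) (at t)"
    by (rule bounded_bilinear.has_vector_derivative[OF bounded_bilinear_matrix_mult assms(1)
        bounded_linear.has_vector_derivative[OF bounded_linear_hat assms(2)]])
  from has_vector_derivative_Pair[OF assms(1) this] show ?thesis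
    by (simp add: bundle_velocity_def matrix_add_ldistrib matrix_mul_assoc add.commute)
qed

lemma tangent_space_bundle_SO3:
  assumes "Q \<in> SO3"
  shows "tangent_space (tangent_bundle SO3) (Q, Q ** hat w) = {bundle_velocity Q w a p | a p. True}"
proof (rule set_eqI, rule iffI)
  fix v assume "v \<in> tangent_space (tangent_bundle SO3) (Q, Q ** hat w)"
  then obtain c :: "real \<Rightarrow> _" and e where e: "e > 0" "c ` {-e<..<e} \<subseteq> tangent_bundle SO3"
    and c0: "c 0 = (Q, Q ** hat w)" and c: "(c has_vector_derivative v) (at 0)"
    unfolding tangent_space_def by blast
  have c1: "((\<lambda>t. fst (c t)) has_vector_derivative fst v) (at 0)"
    and c2: "((\<lambda>t. snd (c t)) has_vector_derivative snd v) (at 0)"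
    using bounded_linear.has_vector_derivative[OF bounded_linear_fst c]
      bounded_linear.has_vector_derivative[OF bounded_linear_snd c] by auto
  have in_bundle: "\<exists>u. fst (c t) \<in> SO3 \<and> snd (c t) = fst (c t) ** hat u" if "t \<in> {-e<..<e}" for t
  proof -
    have "c t \<in> tangent_bundle SO3" using e(2) that by blast
    then show ?thesis by (auto simp: tangent_bundle_SO3)
  qed
  then have "(\<lambda>t. fst (c t)) ` {-e<..<e} \<subseteq> SO3" by blast
  from curve_in_SO3_velocity[OF c1 e(1) this] c0
  obtain a where a: "fst v = Q ** hat a" by auto
  \<comment> \<open>The matrix \<open>g t\<close> is \<open>hat\<close> of the angular velocity, so it is skew and its derivative is skew.\<close>
  define g where "g t = transpose (fst (c t)) ** snd (c t)" for t
  have g: "(g has_vector_derivative transpose Q ** snd v + transpose (fst v) ** (Q ** hat w)) (at 0)"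
    unfolding g_def using c0
      bounded_bilinear.has_vector_derivative[OF bounded_bilinear_matrix_mult
        bounded_linear.has_vector_derivative[OF bounded_linear_transpose c1] c2] by simp
  let ?g' = "transpose Q ** snd v + transpose (fst v) ** (Q ** hat w)"
  have gt: "((\<lambda>t. transpose (g t) + g t) has_vector_derivative transpose ?g' + ?g') (at 0)"
    by (intro has_vector_derivative_add g
        bounded_linear.has_vector_derivative[OF bounded_linear_transpose])
  have "transpose (g t) + g t = 0" if "t \<in> {-e<..<e}" for t
    using in_bundle[OF that] by (auto simp: g_def SO3_mult_cancel transpose_hat)
  moreover have "\<forall>\<^sub>F t in nhds 0. t \<in> {-e<..<e}"
    using e by (intro eventually_nhds_in_open) auto
  ultimately have "\<forall>\<^sub>F t in nhds 0. transpose (g t) + g t = 0"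
    by (auto elim: eventually_mono)
  with gt have "((\<lambda>t. 0 :: real^3^3) has_vector_derivative transpose ?g' + ?g') (at 0)"
    by (rule has_vector_derivative_eventually_eq)
  then have "transpose ?g' + ?g' = 0"
    using vector_derivative_unique_at has_vector_derivative_const by metis
  then have "transpose ?g' = - ?g'" by (simp only: eq_neg_iff_add_eq_0)
  from hat_vee[OF this] obtain p where p: "?g' = hat p" by metis
  have "transpose (fst v) ** (Q ** hat w) = - (hat a ** hat w)"
    by (simp add: a matrix_transpose_mul transpose_hat matrix_minus_mult matrix_mul_assoc[symmetric]
        SO3_mult_cancel[OF assms])
  with p have "transpose Q ** snd v = hat a ** hat w + hat p" by (simp add: algebra_simps)
  then have "snd v = Q ** (hat a ** hat w + hat p)" using SO3_mult_cancel'[OF assms] by metis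
  with a show "v \<in> {bundle_velocity Q w a p | a p. True}"
    by (auto simp: bundle_velocity_def prod_eq_iff)
next
  fix v assume "v \<in> {bundle_velocity Q w a p | a p. True}"
  then obtain a p where v: "v = bundle_velocity Q w a p" by blast
  let ?c = "\<lambda>t. Q ** cayley a t" and ?u = "\<lambda>t::real. w + t *\<^sub>R p"
  have sc: "smooth_on UNIV ?c"
    by (intro smooth_on_bilinear[OF _ bounded_bilinear_matrix_mult] smooth_on_const
        smooth_on_cayley open_UNIV)
  have su: "smooth_on UNIV (\<lambda>t. hat (?u t))"
    by (rule smooth_on_bounded_linear_comp[OF open_UNIV bounded_linear_hat])
       (intro smooth_on_add smooth_on_scaleR smooth_on_const smooth_on_bounded_linear open_UNIV
         bounded_linear_ident)
  have "smooth_on UNIV (\<lambda>t. (?c t, ?c t ** hat (?u t)))"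
    by (intro smooth_on_Pair sc su smooth_on_bilinear[OF _ bounded_bilinear_matrix_mult] open_UNIV)
  then have "smooth_on {-1<..<1} (\<lambda>t. (?c t, ?c t ** hat (?u t)))" by (rule smooth_on_subset) simp
  moreover have "(?c has_vector_derivative ?c 0 ** hat a) (at 0)"
    using bounded_linear.has_vector_derivative[OF
        bounded_bilinear.bounded_linear_right[OF bounded_bilinear_matrix_mult]
        cayley_has_vector_derivative] by simp
  moreover have "(?u has_vector_derivative p) (at 0)"
    by (rule derivative_eq_intros refl | simp)+
  ultimately have "smooth_on {-1<..<1} (\<lambda>t. (?c t, ?c t ** hat (?u t)))"
    "((\<lambda>t. (?c t, ?c t ** hat (?u t))) has_vector_derivative v) (at 0)"
    using bundle_curve_has_vector_derivative[of ?c 0 a ?u p] by (simp_all add: v)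
  then show "v \<in> tangent_space (tangent_bundle SO3) (Q, Q ** hat w)"
    unfolding tangent_space_def using SO3_mult[OF assms cayley_in_SO3]
    by (intro CollectI exI[of _ "\<lambda>t. (?c t, ?c t ** hat (?u t))"] exI[of _ 1])
       (auto simp: tangent_bundle_SO3)
qed

section \<open>The equations of motion\<close>

lemma bounded_linear_matrix_mult_left: "bounded_linear (\<lambda>Y. Y ** (X :: real^3^3) :: real^3^3)"
  by (rule bounded_bilinear.bounded_linear_left[OF bounded_bilinear_matrix_mult])

lemma SO3_field_commutator: "Q ** hat b ** hat a - Q ** hat a ** hat b = Q ** hat (b \<times> a)"
  for Q :: "real^3^3"
  by (simp only: matrix_mul_assoc[symmetric] matrix_mult_diff[symmetric] hat_commutator)

text \<open>
  The form \<open>B\<close> is its own extension to the ambient space, with derivatives given by bilinearity.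
\<close>

lemma ext_deriv1_bilinear_SO3:
  assumes B: "bounded_bilinear B" and Q: "Q \<in> SO3"
  shows "ext_deriv1 SO3 B Q (Q ** hat a) (Q ** hat b)
    = B (Q ** hat a) (Q ** hat b) - B (Q ** hat b) (Q ** hat a)"
proof -
  have lin: "bounded_linear (\<lambda>y. B y v)" for v
    by (rule bounded_bilinear.bounded_linear_left[OF B])
  have ext: "local_one_form_extension SO3 B Q UNIV B"
    unfolding local_one_form_extension_def
    using bounded_linear.linear[OF bounded_bilinear.bounded_linear_right[OF B]]
      smooth_on_bounded_linear[OF open_UNIV lin] by simp
  have fd: "frechet_derivative (\<lambda>y. B y v) (at Q) = (\<lambda>h. B h v)" for v
    using bounded_linear_imp_has_derivative[OF lin] by (rule frechet_derivative_at[symmetric])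
  have "ext_deriv1 SO3 B Q (Q ** hat a) (Q ** hat b)
      = frechet_derivative (\<lambda>y. B y (Q ** hat b)) (at Q) (Q ** hat a)
      - frechet_derivative (\<lambda>y. B y (Q ** hat a)) (at Q) (Q ** hat b)"
    by (rule ext_deriv1_eq[OF ext Q bounded_linear_matrix_mult_left bounded_linear_matrix_mult_left])
       (simp_all add: tangent_space_SO3 Q SO3_field_commutator)
  then show ?thesis by (simp add: fd)
qed

lemma bounded_bilinear_Lambda: "bounded_bilinear (\<lambda>Q \<Omega>. body_velocity Q \<Omega> $ k)"
  unfolding bilinear_conv_bounded_bilinear[symmetric] bilinear_def
  by (auto intro!: linearI simp: body_velocity.add_left body_velocity.add_right
      body_velocity.scaleR_left body_velocity.scaleR_right)

text \<open>
  By \<open>vee_hat_mult\<close> the form \<open>d\<Lambda>\<^sub>i\<close> takes the value \<open>- (a \<times> b)\<^sub>i\<close> on these two vectors.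
\<close>

lemma gyro_form_SO3:
  assumes Q: "Q \<in> SO3"
  shows "gyro_form \<kappa> Q (Q ** hat a) (Q ** hat b) = - (\<kappa> Q \<bullet> (a \<times> b))"
proof -
  have L: "Lambda1 = (\<lambda>Q \<Omega>. body_velocity Q \<Omega> $ 1)" "Lambda2 = (\<lambda>Q \<Omega>. body_velocity Q \<Omega> $ 2)"
    "Lambda3 = (\<lambda>Q \<Omega>. body_velocity Q \<Omega> $ 3)"
    by (simp_all add: fun_eq_iff Lambda_body_velocity)
  have "ext_deriv1 SO3 (\<lambda>Q \<Omega>. body_velocity Q \<Omega> $ k) Q (Q ** hat a) (Q ** hat b) = - (a \<times> b) $ k" for k
    unfolding ext_deriv1_bilinear_SO3[OF bounded_bilinear_Lambda Q]
    using arg_cong[OF vee_hat_mult[of a b], of "\<lambda>x. x $ k"]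
    by (simp add: body_velocity_tangent[OF Q])
  then show ?thesis
    by (simp add: gyro_form_def L inner_vec_def sum_3)
qed

text \<open>
  These linear fields extend every vector tangent to the tangent bundle of \<open>SO3\<close> to a tangent field.
  On the bundle they are the left-invariant fields of the semidirect product of \<open>SO3\<close> and \<open>\<real>\<^sup>3\<close>, so
  their commutators are of the same kind.
\<close>

definition bundle_field :: "real^3 \<Rightarrow> real^3 \<Rightarrow> (real^3^3) \<times> (real^3^3) \<Rightarrow> (real^3^3) \<times> (real^3^3)" where
  "bundle_field a p y = (fst y ** hat a, snd y ** hat a + fst y ** hat p)"

lemma bounded_linear_bundle_field: "bounded_linear (bundle_field a p)"
  unfolding bundle_field_def[abs_def]
  by (intro bounded_linear_Pair bounded_linear_add
      bounded_linear_compose[OF bounded_linear_matrix_mult_left bounded_linear_fst]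
      bounded_linear_compose[OF bounded_linear_matrix_mult_left bounded_linear_snd])

lemma bundle_field_velocity:
  "bundle_field a p (Q, Q ** hat w) = bundle_velocity Q w a (p + w \<times> a)"
  unfolding bundle_field_def bundle_velocity_def
  by (simp add: matrix_mul_assoc[symmetric] matrix_add_ldistrib[symmetric]
      linear_add[OF linear_hat] hat_commutator[symmetric] add.commute)

lemma bundle_velocity_field:
  "bundle_velocity Q w a p = bundle_field a (p - w \<times> a) (Q, Q ** hat w)"
  by (simp add: bundle_field_velocity)

lemma bundle_field_tangent:
  "y \<in> tangent_bundle SO3 \<Longrightarrow> bundle_field a p y \<in> tangent_space (tangent_bundle SO3) y"
  unfolding tangent_bundle_SO3 using tangent_space_bundle_SO3 bundle_field_velocity by fastforce

lemma bundle_field_commutator: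
  "bundle_field a p (bundle_field b q y) - bundle_field b q (bundle_field a p y)
    = bundle_field (b \<times> a) (q \<times> a + b \<times> p) y"
proof -
  interpret m: bounded_bilinear "(**) :: real^3^3 \<Rightarrow> real^3^3 \<Rightarrow> real^3^3"
    by (rule bounded_bilinear_matrix_mult)
  show ?thesis
    by (simp add: bundle_field_def linear_add[OF linear_hat] hat_commutator[symmetric]
        m.add_left m.add_right m.diff_right matrix_mul_assoc)
qed

definition liouville_extension ::
  "(real^3 \<Rightarrow> real^3) \<Rightarrow> (real^3^3) \<times> (real^3^3) \<Rightarrow> (real^3^3) \<times> (real^3^3) \<Rightarrow> real" where
  "liouville_extension A y Y = A (body_velocity (fst y) (snd y)) \<bullet> body_velocity (fst y) (fst Y)"

lemma inertia_tensorD: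
  assumes "inertia_tensor A"
  shows "bounded_linear A" "A u \<bullet> v = u \<bullet> A v" "A u = A v \<Longrightarrow> u = v"
proof -
  have lin: "linear A" using assms by (simp add: inertia_tensor_def)
  then show "bounded_linear A" by (simp add: linear_conv_bounded_linear)
  show "A u \<bullet> v = u \<bullet> A v" using assms by (simp add: inertia_tensor_def)
  assume "A u = A v"
  then have "A (u - v) = 0" by (simp add: linear_diff[OF lin])
  then have "A (u - v) \<bullet> (u - v) = 0" by simp
  then show "u = v" using assms unfolding inertia_tensor_def by (metis eq_iff_diff_eq_0 less_irrefl)
qed

lemma smooth_on_fst_snd: "smooth_on UNIV fst" "smooth_on UNIV snd"
  by (auto intro!: smooth_on_bounded_linear bounded_linear_fst bounded_linear_snd)

lemma smooth_on_angular_velocity: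
  "bounded_linear A \<Longrightarrow> smooth_on UNIV (\<lambda>y. A (body_velocity (fst y) (snd y)))"
  by (rule smooth_on_bounded_linear_comp[OF open_UNIV _
        smooth_on_bilinear[OF open_UNIV bounded_bilinear_body_velocity smooth_on_fst_snd]])

lemma liouville_extension:
  assumes A: "inertia_tensor A"
  shows "local_one_form_extension (tangent_bundle SO3) (liouville_form (rigid_body A V \<kappa>)) y UNIV
    (liouville_extension A)"
proof -
  have "linear (liouville_extension A y)" for y
    unfolding liouville_extension_def
    by (rule linearI) (simp_all add: body_velocity.add_right body_velocity.scaleR_right inner_add_right)
  moreover have "smooth_on UNIV (\<lambda>y. liouville_extension A y Y)" for Y
    unfolding liouville_extension_def
    by (rule smooth_on_inner[OF open_UNIV smooth_on_angular_velocity[OF inertia_tensorD(1)[OF A]]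
        smooth_on_bilinear[OF open_UNIV bounded_bilinear_body_velocity smooth_on_fst_snd(1)
          smooth_on_const]])
  moreover have "liouville_extension A y v = liouville_form (rigid_body A V \<kappa>) y v"
    if y: "y \<in> tangent_bundle SO3" and v: "v \<in> tangent_space (tangent_bundle SO3) y" for y v
  proof -
    obtain Q u where Q: "Q \<in> SO3" "y = (Q, Q ** hat u)" using y tangent_bundle_SO3 by metis
    obtain a p where "v = bundle_velocity Q u a p" using v Q by (auto simp: tangent_space_bundle_SO3)
    with Q show ?thesis
      by (simp add: liouville_extension_def liouville_form_def rigid_body_def body_metric_def
          bundle_velocity_def angular_velocity_SO3 body_velocity_SO3)
  qed
  ultimately show ?thesis by (simp add: local_one_form_extension_def)
qed

lemma body_velocity_has_derivative:
  "((\<lambda>y. body_velocity (fst y) (snd y)) has_derivative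
      (\<lambda>h. body_velocity (fst y) (snd h) + body_velocity (fst h) (snd y))) (at y)"
  by (rule bounded_bilinear.FDERIV[OF bounded_bilinear_body_velocity])
     (auto intro: bounded_linear_imp_has_derivative bounded_linear_fst bounded_linear_snd)

lemma body_velocity_derivative_tangent:
  assumes "Q \<in> SO3"
  shows "body_velocity Q (snd (bundle_velocity Q w a p)) + body_velocity (fst (bundle_velocity Q w a p)) (Q ** hat w) = p"
  by (simp add: bundle_velocity_def body_velocity_SO3[OF assms] body_velocity_tangent[OF assms]
      linear_add[OF linear_vee])

text \<open>
  Only the product rule is used; the term with \<open>vee\<close> comes from the dependence of \<open>body_velocity\<close> on its
  first argument and becomes the cross product after antisymmetrisation.
\<close>

lemma liouville_extension_derivative:
  assumes A: "inertia_tensor A" and Q: "Q \<in> SO3"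
  shows "frechet_derivative (\<lambda>y. liouville_extension A y (bundle_velocity Q w b q)) (at (Q, Q ** hat w))
    (bundle_velocity Q w a p) = A p \<bullet> b - A w \<bullet> vee (hat a ** hat b)"
proof -
  let ?x = "(Q, Q ** hat w)" and ?Y = "bundle_velocity Q w b q"
  have 1: "((\<lambda>y. A (body_velocity (fst y) (snd y))) has_derivative
      (\<lambda>h. A (body_velocity (fst ?x) (snd h) + body_velocity (fst h) (snd ?x)))) (at ?x)"
    by (rule bounded_linear.has_derivative[OF inertia_tensorD(1)[OF A] body_velocity_has_derivative])
  have 2: "((\<lambda>y. body_velocity (fst y) (fst ?Y)) has_derivative
      (\<lambda>h. body_velocity (fst h) (fst ?Y))) (at ?x)"
    by (rule bounded_linear_imp_has_derivative)
       (rule bounded_linear_compose[OF body_velocity.bounded_linear_left bounded_linear_fst])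
  from frechet_derivative_at[OF bounded_bilinear.FDERIV[OF bounded_bilinear_inner 1 2], symmetric]
  show ?thesis
    by (simp add: liouville_extension_def body_velocity_derivative_tangent[OF Q])
       (simp add: bundle_velocity_def body_velocity_SO3[OF Q] body_velocity_tangent[OF Q])
qed

lemma symplectic_form_rigid_body:
  assumes A: "inertia_tensor A" and Q: "Q \<in> SO3"
  shows "symplectic_form (rigid_body A V \<kappa>) (Q, Q ** hat w)
      (bundle_velocity Q w a p) (bundle_velocity Q w b q)
    = A p \<bullet> b - A q \<bullet> a - (A w + \<kappa> Q) \<bullet> (a \<times> b)"
proof -
  let ?S = "rigid_body A V \<kappa>"
  have y: "(Q, Q ** hat w) \<in> tangent_bundle SO3" using Q by (auto simp: tangent_bundle_SO3)
  have "ext_deriv1 (tangent_bundle SO3) (liouville_form ?S) (Q, Q ** hat w)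
      (bundle_velocity Q w a p) (bundle_velocity Q w b q)
    = frechet_derivative (\<lambda>y. liouville_extension A y (bundle_velocity Q w b q)) (at (Q, Q ** hat w)) (bundle_velocity Q w a p)
    - frechet_derivative (\<lambda>y. liouville_extension A y (bundle_velocity Q w a p)) (at (Q, Q ** hat w)) (bundle_velocity Q w b q)"
    unfolding bundle_velocity_field
    by (rule ext_deriv1_eq[OF liouville_extension[OF A] y bounded_linear_bundle_field
          bounded_linear_bundle_field])
       (simp_all add: bundle_field_tangent bundle_field_commutator y)
  also have "\<dots> = A p \<bullet> b - A q \<bullet> a - A w \<bullet> (a \<times> b)"
    unfolding liouville_extension_derivative[OF A Q] vee_hat_mult[symmetric]
    by (simp add: inner_diff_right)
  finally show ?thesis
    by (simp add: symplectic_form_def rigid_body_def bundle_velocity_def gyro_form_SO3[OF Q]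
        inner_add_left)
qed

lemma differential_hamiltonian:
  assumes A: "inertia_tensor A" and Q: "Q \<in> SO3" and V: "local_extension SO3 V Q U V'"
  shows "differential (tangent_bundle SO3) (hamiltonian (rigid_body A V \<kappa>)) (Q, Q ** hat w)
      (bundle_velocity Q w b q)
    = A w \<bullet> q + frechet_derivative V' (at Q) (Q ** hat b)"
proof -
  let ?B = "\<lambda>y. body_velocity (fst y) (snd y)"
  define H where "H y = (A (?B y) \<bullet> ?B y) * (1 / 2) + V' (fst y)" for y
  have V': "open U" "Q \<in> U" "smooth_on U V'" "\<And>P. P \<in> U \<inter> SO3 \<Longrightarrow> V' P = V P"
    using V by (auto simp: local_extension_def)
  let ?W = "fst -` U :: ((real^3^3) * (real^3^3)) set"
  have opn: "open ?W" by (intro open_vimage_fst V')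
  have fst: "smooth_on ?W fst"
    by (rule smooth_on_bounded_linear[OF opn bounded_linear_fst])
  have "smooth_on ?W (\<lambda>y. V' (fst y))"
    by (rule smooth_on_compose[OF opn fst V'(3)]) auto
  moreover have "smooth_on UNIV (\<lambda>y. A (?B y) \<bullet> ?B y)"
    by (rule smooth_on_inner[OF open_UNIV smooth_on_angular_velocity[OF inertia_tensorD(1)[OF A]]
        smooth_on_bilinear[OF open_UNIV bounded_bilinear_body_velocity smooth_on_fst_snd]])
  ultimately have "smooth_on ?W H"
    unfolding H_def by (intro smooth_on_add[OF opn] smooth_on_mult[OF opn] smooth_on_const)
       (auto intro: smooth_on_subset)
  moreover have "H y = hamiltonian (rigid_body A V \<kappa>) y"
    if y: "y \<in> ?W \<inter> tangent_bundle SO3" for y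
  proof -
    obtain P u where "P \<in> SO3" "y = (P, P ** hat u)"
      using y tangent_bundle_SO3[of y] by blast
    moreover from this have "P \<in> U" using y by simp
    ultimately show ?thesis
      by (simp add: H_def hamiltonian_def rigid_body_def body_metric_def angular_velocity_SO3
          body_velocity_SO3 V'(4))
  qed
  ultimately have ext: "local_extension (tangent_bundle SO3) (hamiltonian (rigid_body A V \<kappa>))
      (Q, Q ** hat w) ?W H"
    using opn V'(2) by (simp add: local_extension_def)
  let ?x = "(Q, Q ** hat w)"
  let ?dB = "\<lambda>h. body_velocity (fst ?x) (snd h) + body_velocity (fst h) (snd ?x)"
  have 1: "(?B has_derivative ?dB) (at ?x)" by (rule body_velocity_has_derivative)
  have 2: "((\<lambda>y. V' (fst y)) has_derivative (\<lambda>h. frechet_derivative V' (at Q) (fst h))) (at ?x)"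
    by (rule has_derivative_compose[where f = fst])
       (auto intro!: bounded_linear_imp_has_derivative bounded_linear_fst
         smooth_on_has_derivative V')
  have "(H has_derivative (\<lambda>h. (A (?B ?x) \<bullet> ?dB h + A (?dB h) \<bullet> ?B ?x) * (1/2)
      + frechet_derivative V' (at Q) (fst h))) (at ?x)"
    unfolding H_def
    by (rule has_derivative_add[OF has_derivative_mult_left[OF
          bounded_bilinear.FDERIV[OF bounded_bilinear_inner
            bounded_linear.has_derivative[OF inertia_tensorD(1)[OF A] 1] 1]] 2])
  from frechet_derivative_at[OF this, symmetric]
  have "frechet_derivative H (at ?x) (bundle_velocity Q w b q)
      = (A w \<bullet> q + A q \<bullet> w) / 2 + frechet_derivative V' (at Q) (Q ** hat b)"
    by (simp add: body_velocity_derivative_tangent[OF Q] body_velocity_SO3[OF Q])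
       (simp add: bundle_velocity_def)
  moreover have "A q \<bullet> w = A w \<bullet> q"
    using inertia_tensorD(2)[OF A, of q w] by (simp add: inner_commute)
  moreover have "bundle_velocity Q w b q \<in> tangent_space (tangent_bundle SO3) ?x"
    by (auto simp: tangent_space_bundle_SO3[OF Q])
  ultimately show ?thesis by (simp add: differential_eq[OF _ ext])
qed

text \<open>
  Testing with \<open>b = 0\<close> forces \<open>A a = A w\<close>, and then testing with \<open>q = 0\<close> forces \<open>A p = A \<nu>\<close>; positive
  definiteness of \<open>A\<close> gives uniqueness.
\<close>

lemma dynamics_rigid_body:
  assumes A: "inertia_tensor A" and Q: "Q \<in> SO3" and V: "local_extension SO3 V Q U V'"
    and \<nu>: "\<And>b. A \<nu> \<bullet> b = (A w + \<kappa> Q) \<bullet> (w \<times> b) - frechet_derivative V' (at Q) (Q ** hat b)"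
  shows "dynamics (rigid_body A V \<kappa>) (Q, Q ** hat w) = bundle_velocity Q w w \<nu>"
  unfolding dynamics_def
proof (rule the_equality)
  have cfg: "config (rigid_body A V \<kappa>) = SO3" by (simp add: rigid_body_def)
  have V': "linear (frechet_derivative V' (at Q))"
    using V by (auto simp: local_extension_def intro!: has_derivative_linear smooth_on_has_derivative)
  let ?P = "\<lambda>X. X \<in> tangent_space (tangent_bundle SO3) (Q, Q ** hat w) \<and>
     (\<forall>Y\<in>tangent_space (tangent_bundle SO3) (Q, Q ** hat w).
        symplectic_form (rigid_body A V \<kappa>) (Q, Q ** hat w) X Y
        = - differential (tangent_bundle SO3) (hamiltonian (rigid_body A V \<kappa>)) (Q, Q ** hat w) Y)"
  have eq: "?P (bundle_velocity Q w a p) \<longleftrightarrow> (\<forall>b q. A p \<bullet> b - A q \<bullet> a - (A w + \<kappa> Q) \<bullet> (a \<times> b)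
      = - (A w \<bullet> q + frechet_derivative V' (at Q) (Q ** hat b)))" for a p
  proof -
    have "bundle_velocity Q w a p \<in> tangent_space (tangent_bundle SO3) (Q, Q ** hat w)"
      unfolding tangent_space_bundle_SO3[OF Q] by blast
    moreover have "(\<forall>Y\<in>tangent_space (tangent_bundle SO3) (Q, Q ** hat w). \<phi> Y)
        \<longleftrightarrow> (\<forall>b q. \<phi> (bundle_velocity Q w b q))" for \<phi>
      unfolding tangent_space_bundle_SO3[OF Q] by blast
    ultimately show ?thesis
      by (simp only: symplectic_form_rigid_body[OF A Q] differential_hamiltonian[OF A Q V] simp_thms)
  qed
  have sym: "A q \<bullet> w = A w \<bullet> q" for q
    using inertia_tensorD(2)[OF A, of q w] by (simp add: inner_commute)
  show "bundle_velocity Q w w \<nu> \<in> tangent_space (tangent_bundle (config (rigid_body A V \<kappa>))) (Q, Q ** hat w) \<and>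
    (\<forall>Y\<in>tangent_space (tangent_bundle (config (rigid_body A V \<kappa>))) (Q, Q ** hat w).
        symplectic_form (rigid_body A V \<kappa>) (Q, Q ** hat w) (bundle_velocity Q w w \<nu>) Y
        = - differential (tangent_bundle (config (rigid_body A V \<kappa>))) (hamiltonian (rigid_body A V \<kappa>)) (Q, Q ** hat w) Y)"
    unfolding cfg eq by (simp add: \<nu> sym)
  fix X assume "X \<in> tangent_space (tangent_bundle (config (rigid_body A V \<kappa>))) (Q, Q ** hat w) \<and>
    (\<forall>Y\<in>tangent_space (tangent_bundle (config (rigid_body A V \<kappa>))) (Q, Q ** hat w).
        symplectic_form (rigid_body A V \<kappa>) (Q, Q ** hat w) X Y
        = - differential (tangent_bundle (config (rigid_body A V \<kappa>))) (hamiltonian (rigid_body A V \<kappa>)) (Q, Q ** hat w) Y)"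
  then have X: "?P X" unfolding cfg .
  then obtain a p where Xap: "X = bundle_velocity Q w a p"
    by (auto simp: tangent_space_bundle_SO3[OF Q])
  have *: "A p \<bullet> b - A q \<bullet> a - (A w + \<kappa> Q) \<bullet> (a \<times> b)
      = - (A w \<bullet> q + frechet_derivative V' (at Q) (Q ** hat b))" for b q
    using X unfolding Xap eq by blast
  have hat0: "hat 0 = 0" by (rule linear_0[OF linear_hat])
  have "(A a - A w) \<bullet> q = 0" for q
    using *[of 0 q] inertia_tensorD(2)[OF A, of q a]
    by (simp add: hat0 linear_0[OF V'] inner_diff_left inner_diff_right inner_commute)
  then have "A a = A w" by (metis eq_iff_diff_eq_0 inner_eq_zero_iff)
  then have a: "a = w" by (rule inertia_tensorD(3)[OF A])
  have A0: "A 0 = 0" using inertia_tensorD(1)[OF A] by (rule linear_0[OF bounded_linear.linear])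
  have "(A p - A \<nu>) \<bullet> b = 0" for b
    using *[of b 0] by (simp add: a A0 \<nu> inner_diff_left)
  then have "A p = A \<nu>" by (metis eq_iff_diff_eq_0 inner_eq_zero_iff)
  then have "p = \<nu>" by (rule inertia_tensorD(3)[OF A])
  then show "X = bundle_velocity Q w w \<nu>" by (simp add: Xap a)
qed

section \<open>Local existence of trajectories\<close>

text \<open>
  Picard iteration on bounded continuous functions on the whole line.  Clamping the upper limit of
  the integral to \<open>[-h, h]\<close> keeps the iterates bounded, and \<open>h\<close> is so small that the iteration is a
  contraction.
\<close>

lemma picard_global_lipschitz:
  fixes f :: "'a::euclidean_space \<Rightarrow> 'a"
  assumes lip: "\<And>x y. norm (f x - f y) \<le> L * norm (x - y)" and L: "0 \<le> L"
    and bnd: "\<And>x. norm (f x) \<le> B"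
  shows "\<exists>h>0. \<exists>c. c 0 = x0 \<and> (\<forall>t\<in>{-h<..<h}. (c has_vector_derivative f (c t)) (at t))"
proof -
  \<comment> \<open>The two integrals below have total length at most \<open>3 * h\<close>, which gives the contraction factor \<open>3 / 4\<close>.\<close>
  define h where "h = 1 / (4 * (L + 1))"
  have h: "h > 0" using L by (simp add: h_def)
  have hL: "3 * h * L \<le> 3 / 4" using L by (simp add: h_def field_simps)
  have B: "0 \<le> B" using bnd[of x0] norm_ge_zero order_trans by blast
  have contf: "continuous_on S f" for S
  proof (rule lipschitz_on_continuous_on[of L])
    show "L-lipschitz_on S f" using lip L by (auto simp: lipschitz_on_def dist_norm)
  qed
  define cl where "cl t = max (-h) (min h t)" for t :: real
  have cl: "-h \<le> cl t" "cl t \<le> h" for t using h by (auto simp: cl_def)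
  have cl_id: "t \<in> {-h..h} \<Longrightarrow> cl t = t" for t by (auto simp: cl_def)
  define \<Phi> where "\<Phi> X t = x0 + integral {-h..cl t} (\<lambda>s. f (X s)) - integral {-h..0} (\<lambda>s. f (X s))" for X t
  have cX: "continuous_on S (\<lambda>s. f (apply_bcontfun X s))" for S and X :: "real \<Rightarrow>\<^sub>C 'a"
    by (rule continuous_on_compose2[OF contf[of UNIV]]) auto
  have int_bound: "norm (integral {-h..t} g) \<le> K * (t + h)"
    if "continuous_on {-h..t} g" "\<And>s. norm (g s) \<le> K" "-h \<le> t" for g :: "real \<Rightarrow> 'a" and t K
    using integral_bound[OF that(3,1), of K] that(2) by simp
  have mem: "\<Phi> (apply_bcontfun X) \<in> bcontfun" for X :: "real \<Rightarrow>\<^sub>C 'a"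
  proof (rule bcontfun_normI)
    have "continuous_on {-h..h} (\<lambda>t. integral {-h..t} (\<lambda>s. f (apply_bcontfun X s)))"
      by (intro indefinite_integral_continuous_1 integrable_continuous_real cX)
    moreover have "continuous_on UNIV cl" unfolding cl_def by (intro continuous_intros)
    ultimately have "continuous_on UNIV (\<lambda>t. integral {-h..cl t} (\<lambda>s. f (apply_bcontfun X s)))"
      by (rule continuous_on_compose2) (use cl in auto)
    then show "continuous_on UNIV (\<Phi> (apply_bcontfun X))"
      unfolding \<Phi>_def by (intro continuous_intros)
    fix t
    have 1: "norm (integral {-h..cl t} (\<lambda>s. f (apply_bcontfun X s))) \<le> B * (cl t + h)"
      by (rule int_bound[OF cX bnd cl(1)])
    have 2: "norm (integral {-h..0} (\<lambda>s. f (apply_bcontfun X s))) \<le> B * (0 + h)"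
      by (rule int_bound[OF cX bnd]) (use h in simp)
    have "B * (cl t + h) \<le> B * (2 * h)" using B cl(2)[of t] by (intro mult_left_mono) auto
    then show "norm (\<Phi> (apply_bcontfun X) t) \<le> norm x0 + B * (2 * h) + B * (0 + h)"
      unfolding \<Phi>_def
      using 1 2 norm_triangle_ineq4[of "x0 + integral {-h..cl t} (\<lambda>s. f (apply_bcontfun X s))"
          "integral {-h..0} (\<lambda>s. f (apply_bcontfun X s))"]
        norm_triangle_ineq[of x0 "integral {-h..cl t} (\<lambda>s. f (apply_bcontfun X s))"] by linarith
  qed
  define P where "P X = Bcontfun (\<Phi> (apply_bcontfun X))" for X :: "real \<Rightarrow>\<^sub>C 'a"
  have P: "apply_bcontfun (P X) = \<Phi> (apply_bcontfun X)" for X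
    unfolding P_def by (rule Bcontfun_inverse[OF mem])
  have "\<forall>X Y. dist (P X) (P Y) \<le> 3 / 4 * dist X Y"
  proof (intro allI)
    fix X Y :: "real \<Rightarrow>\<^sub>C 'a"
    show "dist (P X) (P Y) \<le> 3 / 4 * dist X Y"
    proof (rule dist_bound)
      fix t
      define g where "g s = f (apply_bcontfun X s) - f (apply_bcontfun Y s)" for s
      have g: "continuous_on S g" for S unfolding g_def by (intro continuous_on_diff cX)
      have gb: "norm (g s) \<le> L * dist X Y" for s
      proof -
        have "norm (g s) \<le> L * dist (apply_bcontfun X s) (apply_bcontfun Y s)"
          using lip by (simp add: g_def dist_norm)
        also have "\<dots> \<le> L * dist X Y" using L dist_bounded by (intro mult_left_mono) auto
        finally show ?thesis .
      qed
      have split: "integral {-h..t} g = integral {-h..t} (\<lambda>s. f (apply_bcontfun X s)) - integral {-h..t} (\<lambda>s. f (apply_bcontfun Y s))" for t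
        unfolding g_def by (intro integral_diff integrable_continuous_real cX)
      have "dist (\<Phi> (apply_bcontfun X) t) (\<Phi> (apply_bcontfun Y) t)
          = norm (integral {-h..cl t} g - integral {-h..0} g)"
        unfolding split \<Phi>_def dist_norm by (simp add: algebra_simps)
      also have "\<dots> \<le> norm (integral {-h..cl t} g) + norm (integral {-h..0} g)"
        by (rule norm_triangle_ineq4)
      also have "\<dots> \<le> L * dist X Y * (cl t + h) + L * dist X Y * (0 + h)"
        using h cl by (intro add_mono int_bound g gb) auto
      also have "\<dots> \<le> L * dist X Y * (2 * h) + L * dist X Y * (0 + h)"
        using L cl(2)[of t] by (intro add_mono mult_left_mono) auto
      also have "\<dots> = (3 * h * L) * dist X Y" by (simp add: algebra_simps)
      also have "\<dots> \<le> 3 / 4 * dist X Y" using hL by (intro mult_right_mono) auto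
      finally show "dist (apply_bcontfun (P X) t) (apply_bcontfun (P Y) t) \<le> 3 / 4 * dist X Y"
        by (simp add: P)
    qed
  qed
  then obtain X where "P X = X" using banach_fix_type[of "3/4" P] by auto
  then have X: "apply_bcontfun X = \<Phi> (apply_bcontfun X)" using P[of X] by simp
  have "apply_bcontfun X 0 = x0"
    by (subst X) (use cl_id[of 0] h in \<open>simp add: \<Phi>_def\<close>)
  moreover have "(apply_bcontfun X has_vector_derivative f (apply_bcontfun X t)) (at t)"
    if t: "t \<in> {-h<..<h}" for t
  proof -
    have "((\<lambda>u. integral {-h..u} (\<lambda>s. f (apply_bcontfun X s))) has_vector_derivative f (apply_bcontfun X t)) (at t within {-h..h})"
      by (rule integral_has_vector_derivative[OF cX]) (use t in auto)
    moreover have "at t within {-h..h} = at t"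
      using t by (intro at_within_interior) (simp add: interior_atLeastAtMost_real)
    ultimately have "((\<lambda>u. integral {-h..u} (\<lambda>s. f (apply_bcontfun X s))) has_vector_derivative f (apply_bcontfun X t)) (at t)"
      by simp
    then have d: "((\<lambda>u. x0 + integral {-h..u} (\<lambda>s. f (apply_bcontfun X s)) - integral {-h..0} (\<lambda>s. f (apply_bcontfun X s)))
        has_vector_derivative f (apply_bcontfun X t)) (at t)"
      by (auto intro!: derivative_eq_intros)
    show ?thesis
    proof (rule has_vector_derivative_eventually_eq[OF d])
      have "\<forall>\<^sub>F u in nhds t. u \<in> {-h<..<h}" using t by (intro eventually_nhds_in_open) auto
      then show "\<forall>\<^sub>F u in nhds t. x0 + integral {-h..u} (\<lambda>s. f (apply_bcontfun X s)) - integral {-h..0} (\<lambda>s. f (apply_bcontfun X s)) = apply_bcontfun X u"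
      proof eventually_elim
        case (elim u)
        then show ?case using fun_cong[OF X, of u] cl_id[of u] by (simp add: \<Phi>_def)
      qed
    qed
  qed
  ultimately show ?thesis using h by blast
qed

lemma smooth_on_locally_lipschitz:
  fixes f :: "'a::euclidean_space \<Rightarrow> 'b::real_normed_vector"
  assumes f: "smooth_on U f" and S: "compact S" "convex S" "S \<subseteq> U"
  shows "\<exists>L\<ge>0. \<forall>x\<in>S. \<forall>y\<in>S. norm (f x - f y) \<le> L * norm (x - y)"
proof -
  have "\<exists>K. \<forall>x\<in>S. norm (frechet_derivative f (at x) b) \<le> K" for b
  proof -
    have "continuous_on S (\<lambda>x. frechet_derivative f (at x) b)"
      using smooth_on_continuous[OF smooth_on_frechet_derivative[OF f]] S(3)
      by (rule continuous_on_subset)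
    then show ?thesis
      using compact_imp_bounded[OF compact_continuous_image[OF _ S(1)]]
      by (force simp: bounded_iff)
  qed
  then obtain K where K: "\<And>x b. x \<in> S \<Longrightarrow> norm (frechet_derivative f (at x) b) \<le> K b" by metis
  define L where "L = (\<Sum>b\<in>(Basis::'a set). \<bar>K b\<bar>)"
  have L: "0 \<le> L" by (simp add: L_def sum_nonneg)
  have d: "(f has_derivative frechet_derivative f (at x)) (at x)" if "x \<in> S" for x
    using that S(3) by (intro smooth_on_has_derivative[OF f]) auto
  have "norm (frechet_derivative f (at x) v) \<le> L * norm v" if x: "x \<in> S" for x v
  proof -
    have lin: "linear (frechet_derivative f (at x))" using d[OF x] by (rule has_derivative_linear)
    have "frechet_derivative f (at x) v = (\<Sum>b\<in>Basis. (v \<bullet> b) *\<^sub>R frechet_derivative f (at x) b)"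
      by (rule linear_basis_expansion[OF lin])
    also have "norm \<dots> \<le> (\<Sum>b\<in>Basis. norm v * \<bar>K b\<bar>)"
    proof (rule sum_norm_le)
      fix b :: 'a assume "b \<in> Basis"
      then show "norm ((v \<bullet> b) *\<^sub>R frechet_derivative f (at x) b) \<le> norm v * \<bar>K b\<bar>"
        using K[OF x, of b] Basis_le_norm[of b v] by (auto intro!: mult_mono)
    qed
    also have "\<dots> = L * norm v" by (simp add: L_def sum_distrib_left mult.commute)
    finally show ?thesis .
  qed
  then have on: "onorm (frechet_derivative f (at x)) \<le> L" if "x \<in> S" for x
    using L that by (intro onorm_bound) auto
  have "norm (f x - f y) \<le> L * norm (x - y)" if "x \<in> S" "y \<in> S" for x y
    by (rule differentiable_bound[OF S(2) _ on that]) (rule has_derivative_at_withinI[OF d])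
  with L show ?thesis by blast
qed

text \<open>
  Composing \<open>f\<close> with the projection onto a closed ball makes it bounded and globally Lipschitz, and a
  solution of the modified equation stays in the ball for a short time, where nothing was changed.
\<close>

theorem smooth_ode_local_solution:
  fixes f :: "'a::euclidean_space \<Rightarrow> 'a"
  assumes U: "open U" "x0 \<in> U" and f: "smooth_on U f"
  shows "\<exists>h>0. \<exists>c. c 0 = x0 \<and>
    (\<forall>t\<in>{-h<..<h}. c t \<in> U \<and> (c has_vector_derivative f (c t)) (at t))"
proof -
  obtain r where r: "r > 0" "cball x0 r \<subseteq> U" using U open_contains_cball by blast
  let ?S = "cball x0 r"
  let ?p = "closest_point ?S"
  have S: "closed ?S" "?S \<noteq> {}" "convex ?S" using r by auto
  have pS: "?p x \<in> ?S" for x by (rule closest_point_in_set[OF S(1,2)])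
  obtain L where L: "0 \<le> L" "\<And>x y. x \<in> ?S \<Longrightarrow> y \<in> ?S \<Longrightarrow> norm (f x - f y) \<le> L * norm (x - y)"
    using smooth_on_locally_lipschitz[OF f compact_cball convex_cball r(2)] by blast
  have "norm (f (?p x) - f (?p y)) \<le> L * norm (x - y)" for x y
  proof -
    have "norm (f (?p x) - f (?p y)) \<le> L * norm (?p x - ?p y)" by (rule L(2)[OF pS pS])
    also have "\<dots> \<le> L * norm (x - y)"
      using closest_point_lipschitz[OF S(3,1,2), of x y] L(1)
      by (intro mult_left_mono) (auto simp: dist_norm)
    finally show ?thesis .
  qed
  moreover have "norm (f (?p x)) \<le> norm (f x0) + L * r" for x
  proof -
    have "norm (f (?p x) - f x0) \<le> L * norm (?p x - x0)" using r by (intro L(2) pS) auto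
    also have "\<dots> \<le> L * r"
      using pS[of x] L(1) by (intro mult_left_mono) (auto simp: dist_norm norm_minus_commute)
    finally show ?thesis using norm_triangle_ineq2[of "f (?p x)" "f x0"] by linarith
  qed
  ultimately obtain h c where h: "h > 0" and c0: "c 0 = x0"
    and c: "\<And>t. t \<in> {-h<..<h} \<Longrightarrow> (c has_vector_derivative f (?p (c t))) (at t)"
    using picard_global_lipschitz[of "\<lambda>x. f (?p x)" L _ x0] L(1) by blast
  have "isCont c 0" using c[of 0] h by (auto intro: has_vector_derivative_continuous)
  then obtain d where d: "d > 0" "\<And>t. \<bar>t\<bar> < d \<Longrightarrow> dist (c t) (c 0) < r"
    using r(1) unfolding continuous_at_eps_delta by (auto simp: dist_real_def)
  have "c t \<in> U \<and> (c has_vector_derivative f (c t)) (at t)" if t: "t \<in> {- min h d<..<min h d}" for t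
  proof -
    have "\<bar>t\<bar> < d" using t by auto
    then have ct: "c t \<in> ?S" using d(2)[of t] by (simp add: c0 dist_commute less_imp_le)
    have "(c has_vector_derivative f (?p (c t))) (at t)" using t by (intro c) auto
    then show ?thesis using ct r(2) closest_point_self[OF ct] by auto
  qed
  moreover have "min h d > 0" using h d by simp
  ultimately show ?thesis using c0 by blast
qed

section \<open>Functions of the first row\<close>

lemma local_extension_curve_derivative:
  assumes ext: "local_extension M f (c t) U g" and c: "(c has_vector_derivative v) (at t)"
    and M: "\<forall>\<^sub>F s in nhds t. c s \<in> M"
  shows "((\<lambda>s. f (c s)) has_vector_derivative frechet_derivative g (at (c t)) v) (at t)"
proof -
  have g: "open U" "c t \<in> U" "smooth_on U g" "\<And>y. y \<in> U \<inter> M \<Longrightarrow> g y = f y"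
    using ext by (auto simp: local_extension_def)
  have d: "((\<lambda>s. g (c s)) has_vector_derivative frechet_derivative g (at (c t)) v) (at t)"
    by (rule has_vector_derivative_compose[OF c smooth_on_has_derivative[OF g(3,2)]])
  have "isCont c t" using c by (rule has_vector_derivative_continuous)
  then have "\<forall>\<^sub>F s in nhds t. c s \<in> U"
    using g(1,2) by (auto simp: isCont_def eventually_nhds_conv_at dest: topological_tendstoD)
  with M have "\<forall>\<^sub>F s in nhds t. g (c s) = f (c s)" by eventually_elim (simp add: g(4))
  with d show ?thesis by (rule has_vector_derivative_eventually_eq)
qed

lemma has_vector_derivative_zero_constant:
  assumes "convex I" "\<And>t. t \<in> I \<Longrightarrow> (f has_vector_derivative 0) (at t within I)"
  obtains k where "\<And>t. t \<in> I \<Longrightarrow> f t = k"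
  using has_derivative_zero_constant[OF assms(1), of f] assms(2)
  by (auto simp: has_vector_derivative_def)

lemma hat_mult_vec: "hat w *v x = w \<times> x"
  by (simp add: vec_eq_iff forall_3 matrix_vector_mult_def sum_3 cross3_def algebra_simps)

lemma linear_alpha: "linear alpha"
  by (rule linearI) (simp_all add: alpha_def row_def vec_eq_iff)

lemmas bounded_linear_alpha = linear_conv_bounded_linear[THEN iffD1, OF linear_alpha]

lemma alpha_mult_hat: "alpha (Q ** hat w) = alpha Q \<times> w"
  by (simp add: alpha_def row_def vec_eq_iff forall_3 matrix_matrix_mult_def sum_3 cross3_def
      algebra_simps)

lemma mult_alpha: "Q \<in> SO3 \<Longrightarrow> Q *v alpha Q = axis 1 1"
proof -
  assume "Q \<in> SO3"
  have "Q *v alpha Q = (Q ** transpose Q) *v axis 1 1"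
    by (simp add: alpha_def row_def vec_eq_iff forall_3 matrix_vector_mult_def
        matrix_matrix_mult_def sum_3 transpose_def axis_def)
  then show ?thesis using SO3_D(2)[OF \<open>Q \<in> SO3\<close>] by simp
qed

lemma norm_alpha: "Q \<in> SO3 \<Longrightarrow> norm (alpha Q) = 1"
  unfolding SO3_def rotation_matrix_def using orthogonal_matrix_orthonormal_rows[of Q]
  by (auto simp: alpha_def)

lemma hat_axis_mult: "Q \<in> SO3 \<Longrightarrow> hat (axis 1 1) ** Q = Q ** hat (alpha Q)"
proof -
  assume Q: "Q \<in> SO3"
  have "(hat (axis 1 1) ** Q) *v x = (Q ** hat (alpha Q)) *v x" for x
    using cross_rotation_matrix[of Q "alpha Q" x] Q
    by (simp add: matrix_vector_mul_assoc[symmetric] hat_mult_vec mult_alpha SO3_def)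
  then show ?thesis by (simp add: matrix_eq)
qed

definition axis_rotation :: "real \<Rightarrow> real^3^3" where
  "axis_rotation t = vector [vector [1, 0, 0], vector [0, cos t, - sin t], vector [0, sin t, cos t]]"

lemma axis_rotation_entries [simp]:
  "axis_rotation t $ 1 = vector [1, 0, 0]"
  "axis_rotation t $ 2 = vector [0, cos t, - sin t]"
  "axis_rotation t $ 3 = vector [0, sin t, cos t]"
  by (simp_all add: axis_rotation_def)

lemma axis_rotation_0: "axis_rotation 0 = mat 1"
  by (simp add: vec_eq_iff forall_3 mat_def)

lemma axis_rotation_in_SO3: "axis_rotation t \<in> SO3"
proof (rule SO3_I)
  show "axis_rotation t ** transpose (axis_rotation t) = mat 1"
    using sin_cos_squared_add[of t]
    by (simp add: vec_eq_iff forall_3 matrix_matrix_mult_def sum_3 mat_def transpose_def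
        power2_eq_square add.commute)
  show "det (axis_rotation t) = 1"
    using sin_cos_squared_add[of t] by (simp add: det_3 power2_eq_square add.commute)
qed

lemma alpha_axis_rotation_mult: "alpha (axis_rotation t ** Q) = alpha Q"
  by (simp add: alpha_def row_def vec_eq_iff matrix_matrix_mult_def sum_3)

lemma axis_rotation_orbit_velocity:
  assumes Q: "Q \<in> SO3"
  shows "((\<lambda>t. axis_rotation t ** Q) has_vector_derivative
      (axis_rotation t ** Q) ** hat (alpha (axis_rotation t ** Q))) (at t)"
proof -
  let ?P = "axis_rotation t ** Q"
  define C :: "real^3^3" where "C = vector [vector [1, 0, 0], 0, 0]"
  define D :: "real^3^3" where "D = vector [0, vector [0, 1, 0], vector [0, 0, 1]]"
  define E :: "real^3^3" where "E = vector [0, vector [0, 0, -1], vector [0, 1, 0]]"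
  have rot: "axis_rotation = (\<lambda>t. C + cos t *\<^sub>R D + sin t *\<^sub>R E)"
    by (simp add: fun_eq_iff vec_eq_iff forall_3 C_def D_def E_def)
  have "((\<lambda>t. C + cos t *\<^sub>R D + sin t *\<^sub>R E) has_vector_derivative - sin t *\<^sub>R D + cos t *\<^sub>R E) (at t)"
    by (auto intro!: derivative_eq_intros simp: has_real_derivative_iff_has_vector_derivative[symmetric])
  moreover have "- sin t *\<^sub>R D + cos t *\<^sub>R E = hat (axis 1 1) ** axis_rotation t"
    by (simp add: vec_eq_iff forall_3 D_def E_def matrix_matrix_mult_def sum_3 axis_def)
  ultimately have "(axis_rotation has_vector_derivative hat (axis 1 1) ** axis_rotation t) (at t)"
    by (simp add: rot)
  then have "((\<lambda>t. axis_rotation t ** Q) has_vector_derivative hat (axis 1 1) ** axis_rotation t ** Q) (at t)"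
    by (rule bounded_linear.has_vector_derivative[OF bounded_linear_matrix_mult_left])
  moreover have "hat (axis 1 1) ** axis_rotation t ** Q = ?P ** hat (alpha ?P)"
    using hat_axis_mult[OF SO3_mult[OF axis_rotation_in_SO3 Q, of t]] by (simp add: matrix_mul_assoc)
  ultimately show ?thesis by simp
qed

text \<open>
  The quotient \<open>P Q\<^sup>T\<close> is a rotation that fixes the first axis.
\<close>

lemma alpha_fibre:
  assumes P: "P \<in> SO3" and Q: "Q \<in> SO3" and eq: "alpha P = alpha Q"
  shows "\<exists>t. P = axis_rotation t ** Q"
proof -
  define S where "S = P ** transpose Q"
  have "transpose Q \<in> SO3"
    using Q by (simp add: SO3_def rotation_matrix_def orthogonal_matrix_transpose det_transpose)
  then have S: "S \<in> SO3" unfolding S_def using P by (rule SO3_mult[rotated])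
  have "row 1 S = Q *v alpha P"
    by (simp add: S_def alpha_def row_def vec_eq_iff matrix_matrix_mult_def
        matrix_vector_mult_def transpose_def mult.commute)
  then have "row 1 S = axis 1 1" using mult_alpha[OF Q] eq by simp
  then have r1: "S$1$1 = 1" "S$1$2 = 0" "S$1$3 = 0"
    by (simp_all add: row_def vec_eq_iff forall_3 axis_def)
  have o: "(\<Sum>k\<in>UNIV. S$i$k * S$j$k) = (if i = j then 1 else 0)" for i j
    using arg_cong[OF SO3_D(2)[OF S], of "\<lambda>X. X $ i $ j"]
    by (simp add: matrix_matrix_mult_def transpose_def mat_def)
  have c1: "S$2$1 = 0" "S$3$1 = 0"
    using o[of 2 1] o[of 3 1] by (simp_all add: sum_3 r1)
  have n2: "(S$2$2)\<^sup>2 + (S$2$3)\<^sup>2 = 1" and n3: "(S$3$2)\<^sup>2 + (S$3$3)\<^sup>2 = 1"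
    using o[of 2 2] o[of 3 3] by (simp_all add: sum_3 c1 power2_eq_square)
  have det: "S$2$2 * S$3$3 - S$2$3 * S$3$2 = 1"
    using SO3_D(3)[OF S] by (simp add: det_3 r1 c1)
  \<comment> \<open>This is the sum of the squared norms of the last two rows minus twice the determinant.\<close>
  have "(S$2$2 - S$3$3)\<^sup>2 + (S$2$3 + S$3$2)\<^sup>2 = 0"
    using n2 n3 det by (simp add: power2_eq_square algebra_simps)
  then have e: "S$3$3 = S$2$2" "S$3$2 = - S$2$3"
    by (simp_all add: sum_power2_eq_zero_iff)
  obtain t where "S$2$2 = cos t" "- S$2$3 = sin t"
    using sincos_total_2pi[of "S$2$2" "- S$2$3"] n2 by auto
  then have "S = axis_rotation t"
    by (simp add: vec_eq_iff forall_3 r1 c1 e)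
  moreover have "P = S ** Q"
    using SO3_D(1)[OF Q] by (simp add: S_def matrix_mul_assoc[symmetric])
  ultimately show ?thesis by blast
qed

lemma function_of_alpha_derivative:
  assumes f: "function_of_alpha f" and Q: "Q \<in> SO3" and ext: "local_extension SO3 f Q U g"
  shows "frechet_derivative g (at Q) (Q ** hat (alpha Q)) = 0"
proof -
  obtain \<phi> where \<phi>: "\<And>P. P \<in> SO3 \<Longrightarrow> f P = \<phi> (alpha P)"
    using f by (auto simp: function_of_alpha_def)
  let ?c = "\<lambda>t. axis_rotation t ** Q"
  have "((\<lambda>t. f (?c t)) has_vector_derivative frechet_derivative g (at (?c 0)) (?c 0 ** hat (alpha (?c 0)))) (at 0)"
    by (rule local_extension_curve_derivative[where M = SO3 and U = U, OF _ axis_rotation_orbit_velocity[OF Q]])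
       (simp_all add: axis_rotation_0 ext SO3_mult axis_rotation_in_SO3 Q)
  moreover have "(\<lambda>t. f (?c t)) = (\<lambda>t. f Q)"
    by (simp add: \<phi> SO3_mult axis_rotation_in_SO3 Q alpha_axis_rotation_mult)
  ultimately have "((\<lambda>t. f Q) has_vector_derivative frechet_derivative g (at Q) (Q ** hat (alpha Q))) (at 0)"
    by (simp add: axis_rotation_0)
  then show ?thesis using vector_derivative_unique_at has_vector_derivative_const by metis
qed

text \<open>
  A function with vanishing derivative along the rotations about the first axis is constant on their
  orbits, and these are the fibres of \<open>alpha\<close>.
\<close>

lemma function_of_alphaI:
  assumes f: "smooth_function SO3 f"
    and zero: "\<And>Q U g. Q \<in> SO3 \<Longrightarrow> local_extension SO3 f Q U g \<Longrightarrow>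
      frechet_derivative g (at Q) (Q ** hat (alpha Q)) = 0"
  shows "function_of_alpha f"
proof -
  have "f P = f Q" if PQ: "P \<in> SO3" "Q \<in> SO3" "alpha P = alpha Q" for P Q
  proof -
    let ?c = "\<lambda>t. axis_rotation t ** Q"
    have "((\<lambda>t. f (?c t)) has_vector_derivative 0) (at t)" for t
    proof -
      have ct: "?c s \<in> SO3" for s by (rule SO3_mult[OF axis_rotation_in_SO3 PQ(2)])
      obtain U g where ext: "local_extension SO3 f (?c t) U g"
        using f ct unfolding smooth_function_def by blast
      have "((\<lambda>t. f (?c t)) has_vector_derivative frechet_derivative g (at (?c t)) (?c t ** hat (alpha (?c t)))) (at t)"
        by (rule local_extension_curve_derivative[OF ext axis_rotation_orbit_velocity[OF PQ(2)]])
           (simp add: ct)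
      then show ?thesis using zero[OF ct ext] by simp
    qed
    then obtain k where k: "\<And>t. f (?c t) = k"
      using has_vector_derivative_zero_constant[of UNIV "\<lambda>t. f (?c t)"] by (metis UNIV_I convex_UNIV)
    obtain t where "P = ?c t" using alpha_fibre[OF PQ] by blast
    then show ?thesis using k[of t] k[of 0] by (simp add: axis_rotation_0)
  qed
  then have "\<forall>Q\<in>SO3. f Q = f (SOME P. P \<in> SO3 \<and> alpha P = alpha Q)"
    by (metis (mono_tags, lifting) someI_ex)
  then show ?thesis unfolding function_of_alpha_def using f
    by (intro conjI exI[of _ "\<lambda>x. f (SOME P. P \<in> SO3 \<and> alpha P = x)"])
qed

section \<open>Area integrals\<close>

lemma smooth_function_vec:
  fixes f :: "'a::euclidean_space \<Rightarrow> real^'n"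
  assumes "\<forall>i. smooth_function M (\<lambda>x. f x $ i)"
  shows "smooth_function M f"
  unfolding smooth_function_def
proof
  fix x assume "x \<in> M"
  then have "\<forall>i. \<exists>U g. local_extension M (\<lambda>x. f x $ i) x U g"
    using assms unfolding smooth_function_def by blast
  then obtain U g where ext: "\<And>i. local_extension M (\<lambda>x. f x $ i) x (U i) (g i)" by metis
  have W: "open (\<Inter>i. U i)" "x \<in> (\<Inter>i. U i)"
    using ext by (auto simp: local_extension_def)
  have "smooth_on (\<Inter>i. U i) (\<lambda>y. \<chi> i. g i y)"
    using ext by (intro smooth_on_vec W) (auto simp: local_extension_def intro: smooth_on_subset)
  then have "local_extension M f x (\<Inter>i. U i) (\<lambda>y. \<chi> i. g i y)"
    using W ext by (auto simp: local_extension_def vec_eq_iff)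
  then show "\<exists>U g. local_extension M f x U g" by blast
qed

lemma bounded_bilinear_cross: "bounded_bilinear (\<times>)"
  using bilinear_cross by (simp add: bilinear_conv_bounded_bilinear)

text \<open>
  For a function \<open>g\<close> on \<open>SO3\<close> this is the gradient in the body frame, the vector that enters Euler's
  equations, with a minus sign, as the moment of the potential.
\<close>

definition body_gradient :: "(real^3^3 \<Rightarrow> real) \<Rightarrow> real^3^3 \<Rightarrow> real^3" where
  "body_gradient g Q = (\<chi> i. frechet_derivative g (at Q) (Q ** hat (axis i 1)))"

lemma body_gradient_inner:
  assumes "smooth_on U g" "Q \<in> U"
  shows "body_gradient g Q \<bullet> b = frechet_derivative g (at Q) (Q ** hat b)"
proof -
  have lin: "linear (\<lambda>b. frechet_derivative g (at Q) (Q ** hat b))"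
    using linear_compose[OF linear_compose[OF linear_hat
        bounded_linear.linear[OF bounded_bilinear.bounded_linear_right[OF bounded_bilinear_matrix_mult]]]
        has_derivative_linear[OF smooth_on_has_derivative[OF assms]]]
    by (simp add: o_def)
  show ?thesis
    using linear_axis_expansion[OF lin, of b]
    by (simp add: body_gradient_def inner_vec_def mult.commute)
qed

lemma smooth_on_body_gradient:
  assumes "open U" "smooth_on U g"
  shows "smooth_on U (body_gradient g)"
proof (rule smooth_on_vec[OF assms(1)])
  fix i
  have "frechet_derivative g (at Q) X
      = (\<Sum>b\<in>Basis. (X \<bullet> b) *\<^sub>R frechet_derivative g (at Q) b)" if "Q \<in> U" for X Q
    by (rule linear_basis_expansion[OF has_derivative_linear[OF
          smooth_on_has_derivative[OF assms(2) that]]])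
  then have eq: "(\<Sum>b\<in>Basis. ((Q ** hat (axis i 1)) \<bullet> b) *\<^sub>R frechet_derivative g (at Q) b)
      = body_gradient g Q $ i" if "Q \<in> U" for Q
    using that by (simp add: body_gradient_def)
  have inner: "smooth_on U (\<lambda>Q. (Q ** hat (axis i 1)) \<bullet> b)" for b
    by (rule smooth_on_inner[OF assms(1)
          smooth_on_bounded_linear[OF assms(1) bounded_linear_matrix_mult_left] smooth_on_const])
  show "smooth_on U (\<lambda>Q. body_gradient g Q $ i)"
    by (rule smooth_on_cong[OF assms(1) eq], assumption, rule smooth_on_sum[OF assms(1)],
        rule smooth_on_scaleR[OF assms(1) inner smooth_on_frechet_derivative[OF assms(2)]])
qed

lemma inertia_tensor_inverse:
  assumes A: "inertia_tensor A"
  obtains B where "bounded_linear B" "\<And>x. A (B x) = x"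
proof -
  have "linear A" "inj A"
    using A inertia_tensorD(3)[OF A] by (auto simp: inertia_tensor_def inj_on_def)
  then obtain B where "linear B" "\<forall>x. A (B x) = x"
    using linear_injective_isomorphism by blast
  then show ?thesis using that by (simp add: linear_conv_bounded_linear)
qed

text \<open>
  The equations of motion for \<open>(Q, w)\<close> extend to a smooth field near the given point of the ambient
  space.  Its solutions stay in \<open>SO3\<close>: for skew \<open>hat w\<close> the matrix \<open>Q Q\<^sup>T\<close> is constant along them.
\<close>

lemma trajectory_through_every_point:
  assumes A: "inertia_tensor A" and V: "smooth_function SO3 V" and \<kappa>: "smooth_function SO3 \<kappa>"
    and Q: "Q \<in> SO3"
  shows "\<exists>h>0. \<exists>c. trajectory (rigid_body A V \<kappa>) {-h<..<h} c \<and> c 0 = (Q, Q ** hat w)"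
proof -
  obtain U1 V' where V': "local_extension SO3 V Q U1 V'"
    using V Q unfolding smooth_function_def by blast
  obtain U2 \<kappa>' where \<kappa>': "local_extension SO3 \<kappa> Q U2 \<kappa>'"
    using \<kappa> Q unfolding smooth_function_def by blast
  obtain B where B: "bounded_linear B" "\<And>x. A (B x) = x"
    using inertia_tensor_inverse[OF A] by blast
  define U where "U = U1 \<inter> U2"
  have U: "open U" "Q \<in> U" "smooth_on U V'" "smooth_on U \<kappa>'" "\<And>P. P \<in> U \<inter> SO3 \<Longrightarrow> \<kappa>' P = \<kappa> P"
    "\<And>P. P \<in> U \<Longrightarrow> local_extension SO3 V P U V'"
    using V' \<kappa>' by (auto simp: local_extension_def U_def intro: smooth_on_subset)
  let ?W = "fst -` U :: ((real^3^3) * (real^3)) set"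
  have W: "open ?W" by (rule open_vimage_fst[OF U(1)])
  define acc where "acc y = B ((A (snd y) + \<kappa>' (fst y)) \<times> snd y - body_gradient V' (fst y))" for y
  define fld where "fld y = (fst y ** hat (snd y), acc y)" for y
  have sf: "smooth_on ?W fst" "smooth_on ?W snd"
    by (rule smooth_on_bounded_linear[OF W bounded_linear_fst],
        rule smooth_on_bounded_linear[OF W bounded_linear_snd])
  have "smooth_on ?W acc"
    unfolding acc_def
    by (intro smooth_on_bounded_linear_comp[OF W B(1)] smooth_on_diff[OF W]
        smooth_on_bilinear[OF W bounded_bilinear_cross] sf smooth_on_add[OF W]
        smooth_on_bounded_linear_comp[OF W inertia_tensorD(1)[OF A]]
        smooth_on_compose[OF W sf(1) U(4)]
        smooth_on_compose[OF W sf(1) smooth_on_body_gradient[OF U(1,3)]]) auto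
  then have "smooth_on ?W fld"
    unfolding fld_def
    by (intro smooth_on_Pair[OF W] smooth_on_bilinear[OF W bounded_bilinear_matrix_mult] sf
        smooth_on_bounded_linear_comp[OF W bounded_linear_hat]) 
  then obtain h y where h: "h > 0" and y0: "y 0 = (Q, w)"
    and y: "\<And>t. t \<in> {-h<..<h} \<Longrightarrow> y t \<in> ?W"
      "\<And>t. t \<in> {-h<..<h} \<Longrightarrow> (y has_vector_derivative fld (y t)) (at t)"
    using smooth_ode_local_solution[OF W, of "(Q, w)" fld] U(2) by auto
  define q where "q t = fst (y t)" for t
  define u where "u t = snd (y t)" for t
  have q: "(q has_vector_derivative q t ** hat (u t)) (at t)" if "t \<in> {-h<..<h}" for t
    using bounded_linear.has_vector_derivative[OF bounded_linear_fst y(2)[OF that]]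
    by (simp add: q_def[abs_def] u_def fld_def)
  have u: "(u has_vector_derivative acc (y t)) (at t)" if "t \<in> {-h<..<h}" for t
    using bounded_linear.has_vector_derivative[OF bounded_linear_snd y(2)[OF that]]
    by (simp add: u_def[abs_def] fld_def)
  have "((\<lambda>t. q t ** transpose (q t)) has_vector_derivative 0) (at t)" if "t \<in> {-h<..<h}" for t
  proof -
    have "((\<lambda>t. q t ** transpose (q t)) has_vector_derivative
        q t ** transpose (q t ** hat (u t)) + (q t ** hat (u t)) ** transpose (q t)) (at t)"
      by (rule bounded_bilinear.has_vector_derivative[OF bounded_bilinear_matrix_mult q[OF that]
          bounded_linear.has_vector_derivative[OF bounded_linear_transpose q[OF that]]])
    then show ?thesis
      by (simp add: matrix_transpose_mul transpose_hat matrix_minus_mult matrix_mult_minus matrix_mul_assoc)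
  qed
  note qq = this
  have "((\<lambda>t. q t ** transpose (q t)) has_vector_derivative 0) (at t within {-h<..<h})"
    if "t \<in> {-h<..<h}" for t
    using qq[OF that] by (rule has_vector_derivative_at_within)
  then obtain k where k: "\<And>t. t \<in> {-h<..<h} \<Longrightarrow> q t ** transpose (q t) = k"
    using has_vector_derivative_zero_constant[OF convex_real_interval(8)] by blast
  have q0: "q 0 = Q" "u 0 = w" by (simp_all add: q_def u_def y0)
  have k1: "k = mat 1" using k[of 0] h SO3_D(2)[OF Q] by (simp add: q0)
  have qSO: "q t \<in> SO3" if "t \<in> {-h<..<h}" for t
  proof (rule path_in_SO3[of "{-h<..<h}" q 0 t])
    show "continuous_on {-h<..<h} q"
      by (rule continuous_at_imp_continuous_on) (use q has_vector_derivative_continuous in blast)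
  qed (use h k k1 q0 Q that in auto)
  let ?c = "\<lambda>t. (q t, q t ** hat (u t))"
  have "(?c has_vector_derivative dynamics (rigid_body A V \<kappa>) (?c t)) (at t)"
    if t: "t \<in> {-h<..<h}" for t
  proof -
    have P: "q t \<in> U" using y(1)[OF t] by (simp add: q_def)
    have "dynamics (rigid_body A V \<kappa>) (q t, q t ** hat (u t))
        = bundle_velocity (q t) (u t) (u t) (acc (y t))"
    proof (rule dynamics_rigid_body[OF A qSO[OF t] U(6)[OF P]])
      fix b
      have "A (acc (y t)) = (A (u t) + \<kappa> (q t)) \<times> u t - body_gradient V' (q t)"
        using U(5)[of "q t"] P qSO[OF t] by (simp add: acc_def B(2) q_def u_def)
      then show "A (acc (y t)) \<bullet> b = (A (u t) + \<kappa> (q t)) \<bullet> (u t \<times> b) - frechet_derivative V' (at (q t)) (q t ** hat b)"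
        by (simp add: inner_diff_left body_gradient_inner[OF U(3) P])
           (simp add: cross3_def inner_vec_def sum_3 algebra_simps)
    qed
    then show ?thesis
      using bundle_curve_has_vector_derivative[OF q[OF t] u[OF t]] by simp
  qed
  moreover have "?c t \<in> tangent_bundle SO3" if "t \<in> {-h<..<h}" for t
    using qSO[OF that] by (auto simp: tangent_bundle_SO3)
  ultimately have "trajectory (rigid_body A V \<kappa>) {-h<..<h} ?c"
    by (auto simp: trajectory_def rigid_body_def is_interval_oo)
  then show ?thesis using h q0 by (intro exI[of _ h] conjI exI[of _ ?c]) auto
qed

text \<open>
  The contribution \<open>A w \<bullet> (w \<times> \<alpha>)\<close> of the equation of motion cancels the one of \<open>\<alpha>' = \<alpha> \<times> w\<close>, and
  the moment of the potential disappears by \<open>function_of_alpha_derivative\<close>.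
\<close>

lemma area_integral_derivative:
  assumes A: "inertia_tensor A" and V: "function_of_alpha V"
    and tr: "trajectory (rigid_body A V \<kappa>) I c" and t: "t \<in> I"
    and ct: "c t = (Q, Q ** hat w)" and Q: "Q \<in> SO3"
    and g: "local_extension SO3 g Q U g'"
  shows "((\<lambda>s. metric (rigid_body A V \<kappa>) (fst (c s)) (rotation_field (fst (c s))) (snd (c s)) + g (fst (c s)))
     has_vector_derivative \<kappa> Q \<bullet> (w \<times> alpha Q) + frechet_derivative g' (at Q) (Q ** hat w)) (at t)"
proof -
  let ?G = "\<lambda>y. metric (rigid_body A V \<kappa>) (fst y) (rotation_field (fst y)) (snd y) + g (fst y)"
  define H where "H y = A (alpha (fst y)) \<bullet> body_velocity (fst y) (snd y) + g' (fst y)"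
    for y :: "(real^3^3) * (real^3^3)"
  let ?W = "fst -` U :: ((real^3^3) * (real^3^3)) set"
  have g': "open U" "Q \<in> U" "smooth_on U g'" "\<And>P. P \<in> U \<inter> SO3 \<Longrightarrow> g' P = g P"
    using g by (auto simp: local_extension_def)
  have W: "open ?W" by (rule open_vimage_fst[OF g'(1)])
  have sf: "smooth_on ?W fst" "smooth_on ?W snd"
    by (rule smooth_on_bounded_linear[OF W bounded_linear_fst],
        rule smooth_on_bounded_linear[OF W bounded_linear_snd])
  have Aal: "bounded_linear (\<lambda>y. A (alpha (fst y)))"
    by (rule bounded_linear_compose[OF inertia_tensorD(1)[OF A]
          bounded_linear_compose[OF bounded_linear_alpha bounded_linear_fst]])
  have "smooth_on ?W H"
    unfolding H_def
    by (rule smooth_on_add[OF W smooth_on_inner[OF W smooth_on_bounded_linear[OF W Aal]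
          smooth_on_bilinear[OF W bounded_bilinear_body_velocity sf]]
        smooth_on_compose[OF W sf(1) g'(3)]]) auto
  moreover have "H y = ?G y" if y: "y \<in> ?W \<inter> tangent_bundle SO3" for y
  proof -
    obtain P v where "P \<in> SO3" "y = (P, P ** hat v)"
      using y tangent_bundle_SO3[of y] by blast
    moreover from this have "P \<in> U" using y by simp
    ultimately show ?thesis
      by (simp add: H_def rigid_body_def body_metric_def rotation_field_def angular_velocity_SO3
          body_velocity_SO3 g'(4))
  qed
  ultimately have ext: "local_extension (tangent_bundle SO3) ?G (c t) ?W H"
    using W g'(2) by (simp add: local_extension_def ct)
  obtain U2 V' where V': "local_extension SO3 V Q U2 V'"
    using V Q unfolding function_of_alpha_def smooth_function_def by blast
  have V's: "smooth_on U2 V'" "Q \<in> U2" using V' by (auto simp: local_extension_def)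
  obtain B where B: "bounded_linear B" "\<And>x. A (B x) = x"
    using inertia_tensor_inverse[OF A] by blast
  define \<nu> where "\<nu> = B ((A w + \<kappa> Q) \<times> w - body_gradient V' Q)"
  have \<nu>: "A \<nu> \<bullet> b = (A w + \<kappa> Q) \<bullet> (w \<times> b) - frechet_derivative V' (at Q) (Q ** hat b)" for b
    unfolding \<nu>_def B(2)
    by (simp add: inner_diff_left body_gradient_inner[OF V's])
       (simp add: cross3_def inner_vec_def sum_3 algebra_simps)
  have "(c has_vector_derivative dynamics (rigid_body A V \<kappa>) (c t)) (at t)"
    using tr t by (simp add: trajectory_def)
  then have c: "(c has_vector_derivative bundle_velocity Q w w \<nu>) (at t)"
    using dynamics_rigid_body[where \<kappa> = \<kappa> and w = w and \<nu> = \<nu>, OF A Q V'] \<nu> by (simp add: ct)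
  have "open I" "\<And>s. s \<in> I \<Longrightarrow> c s \<in> tangent_bundle SO3"
    using tr by (auto simp: trajectory_def rigid_body_def)
  then have ev: "\<forall>\<^sub>F s in nhds t. c s \<in> tangent_bundle SO3"
    using t eventually_nhds_in_open[of I t] by (auto elim: eventually_mono)
  let ?x = "(Q, Q ** hat w)" and ?X = "bundle_velocity Q w w \<nu>"
  have "((\<lambda>y. g' (fst y)) has_derivative (\<lambda>h. frechet_derivative g' (at Q) (fst h))) (at ?x)"
    by (rule has_derivative_compose[where f = fst])
       (auto intro!: bounded_linear_imp_has_derivative bounded_linear_fst
         smooth_on_has_derivative g')
  from frechet_derivative_at[OF has_derivative_add[OF bounded_bilinear.FDERIV[OF bounded_bilinear_inner
        bounded_linear_imp_has_derivative[OF Aal] body_velocity_has_derivative] this], symmetric]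
  have "frechet_derivative H (at ?x) ?X
      = A (alpha Q) \<bullet> \<nu> + A (alpha Q \<times> w) \<bullet> w + frechet_derivative g' (at Q) (Q ** hat w)"
    unfolding H_def
    by (simp add: body_velocity_derivative_tangent[OF Q] body_velocity_SO3[OF Q])
       (simp add: bundle_velocity_def alpha_mult_hat)
  moreover have "A (alpha Q) \<bullet> \<nu> = (A w + \<kappa> Q) \<bullet> (w \<times> alpha Q)"
    using \<nu>[of "alpha Q"] function_of_alpha_derivative[OF V Q V'] inertia_tensorD(2)[OF A, of \<nu> "alpha Q"]
    by (simp add: inner_commute)
  moreover have "A (alpha Q \<times> w) \<bullet> w = - (A w \<bullet> (w \<times> alpha Q))"
    using inertia_tensorD(2)[OF A, of "alpha Q \<times> w" w] cross_skew[of "alpha Q" w]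
    by (simp add: inner_commute)
  ultimately have "frechet_derivative H (at ?x) ?X
      = \<kappa> Q \<bullet> (w \<times> alpha Q) + frechet_derivative g' (at Q) (Q ** hat w)"
    by (simp add: inner_add_left)
  then show ?thesis
    using local_extension_curve_derivative[OF ext c ev] by (simp add: ct)
qed

lemma has_area_integral_iff:
  assumes A: "inertia_tensor A" and V: "function_of_alpha V" and \<kappa>: "smooth_function SO3 \<kappa>"
  shows "has_area_integral (rigid_body A V \<kappa>) \<longleftrightarrow>
    (\<exists>g. smooth_function SO3 g \<and> (\<forall>Q\<in>SO3. \<forall>U g'. local_extension SO3 g Q U g' \<longrightarrow>
       (\<forall>w. frechet_derivative g' (at Q) (Q ** hat w) = \<kappa> Q \<bullet> (alpha Q \<times> w))))"
    (is "?lhs \<longleftrightarrow> (\<exists>g. ?P g)")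
proof
  let ?S = "rigid_body A V \<kappa>"
  let ?G = "\<lambda>g y. metric ?S (fst y) (rotation_field (fst y)) (snd y) + g (fst y)"
  have skew: "\<kappa> Q \<bullet> (alpha Q \<times> w) = - (\<kappa> Q \<bullet> (w \<times> alpha Q))" for Q w
    using cross_skew[of "alpha Q" w] by simp
  {
    assume ?lhs
    then obtain g where g: "smooth_function SO3 g" and fi: "first_integral ?S (?G g)"
      unfolding has_area_integral_def by blast
    have "frechet_derivative g' (at Q) (Q ** hat w) = \<kappa> Q \<bullet> (alpha Q \<times> w)"
      if Q: "Q \<in> SO3" and ext: "local_extension SO3 g Q U g'" for Q U g' w
    proof -
      have "smooth_function SO3 V" using V by (simp add: function_of_alpha_def)
      from trajectory_through_every_point[OF A this \<kappa> Q, of w] obtain h c where h: "h > 0"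
        and c: "trajectory ?S {-h<..<h} c" "c 0 = (Q, Q ** hat w)" by blast
      have d: "((\<lambda>s. ?G g (c s)) has_vector_derivative
          \<kappa> Q \<bullet> (w \<times> alpha Q) + frechet_derivative g' (at Q) (Q ** hat w)) (at 0)"
        by (rule area_integral_derivative[OF A V c(1) _ c(2) Q ext]) (use h in simp)
      have "\<forall>\<^sub>F s in nhds (0::real). s \<in> {-h<..<h}" using h by (intro eventually_nhds_in_open) auto
      then have "\<forall>\<^sub>F s in nhds 0. ?G g (c s) = ?G g (c 0)"
      proof eventually_elim
        case (elim s)
        show ?case
          by (rule fi[unfolded first_integral_def, rule_format, OF c(1) elim]) (use h in simp)
      qed
      from has_vector_derivative_eventually_eq[OF d this]
      have "\<kappa> Q \<bullet> (w \<times> alpha Q) + frechet_derivative g' (at Q) (Q ** hat w) = 0"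
        using vector_derivative_unique_at has_vector_derivative_const by metis
      then show ?thesis by (simp add: skew)
    qed
    with g show "\<exists>g. ?P g" by blast
  }
  assume "\<exists>g. ?P g"
  then obtain g where g: "smooth_function SO3 g"
    and eq: "\<And>Q U g' w. Q \<in> SO3 \<Longrightarrow> local_extension SO3 g Q U g' \<Longrightarrow>
       frechet_derivative g' (at Q) (Q ** hat w) = \<kappa> Q \<bullet> (alpha Q \<times> w)" by blast
  have "first_integral ?S (?G g)"
    unfolding first_integral_def
  proof (intro allI impI ballI)
    fix I c s t assume c: "trajectory ?S I c" and st: "s \<in> I" "t \<in> I"
    have "((\<lambda>s. ?G g (c s)) has_vector_derivative 0) (at r within I)" if r: "r \<in> I" for r
    proof -
      have "c r \<in> tangent_bundle SO3" using c r by (simp add: trajectory_def rigid_body_def)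
      then obtain Q w where Q: "Q \<in> SO3" "c r = (Q, Q ** hat w)" using tangent_bundle_SO3[of "c r"] by blast
      obtain U g' where ext: "local_extension SO3 g Q U g'"
        using g Q(1) unfolding smooth_function_def by blast
      from area_integral_derivative[OF A V c r Q(2,1) ext] show ?thesis
        by (simp add: eq[OF Q(1) ext] skew has_vector_derivative_at_within)
    qed
    moreover have "convex I" using c by (simp add: trajectory_def is_interval_convex)
    ultimately obtain k where "\<And>r. r \<in> I \<Longrightarrow> ?G g (c r) = k"
      using has_vector_derivative_zero_constant[of I "\<lambda>s. ?G g (c s)"] by blast
    then show "?G g (c s) = ?G g (c t)" using st by simp
  qed
  with g show ?lhs unfolding has_area_integral_def by blast
qed

section \<open>The representation of the gyroscopic form\<close>

lemma local_extension_derivative_unique: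
  fixes f :: "'a::euclidean_space \<Rightarrow> real"
  assumes "local_extension M f x U g" "local_extension M f x U' g'" "v \<in> tangent_space M x"
  shows "frechet_derivative g (at x) v = frechet_derivative g' (at x) v"
  using differential_eq[OF assms(3,1)] differential_eq[OF assms(3,2)] by simp

lemma gyro_form_extension:
  assumes k: "local_extension SO3 \<kappa> Q U k"
  shows "local_two_form_extension SO3 (gyro_form \<kappa>) Q U
    (\<lambda>y u v. k y \<bullet> (body_velocity u v - body_velocity v u))"
proof -
  have U: "open U" "Q \<in> U" "smooth_on U k" "\<And>P. P \<in> U \<inter> SO3 \<Longrightarrow> k P = \<kappa> P"
    using k by (auto simp: local_extension_def)
  have "bilinear (\<lambda>u v. k y \<bullet> (body_velocity u v - body_velocity v u))" for y
    unfolding bilinear_def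
    by (auto intro!: linearI simp: body_velocity.add_left body_velocity.add_right
        body_velocity.scaleR_left body_velocity.scaleR_right algebra_simps inner_simps)
  moreover have "smooth_on U (\<lambda>y. k y \<bullet> z)" for z
    by (rule smooth_on_inner[OF U(1,3) smooth_on_const])
  moreover have "k P \<bullet> (body_velocity (P ** hat a) (P ** hat b) - body_velocity (P ** hat b) (P ** hat a))
      = gyro_form \<kappa> P (P ** hat a) (P ** hat b)" if "P \<in> U \<inter> SO3" for P a b
    using that U(4)[OF that] vee_hat_mult[of a b]
    by (simp add: body_velocity_tangent gyro_form_SO3)
       (metis inner_minus_right minus_diff_eq)
  ultimately show ?thesis
    using U(1,2) by (auto simp: local_two_form_extension_def tangent_space_SO3)
qed

text \<open>
  The forms \<open>d\<Lambda>\<^sub>i\<close> are constant in the ambient space, so only the derivatives of \<open>\<kappa>\<close> occur, and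
  \<open>d\<kappa>\<^sub>i \<and> d\<Lambda>\<^sub>i\<close> picks out the derivative of \<open>\<kappa>\<^sub>i\<close> in the direction \<open>Q ** hat e\<^sub>i\<close>.
\<close>

lemma closed_gyro_form_divergence:
  assumes closed: "closed_two_form SO3 (gyro_form \<kappa>)" and Q: "Q \<in> SO3"
    and k: "local_extension SO3 \<kappa> Q U k"
  shows "(\<Sum>i\<in>UNIV. frechet_derivative k (at Q) (Q ** hat (axis i 1)) $ i) = 0"
proof -
  let ?\<beta> = "\<lambda>y u v. k y \<bullet> (body_velocity u v - body_velocity v u)"
  let ?L = "\<lambda>i y. y ** hat (axis i 1)"
  let ?dk = "\<lambda>i. frechet_derivative k (at Q) (?L i Q)"
  have dk: "(k has_derivative frechet_derivative k (at Q)) (at Q)"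
    using k by (auto simp: local_extension_def intro: smooth_on_has_derivative)
  have d: "frechet_derivative (\<lambda>y. ?\<beta> y (Q ** hat b) (Q ** hat c)) (at Q) h
      = - (frechet_derivative k (at Q) h \<bullet> (b \<times> c))" for b c h
  proof -
    have "((\<lambda>y. k y \<bullet> z) has_derivative (\<lambda>h. frechet_derivative k (at Q) h \<bullet> z)) (at Q)" for z
      by (rule bounded_linear.has_derivative[OF bounded_linear_inner_left dk])
    from frechet_derivative_at[OF this, symmetric] show ?thesis
      using vee_hat_mult[of b c] by (simp add: body_velocity_tangent[OF Q])
        (metis inner_minus_right minus_diff_eq)
  qed
  have "ext_deriv2 SO3 (gyro_form \<kappa>) Q (?L 1 Q) (?L 2 Q) (?L 3 Q)
     = frechet_derivative (\<lambda>y. ?\<beta> y (?L 2 Q) (?L 3 Q)) (at Q) (?L 1 Q)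
     - frechet_derivative (\<lambda>y. ?\<beta> y (?L 1 Q) (?L 3 Q)) (at Q) (?L 2 Q)
     + frechet_derivative (\<lambda>y. ?\<beta> y (?L 1 Q) (?L 2 Q)) (at Q) (?L 3 Q)"
    by (rule ext_deriv2_eq[OF gyro_form_extension[OF k] Q bounded_linear_matrix_mult_left
          bounded_linear_matrix_mult_left bounded_linear_matrix_mult_left])
       (simp_all add: tangent_space_SO3 Q SO3_field_commutator)
  also have "\<dots> = - (?dk 1 \<bullet> (axis 2 1 \<times> axis 3 1)) + ?dk 2 \<bullet> (axis 1 1 \<times> axis 3 1)
      - ?dk 3 \<bullet> (axis 1 1 \<times> axis 2 1)"
    unfolding d by simp
  also have "\<dots> = - (?dk 1 $ 1 + ?dk 2 $ 2 + ?dk 3 $ 3)"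
    by (simp add: cross_basis inner_axis)
  finally show ?thesis
    using closed Q by (simp add: closed_two_form_def tangent_space_SO3 sum_3)
qed

lemma gradient_inner:
  assumes "smooth_on U f" "x \<in> U"
  shows "gradient f x \<bullet> v = frechet_derivative f (at x) v"
proof -
  have lin: "linear (frechet_derivative f (at x))"
    using smooth_on_has_derivative[OF assms] by (rule has_derivative_linear)
  show ?thesis
    using linear_axis_expansion[OF lin, of v] by (simp add: gradient_def inner_vec_def mult.commute)
qed

lemma smooth_on_gradient:
  assumes "open U" "smooth_on U f"
  shows "smooth_on U (gradient f)"
  by (rule smooth_on_vec[OF assms(1)]) (simp add: gradient_def smooth_on_frechet_derivative[OF assms(2)])

lemma smooth_on_alpha: "open W \<Longrightarrow> smooth_on W alpha"
  by (rule smooth_on_bounded_linear[OF _ bounded_linear_alpha])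

lemma open_alpha_vimage: "open U \<Longrightarrow> open (alpha -` U)"
  by (intro open_vimage linear_continuous_on bounded_linear_alpha)

lemma local_extension_compose_alpha:
  fixes f :: "real^3 \<Rightarrow> real"
  assumes U: "open U" "sphere 0 1 \<subseteq> U" and f: "smooth_on U f" and Q: "Q \<in> SO3"
    and eq: "\<And>P. P \<in> SO3 \<Longrightarrow> g P = f (alpha P)"
  shows "local_extension SO3 g Q (alpha -` U) (\<lambda>P. f (alpha P))"
proof -
  have "smooth_on (alpha -` U) (\<lambda>P. f (alpha P))"
    by (rule smooth_on_compose[OF open_alpha_vimage[OF U(1)] smooth_on_alpha[OF open_alpha_vimage[OF U(1)]] f]) auto
  moreover have "alpha Q \<in> U" using norm_alpha[OF Q] U(2) by auto
  ultimately show ?thesis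
    using open_alpha_vimage[OF U(1)] by (simp add: local_extension_def eq)
qed

lemma compose_alpha_derivative:
  assumes f: "smooth_on U f" and Q: "alpha Q \<in> U"
  shows "frechet_derivative (\<lambda>P. f (alpha P)) (at Q) (Q ** hat w) = gradient f (alpha Q) \<bullet> (alpha Q \<times> w)"
proof -
  have "((\<lambda>P. f (alpha P)) has_derivative (\<lambda>h. frechet_derivative f (at (alpha Q)) (alpha h))) (at Q)"
    by (rule has_derivative_compose[where f = alpha,
          OF bounded_linear_imp_has_derivative[OF bounded_linear_alpha] smooth_on_has_derivative[OF f Q]])
  from frechet_derivative_at[OF this, symmetric] show ?thesis
    by (simp add: alpha_mult_hat gradient_inner[OF f Q])
qed

text \<open>
  The normalisation of \<open>x\<close>, written with a real power to which \<open>smooth_on_powr\<close> applies.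
\<close>

definition unit_vector :: "real^3 \<Rightarrow> real^3" where
  "unit_vector x = ((x \<bullet> x) powr (-1/2)) *\<^sub>R x"

lemma unit_vector_inner:
  assumes "x \<noteq> 0" shows "unit_vector x \<bullet> unit_vector x = 1"
proof -
  have "(x \<bullet> x) powr (-1/2) * (x \<bullet> x) powr (-1/2) = (x \<bullet> x) powr (-1)"
    by (simp flip: powr_add)
  also have "\<dots> * (x \<bullet> x) = 1" using assms by (simp add: powr_minus)
  finally show ?thesis by (simp add: unit_vector_def mult.assoc)
qed

lemma smooth_on_unit_vector:
  assumes "open W" "smooth_on W h" "\<And>x. x \<in> W \<Longrightarrow> h x \<noteq> 0"
  shows "smooth_on W (\<lambda>x. unit_vector (h x))"
  unfolding unit_vector_def
  using assms(3) by (intro smooth_on_scaleR[OF assms(1)] smooth_on_powr[OF assms(1)]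
      smooth_on_inner[OF assms(1)] assms(2)) simp

lemma orthonormal_frame_in_SO3:
  assumes "a \<bullet> a = 1" "b \<bullet> b = 1" "a \<bullet> b = 0"
  shows "(vector [a, b, a \<times> b] :: real^3^3) \<in> SO3"
proof (rule SO3_I)
  have c: "(a \<times> b) \<bullet> (a \<times> b) = 1"
    using norm_cross_dot[of a b] assms by (simp add: power2_norm_eq_inner norm_eq_sqrt_inner)
  have "(vector [a, b, a \<times> b] ** transpose (vector [a, b, a \<times> b]) :: real^3^3) $ i $ j
      = (vector [a, b, a \<times> b] :: real^3^3) $ i \<bullet> (vector [a, b, a \<times> b] :: real^3^3) $ j" for i j
    by (simp add: matrix_matrix_mult_def transpose_def inner_vec_def)
  then show "vector [a, b, a \<times> b] ** transpose (vector [a, b, a \<times> b]) = (mat 1 :: real^3^3)"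
    using assms c by (simp add: vec_eq_iff forall_3 mat_def dot_cross_self inner_commute)
  have "det (vector [a, b, a \<times> b] :: real^3^3) = (a \<times> b) \<bullet> (a \<times> b)"
    by (simp add: det_3 inner_vec_def sum_3 cross3_def algebra_simps)
  then show "det (vector [a, b, a \<times> b] :: real^3^3) = 1" using c by simp
qed

text \<open>
  Normalising \<open>x\<close> and \<open>x \<times> e\<close>, for a fixed vector \<open>e\<close> not parallel to \<open>x0\<close>, gives the first two
  rows of a rotation that depends smoothly on \<open>x\<close>.
\<close>

lemma local_section_of_alpha:
  assumes "x0 \<noteq> 0"
  obtains W s where "open W" "x0 \<in> W" "smooth_on W s"
    "\<And>x. x \<in> W \<Longrightarrow> s x \<in> SO3" "\<And>x. x \<in> W \<Longrightarrow> alpha (s x) = unit_vector x"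
proof -
  have "\<exists>e. x0 \<times> e \<noteq> 0"
  proof (rule ccontr)
    assume "\<not> ?thesis"
    then have "x0 \<times> axis 1 1 = 0" "x0 \<times> axis 2 1 = 0" by auto
    then have "x0 = 0" by (simp add: vec_eq_iff forall_3 cross3_def axis_def)
    with assms show False by simp
  qed
  then obtain e where e: "x0 \<times> e \<noteq> 0" by blast
  define W where "W = {x. x \<times> e \<noteq> 0}"
  have bl: "bounded_linear (\<lambda>x. x \<times> e)"
    by (rule bounded_bilinear.bounded_linear_left[OF bounded_bilinear_cross])
  have "open ((\<lambda>x. x \<times> e) -` (- {0}))"
    by (intro open_vimage linear_continuous_on bl) auto
  moreover have "(\<lambda>x. x \<times> e) -` (- {0}) = W" by (auto simp: W_def)
  ultimately have W: "open W" by simp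
  let ?a = unit_vector and ?b = "\<lambda>x. unit_vector (x \<times> e)"
  define s :: "real^3 \<Rightarrow> real^3^3" where "s x = vector [?a x, ?b x, ?a x \<times> ?b x]" for x
  have nz: "x \<noteq> 0" "x \<times> e \<noteq> 0" if "x \<in> W" for x using that by (auto simp: W_def)
  have a: "smooth_on W ?a"
    by (rule smooth_on_unit_vector[OF W smooth_on_bounded_linear[OF W bounded_linear_ident] nz(1)])
  have b: "smooth_on W ?b"
    by (rule smooth_on_unit_vector[OF W smooth_on_bounded_linear[OF W bl] nz(2)])
  have "smooth_on W s"
  proof (rule smooth_on_vec[OF W])
    fix i :: 3
    show "smooth_on W (\<lambda>x. s x $ i)"
      using exhaust_3[of i] a b smooth_on_bilinear[OF W bounded_bilinear_cross a b]
      by (auto simp: s_def)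
  qed
  moreover have "s x \<in> SO3" if "x \<in> W" for x
    unfolding s_def
  proof (rule orthonormal_frame_in_SO3)
    show "?a x \<bullet> ?b x = 0" by (simp add: unit_vector_def dot_cross_self)
  qed (use unit_vector_inner nz[OF that] in auto)
  moreover have "alpha (s x) = unit_vector x" for x
    by (simp add: s_def alpha_def row_def vec_eq_iff)
  moreover have "x0 \<in> W" using e by (simp add: W_def)
  ultimately show ?thesis using that W by blast
qed

text \<open>
  The extension is constant along rays, hence globally defined away from the origin; its smoothness is
  checked with local sections.
\<close>

lemma function_of_alpha_extension:
  assumes g: "function_of_alpha g"
  obtains f where "smooth_on (- {0}) f" "\<And>Q. Q \<in> SO3 \<Longrightarrow> g Q = f (alpha Q)"
proof -
  obtain \<phi> where \<phi>: "\<And>Q. Q \<in> SO3 \<Longrightarrow> g Q = \<phi> (alpha Q)"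
    using g by (auto simp: function_of_alpha_def)
  define f where "f x = \<phi> (unit_vector x)" for x
  have "smooth_on (- {0}) f"
  proof (rule smooth_on_local)
    fix x0 :: "real^3" assume "x0 \<in> - {0}"
    then have "x0 \<noteq> 0" by simp
    then obtain W s where W: "open W" "x0 \<in> W" and s: "smooth_on W s"
      "\<And>x. x \<in> W \<Longrightarrow> s x \<in> SO3" "\<And>x. x \<in> W \<Longrightarrow> alpha (s x) = unit_vector x"
      using local_section_of_alpha by metis
    obtain U g' where ext: "local_extension SO3 g (s x0) U g'"
      using g s(2)[OF W(2)] unfolding function_of_alpha_def smooth_function_def by blast
    then have U: "open U" "s x0 \<in> U" "smooth_on U g'" "\<And>P. P \<in> U \<inter> SO3 \<Longrightarrow> g' P = g P"
      by (auto simp: local_extension_def)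
    define W' where "W' = W \<inter> s -` U"
    have W': "open W'" unfolding W'_def
      by (rule continuous_open_preimage[OF smooth_on_continuous[OF s(1)] W(1) U(1)])
    have "smooth_on W' s" using s(1) by (rule smooth_on_subset) (simp add: W'_def)
    then have "smooth_on W' (\<lambda>x. g' (s x))"
      by (rule smooth_on_compose[OF W' _ U(3)]) (auto simp: W'_def)
    moreover have "g' (s x) = f x" if "x \<in> W'" for x
      using that s(2,3)[of x] by (simp add: W'_def U(4) \<phi> f_def)
    ultimately have "smooth_on W' f" by (rule smooth_on_cong[OF W', rotated])
    moreover have "x0 \<in> W'" using W(2) U(2) by (simp add: W'_def)
    ultimately show "\<exists>W. open W \<and> x0 \<in> W \<and> smooth_on W f" using W' by blast
  qed
  moreover have "g Q = f (alpha Q)" if "Q \<in> SO3" for Q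
    using \<phi>[OF that] norm_alpha[OF that] by (simp add: f_def unit_vector_def norm_eq_sqrt_inner)
  ultimately show ?thesis by (rule that)
qed

text \<open>
  This is the trace of the product of the Hessian with the skew matrix \<open>hat a\<close>.
\<close>

lemma second_derivative_cross_trace:
  fixes f :: "real^3 \<Rightarrow> real"
  assumes f: "smooth_on U f" and U: "open U" "a \<in> U"
  shows "(\<Sum>i\<in>UNIV. frechet_derivative (gradient f) (at a) (a \<times> axis i 1) $ i) = 0"
proof -
  define h where "h i = frechet_derivative (\<lambda>y. frechet_derivative f (at y) (axis i 1)) (at a)" for i :: 3
  have dG: "(gradient f has_derivative frechet_derivative (gradient f) (at a)) (at a)"
    by (rule smooth_on_has_derivative[OF smooth_on_gradient[OF U(1) f] U(2)])
  have comp: "frechet_derivative (gradient f) (at a) v $ i = h i v" for i v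
    using frechet_derivative_at[OF bounded_linear.has_derivative[OF bounded_linear_vec_nth[of i] dG]]
    by (simp add: h_def gradient_def fun_eq_iff)
  have lin: "linear (h i)" for i
    unfolding h_def
    by (rule has_derivative_linear[OF smooth_on_has_derivative[OF smooth_on_frechet_derivative[OF f] U(2)]])
  have sym: "h i (axis j 1) = h j (axis i 1)" for i j
    unfolding h_def by (rule smooth_on_second_derivative_symmetric[OF f U])
  have c: "a \<times> axis 1 1 = (a$3) *\<^sub>R axis 2 1 - (a$2) *\<^sub>R axis 3 1"
    "a \<times> axis 2 1 = (a$1) *\<^sub>R axis 3 1 - (a$3) *\<^sub>R axis 1 1"
    "a \<times> axis 3 1 = (a$2) *\<^sub>R axis 1 1 - (a$1) *\<^sub>R axis 2 1"
    by (simp_all add: vec_eq_iff forall_3 cross3_def axis_def)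
  show ?thesis
    unfolding comp sum_3 c linear_diff[OF lin] linear_scale[OF lin]
    using sym[of 1 2] sym[of 1 3] sym[of 2 3] by (simp add: algebra_simps)
qed

text \<open>
  In the divergence of \<open>F \<alpha> + grad f(\<alpha>)\<close> the derivative of \<open>\<alpha>\<^sub>i\<close> along \<open>Q ** hat e\<^sub>i\<close> is
  \<open>(\<alpha> \<times> e\<^sub>i)\<^sub>i = 0\<close>, and the gradient part is the trace above; what is left is the derivative of \<open>F\<close>
  along \<open>Q ** hat \<alpha>\<close>.
\<close>

lemma coefficient_invariant:
  fixes f :: "real^3 \<Rightarrow> real"
  assumes closed: "closed_two_form SO3 (gyro_form \<kappa>)" 
    and U: "open U" "sphere 0 1 \<subseteq> U" and f: "smooth_on U f"
    and rep: "\<And>Q. Q \<in> SO3 \<Longrightarrow> \<kappa> Q = F Q *\<^sub>R alpha Q + gradient f (alpha Q)"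
    and Q: "Q \<in> SO3" and F': "local_extension SO3 F Q U' F'"
  shows "frechet_derivative F' (at Q) (Q ** hat (alpha Q)) = 0"
proof -
  have F: "open U'" "Q \<in> U'" "smooth_on U' F'" "\<And>P. P \<in> U' \<inter> SO3 \<Longrightarrow> F' P = F P"
    using F' by (auto simp: local_extension_def)
  define W where "W = U' \<inter> alpha -` U"
  have W: "open W" unfolding W_def by (intro open_Int F open_alpha_vimage U)
  have aQ: "alpha Q \<in> U" using norm_alpha[OF Q] U(2) by auto
  let ?k = "\<lambda>P. F' P *\<^sub>R alpha P + gradient f (alpha P)"
  have "smooth_on W ?k"
  proof (rule smooth_on_add[OF W smooth_on_scaleR[OF W _ smooth_on_alpha[OF W]]])
    show "smooth_on W F'" using F(3) by (rule smooth_on_subset) (simp add: W_def)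
    show "smooth_on W (\<lambda>P. gradient f (alpha P))"
      by (rule smooth_on_compose[OF W smooth_on_alpha[OF W] smooth_on_gradient[OF U(1) f]])
         (auto simp: W_def)
  qed
  then have ext: "local_extension SO3 \<kappa> Q W ?k"
    using W F aQ by (simp add: local_extension_def W_def rep)
  let ?dF = "frechet_derivative F' (at Q)" and ?dG = "frechet_derivative (gradient f) (at (alpha Q))"
  have dF: "(F' has_derivative ?dF) (at Q)" by (rule smooth_on_has_derivative[OF F(3,2)])
  have da: "(alpha has_derivative alpha) (at Q)"
    by (rule bounded_linear_imp_has_derivative[OF bounded_linear_alpha])
  have "((\<lambda>P. gradient f (alpha P)) has_derivative (\<lambda>h. ?dG (alpha h))) (at Q)"
    by (rule has_derivative_compose[where f = alpha, OF da
          smooth_on_has_derivative[OF smooth_on_gradient[OF U(1) f] aQ]])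
  from frechet_derivative_at[OF has_derivative_add[OF has_derivative_scaleR[OF dF da] this], symmetric]
  have dk: "frechet_derivative ?k (at Q) (Q ** hat w)
      = F' Q *\<^sub>R (alpha Q \<times> w) + ?dF (Q ** hat w) *\<^sub>R alpha Q + ?dG (alpha Q \<times> w)" for w
    by (simp add: alpha_mult_hat)
  have diag: "(alpha Q \<times> axis i 1) $ i = 0" for i
    using exhaust_3[of i] by (auto simp: cross3_def axis_def)
  have "(\<Sum>i\<in>UNIV. ?dF (Q ** hat (axis i 1)) * alpha Q $ i) + (\<Sum>i\<in>UNIV. ?dG (alpha Q \<times> axis i 1) $ i) = 0"
    using closed_gyro_form_divergence[OF closed Q ext] unfolding dk
    by (simp add: diag sum.distrib)
  then have "(\<Sum>i\<in>UNIV. ?dF (Q ** hat (axis i 1)) * alpha Q $ i) = 0"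
    using second_derivative_cross_trace[OF f U(1) aQ] by simp
  then have "body_gradient F' Q \<bullet> alpha Q = 0"
    by (simp add: body_gradient_def inner_vec_def)
  then show ?thesis by (simp add: body_gradient_inner[OF F(3,2)])
qed

theorem theorem2:
  fixes A :: "real^3 \<Rightarrow> real^3"
    and V :: "real^3^3 \<Rightarrow> real"
    and \<kappa> :: "real^3^3 \<Rightarrow> real^3"
  assumes "inertia_tensor A"
    and "function_of_alpha V"
    and "\<forall>i. smooth_function SO3 (\<lambda>Q. \<kappa> Q $ i)"
    and "closed_two_form SO3 (gyro_form \<kappa>)"
  shows "has_area_integral (rigid_body A V \<kappa>) \<longleftrightarrow>
    (\<exists>F f U. function_of_alpha F \<and>
       open U \<and> sphere 0 1 \<subseteq> U \<and> smooth_on U f \<and>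
       (\<forall>Q\<in>SO3. \<kappa> Q = F Q *\<^sub>R alpha Q + gradient f (alpha Q)))"
proof -
  have \<kappa>: "smooth_function SO3 \<kappa>" using assms(3) by (rule smooth_function_vec)
  note iff = has_area_integral_iff[OF assms(1,2) \<kappa>]
  show ?thesis
  proof
    assume "has_area_integral (rigid_body A V \<kappa>)"
    then obtain g where g: "smooth_function SO3 g" and dg: "\<And>Q U g' w. Q \<in> SO3 \<Longrightarrow>
        local_extension SO3 g Q U g' \<Longrightarrow> frechet_derivative g' (at Q) (Q ** hat w) = \<kappa> Q \<bullet> (alpha Q \<times> w)"
      unfolding iff by blast
    have "function_of_alpha g" by (rule function_of_alphaI[OF g]) (simp add: dg)
    then obtain f where f: "smooth_on (- {0}) f" and gf: "\<And>Q. Q \<in> SO3 \<Longrightarrow> g Q = f (alpha Q)"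
      using function_of_alpha_extension by metis
    have U: "open (- {0 :: real^3})" "sphere 0 1 \<subseteq> - {0 :: real^3}" by auto
    have aU: "alpha Q \<in> - {0}" if "Q \<in> SO3" for Q using norm_alpha[OF that] by auto
    define F where "F Q = (\<kappa> Q - gradient f (alpha Q)) \<bullet> alpha Q" for Q
    have rep: "\<kappa> Q = F Q *\<^sub>R alpha Q + gradient f (alpha Q)" if Q: "Q \<in> SO3" for Q
    proof -
      define r where "r = \<kappa> Q - gradient f (alpha Q)"
      have "r \<bullet> (alpha Q \<times> w) = 0" for w
        using dg[OF Q local_extension_compose_alpha[OF U f Q gf], of w]
          compose_alpha_derivative[OF f aU[OF Q], of w]
        by (simp add: r_def inner_diff_left)
      moreover have "(r \<times> alpha Q) \<bullet> w = r \<bullet> (alpha Q \<times> w)" for w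
        by (simp add: cross3_def inner_vec_def sum_3 algebra_simps)
      ultimately have "r \<times> alpha Q = 0" by (metis inner_eq_zero_iff)
      moreover have "alpha Q \<times> (r \<times> alpha Q) = (alpha Q \<bullet> alpha Q) *\<^sub>R r - (r \<bullet> alpha Q) *\<^sub>R alpha Q"
        by (simp add: vec_eq_iff forall_3 cross3_def inner_vec_def sum_3 algebra_simps)
      moreover have "alpha Q \<bullet> alpha Q = 1"
        using norm_alpha[OF Q] by (simp add: norm_eq_sqrt_inner)
      ultimately have "r = (r \<bullet> alpha Q) *\<^sub>R alpha Q" by simp
      then show ?thesis by (simp add: r_def F_def algebra_simps)
    qed
    have "smooth_function SO3 F"
      unfolding smooth_function_def
    proof
      fix Q assume Q: "Q \<in> SO3"
      then obtain U1 k where "local_extension SO3 \<kappa> Q U1 k"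
        using \<kappa> unfolding smooth_function_def by blast
      then have k: "open U1" "Q \<in> U1" "smooth_on U1 k" "\<And>P. P \<in> U1 \<inter> SO3 \<Longrightarrow> k P = \<kappa> P"
        by (auto simp: local_extension_def)
      define W where "W = U1 \<inter> alpha -` (- {0})"
      have W: "open W" unfolding W_def by (intro open_Int k open_alpha_vimage U)
      have "smooth_on W (\<lambda>P. (k P - gradient f (alpha P)) \<bullet> alpha P)"
      proof (rule smooth_on_inner[OF W smooth_on_diff[OF W] smooth_on_alpha[OF W]])
        show "smooth_on W k" using k(3) by (rule smooth_on_subset) (simp add: W_def)
        show "smooth_on W (\<lambda>P. gradient f (alpha P))"
          by (rule smooth_on_compose[OF W smooth_on_alpha[OF W] smooth_on_gradient[OF U(1) f]])
             (auto simp: W_def)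
      qed
      then have "local_extension SO3 F Q W (\<lambda>P. (k P - gradient f (alpha P)) \<bullet> alpha P)"
        using W k aU[OF Q] by (simp add: local_extension_def W_def F_def)
      then show "\<exists>U g. local_extension SO3 F Q U g" by blast
    qed
    then have "function_of_alpha F"
      by (rule function_of_alphaI) (rule coefficient_invariant[OF assms(4) U f rep])
    then show "\<exists>F f U. function_of_alpha F \<and> open U \<and> sphere 0 1 \<subseteq> U \<and> smooth_on U f \<and>
       (\<forall>Q\<in>SO3. \<kappa> Q = F Q *\<^sub>R alpha Q + gradient f (alpha Q))"
      using U f rep by blast
  next
    assume "\<exists>F f U. function_of_alpha F \<and> open U \<and> sphere 0 1 \<subseteq> U \<and> smooth_on U f \<and>
       (\<forall>Q\<in>SO3. \<kappa> Q = F Q *\<^sub>R alpha Q + gradient f (alpha Q))"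
    then obtain F f U where U: "open U" "sphere 0 1 \<subseteq> U" and f: "smooth_on U f"
      and rep: "\<And>Q. Q \<in> SO3 \<Longrightarrow> \<kappa> Q = F Q *\<^sub>R alpha Q + gradient f (alpha Q)" by blast
    let ?g = "\<lambda>P. f (alpha P)"
    have ext: "local_extension SO3 ?g Q (alpha -` U) ?g" if "Q \<in> SO3" for Q
      by (rule local_extension_compose_alpha[OF U f that refl])
    have "frechet_derivative g' (at Q) (Q ** hat w) = \<kappa> Q \<bullet> (alpha Q \<times> w)"
      if Q: "Q \<in> SO3" and g': "local_extension SO3 ?g Q U' g'" for Q U' g' w
    proof -
      have aU: "alpha Q \<in> U" using norm_alpha[OF Q] U(2) by auto
      have "Q ** hat w \<in> tangent_space SO3 Q" by (simp add: tangent_space_SO3[OF Q])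
      from local_extension_derivative_unique[OF g' ext[OF Q] this]
      show ?thesis
        by (simp add: compose_alpha_derivative[OF f aU] rep[OF Q] inner_add_left dot_cross_self)
    qed
    moreover have "smooth_function SO3 ?g"
      unfolding smooth_function_def using ext by blast
    ultimately show "has_area_integral (rigid_body A V \<kappa>)"
      unfolding iff by blast
  qed
qed

end
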